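(* Let $k$ be a positive integer and assume access to a constant-time fully random hash function. Then there exists an algorithm that takes as input a weighted set $x\in\mathbb{R}_{\ge0}^d$ and outputs $k$ independent weighted minhash values $h_1(x),\dots,h_k(x)$ using expected time $O\big(k\log k+\|x\|_0\log(\|x\|_1+1/\|x\|_1)\big)$.
   Context: For $x\in\mathbb{R}_{\ge0}^d$, $\|x\|_0$ is the number of nonzero entries and $\|x\|_1=\sum_i x_i$ (assumed $>0$). The weighted Jaccard similarity of $x,y$ is $J(x,y)=\sum_i\min(x_i,y_i)/\sum_i\max(x_i,y_i)$. A weighted minhash function $h$ is a random function (chosen independently of the inputs) such that for all weighted sets $x,y$, $\Pr[h(x)=h(y)]=J(x,y)$; equivalently, $h(x)$ is the identity/rank of the first dart hitting $x$ in a random sequence of darts thrown uniformly into $\{1,\dots,d\}\times[0,M]$, where a dart $(i,w)$ hits $x$ if $w\le x_i$. "$k$ independent minhash values" means $h_1,\dots,h_k$ are independent such functions, applied consistently to all inputs. *)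

theory Defs
  imports "HOL-Probability.Probability"
begin

section \<open>Weighted sets and weighted minwise hashing\<close>

text \<open>
  A vector of dimension \<open>d\<close> is a function on the naturals that vanishes from \<open>d\<close> on;
  the coordinates are numbered \<open>0, \<dots>, d - 1\<close>.
\<close>

definition supp :: "nat \<Rightarrow> (nat \<Rightarrow> real) \<Rightarrow> nat set" where
  "supp d x = {i. i < d \<and> x i \<noteq> 0}"

definition norm0 :: "nat \<Rightarrow> (nat \<Rightarrow> real) \<Rightarrow> nat" where
  "norm0 d x = card (supp d x)"

definition norm1 :: "nat \<Rightarrow> (nat \<Rightarrow> real) \<Rightarrow> real" where
  "norm1 d x = (\<Sum>i<d. x i)"

definition weighted_sets :: "nat \<Rightarrow> (nat \<Rightarrow> real) set" where
  "weighted_sets d = {x. (\<forall>i. 0 \<le> x i) \<and> (\<forall>i\<ge>d. x i = 0) \<and> 0 < norm1 d x}"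

definition jaccard :: "nat \<Rightarrow> (nat \<Rightarrow> real) \<Rightarrow> (nat \<Rightarrow> real) \<Rightarrow> real" where
  "jaccard d x y = (\<Sum>i<d. min (x i) (y i)) / (\<Sum>i<d. max (x i) (y i))"

text \<open>
  A random function on the weighted sets is a family of random variables on one probability
  space \<open>M\<close>, or equivalently a random variable with values in a product space.
\<close>

definition weighted_minhash ::
    "nat \<Rightarrow> 'w measure \<Rightarrow> ('w \<Rightarrow> (nat \<Rightarrow> real) \<Rightarrow> real) \<Rightarrow> bool" where
  "weighted_minhash d M h \<longleftrightarrow>
     prob_space M \<and>
     (\<forall>x\<in>weighted_sets d. (\<lambda>\<omega>. h \<omega> x) \<in> borel_measurable M) \<and>
     (\<forall>x\<in>weighted_sets d. \<forall>y\<in>weighted_sets d.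
        measure M {\<omega> \<in> space M. h \<omega> x = h \<omega> y} = jaccard d x y)"

text \<open>
  Independence is that of the functions, not merely of their values at a single weighted set.
\<close>

definition indep_weighted_minhashes ::
    "nat \<Rightarrow> nat \<Rightarrow> 'w measure \<Rightarrow> (nat \<Rightarrow> 'w \<Rightarrow> (nat \<Rightarrow> real) \<Rightarrow> real) \<Rightarrow> bool" where
  "indep_weighted_minhashes d k M h \<longleftrightarrow>
     (\<forall>j<k. weighted_minhash d M (h j)) \<and>
     prob_space.indep_vars M
       (\<lambda>_. PiM (weighted_sets d) (\<lambda>_. borel))
       (\<lambda>j \<omega>. restrict (h j \<omega>) (weighted_sets d)) {..<k}"


section \<open>The fully random hash function\<close>

text \<open>
  Keys are finite sequences of naturals; the hash values are independent and uniform on the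
  unit interval.
\<close>

type_synonym hashfun = "nat list \<Rightarrow> real"

definition hash_space :: "hashfun measure" where
  "hash_space = PiM UNIV (\<lambda>_. uniform_measure lborel {0..<1})"


section \<open>A real RAM with a hash oracle\<close>

text \<open>
  Memory consists of named arrays of naturals and of reals, indexed by naturals; a scalar is
  kept in cell 0 of an array. A program mentions only finitely many array names. As usual for a
  real RAM, naturals can only be added, subtracted (truncated at 0) and compared, and there is no
  rounding of reals to naturals. Division, logarithm and exponential are the total functions of
  the library, in particular \<open>x / 0 = 0\<close>.
\<close>

datatype iexp =
    INum nat
  | ICell string iexp
  | IPlus iexp iexp
  | IMinus iexp iexp

datatype rexp =
    RNat iexp
  | RCell string iexp
  | RPlus rexp rexp
  | RMinus rexp rexp
  | RTimes rexp rexp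
  | RDivide rexp rexp
  | RExp rexp
  | RLn rexp

datatype bexp =
    ILess iexp iexp
  | RLess rexp rexp
  | BNot bexp
  | BAnd bexp bexp

text \<open>
  The two hash instructions store, in the addressed cell, the hash value of a key, either as
  a real in the unit interval or scaled to a natural below a given bound.
\<close>

datatype com =
    Skip
  | IAssign string iexp iexp
  | RAssign string iexp rexp
  | RHash string iexp "iexp list"
  | IHash string iexp iexp "iexp list"
  | Seq com com
  | Cond bexp com com
  | While bexp com

record mem =
  imem :: "string \<Rightarrow> nat \<Rightarrow> nat"
  rmem :: "string \<Rightarrow> nat \<Rightarrow> real"

fun ival :: "mem \<Rightarrow> iexp \<Rightarrow> nat" where
  "ival s (INum n) = n"
| "ival s (ICell a e) = imem s a (ival s e)"
| "ival s (IPlus e f) = ival s e + ival s f"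
| "ival s (IMinus e f) = ival s e - ival s f"

fun rval :: "mem \<Rightarrow> rexp \<Rightarrow> real" where
  "rval s (RNat e) = real (ival s e)"
| "rval s (RCell a e) = rmem s a (ival s e)"
| "rval s (RPlus e f) = rval s e + rval s f"
| "rval s (RMinus e f) = rval s e - rval s f"
| "rval s (RTimes e f) = rval s e * rval s f"
| "rval s (RDivide e f) = rval s e / rval s f"
| "rval s (RExp e) = exp (rval s e)"
| "rval s (RLn e) = ln (rval s e)"

fun bval :: "mem \<Rightarrow> bexp \<Rightarrow> bool" where
  "bval s (ILess e f) \<longleftrightarrow> ival s e < ival s f"
| "bval s (RLess e f) \<longleftrightarrow> rval s e < rval s f"
| "bval s (BNot b) \<longleftrightarrow> \<not> bval s b"
| "bval s (BAnd b c) \<longleftrightarrow> bval s b \<and> bval s c"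

definition iset :: "string \<Rightarrow> nat \<Rightarrow> nat \<Rightarrow> mem \<Rightarrow> mem" where
  "iset a i v s = s\<lparr>imem := (imem s)(a := (imem s a)(i := v))\<rparr>"

definition rset :: "string \<Rightarrow> nat \<Rightarrow> real \<Rightarrow> mem \<Rightarrow> mem" where
  "rset a i v s = s\<lparr>rmem := (rmem s)(a := (rmem s a)(i := v))\<rparr>"

text \<open>
  \<open>exec \<omega> c s n t\<close>: with hash function \<open>\<omega>\<close>, the program \<open>c\<close> started in memory \<open>s\<close> halts in
  memory \<open>t\<close> after \<open>n\<close> steps. Assignments, hash queries and tests take one step each; evaluating
  the expressions in them costs at most a constant factor, since their size is fixed by the
  program.
\<close>

inductive exec :: "hashfun \<Rightarrow> com \<Rightarrow> mem \<Rightarrow> nat \<Rightarrow> mem \<Rightarrow> bool" for \<omega> where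
  Skip: "exec \<omega> Skip s 1 s"
| IAssign: "exec \<omega> (IAssign a i e) s 1 (iset a (ival s i) (ival s e) s)"
| RAssign: "exec \<omega> (RAssign a i e) s 1 (rset a (ival s i) (rval s e) s)"
| RHash: "exec \<omega> (RHash a i es) s 1 (rset a (ival s i) (\<omega> (map (ival s) es)) s)"
| IHash: "exec \<omega> (IHash a i m es) s 1
    (iset a (ival s i) (nat \<lfloor>real (ival s m) * \<omega> (map (ival s) es)\<rfloor>) s)"
| Seq: "exec \<omega> c s m t \<Longrightarrow> exec \<omega> c' t n u \<Longrightarrow> exec \<omega> (Seq c c') s (m + n) u"
| CondTrue: "bval s b \<Longrightarrow> exec \<omega> c s n t \<Longrightarrow> exec \<omega> (Cond b c c') s (Suc n) t"
| CondFalse: "\<not> bval s b \<Longrightarrow> exec \<omega> c' s n t \<Longrightarrow> exec \<omega> (Cond b c c') s (Suc n) t"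
| WhileFalse: "\<not> bval s b \<Longrightarrow> exec \<omega> (While b c) s 1 s"
| WhileTrue: "bval s b \<Longrightarrow> exec \<omega> c s m t \<Longrightarrow> exec \<omega> (While b c) t n u \<Longrightarrow>
    exec \<omega> (While b c) s (Suc (m + n)) u"

inductive_cases exec_SkipE: "exec \<omega> Skip s n t"
inductive_cases exec_IAssignE: "exec \<omega> (IAssign a i e) s n t"
inductive_cases exec_RAssignE: "exec \<omega> (RAssign a i e) s n t"
inductive_cases exec_RHashE: "exec \<omega> (RHash a i es) s n t"
inductive_cases exec_IHashE: "exec \<omega> (IHash a i m es) s n t"
inductive_cases exec_SeqE: "exec \<omega> (Seq c c') s n t"
inductive_cases exec_CondE: "exec \<omega> (Cond b c c') s n t"
inductive_cases exec_WhileE: "exec \<omega> (While b c) s n t"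

lemma exec_deterministic:
  "exec \<omega> c s n t \<Longrightarrow> exec \<omega> c s n' t' \<Longrightarrow> n' = n \<and> t' = t"
proof (induction arbitrary: n' t' rule: exec.induct)
  case (Seq c s m t c' n u)
  from Seq.prems show ?case by (rule exec_SeqE) (use Seq.IH in blast)
next
  case (CondTrue s b c n t c')
  from CondTrue.prems show ?case by (rule exec_CondE) (use CondTrue in blast)+
next
  case (CondFalse s b c' n t c)
  from CondFalse.prems show ?case by (rule exec_CondE) (use CondFalse in blast)+
next
  case (WhileFalse s b c)
  from WhileFalse.prems show ?case by (rule exec_WhileE) (use WhileFalse in auto)
next
  case (WhileTrue s b c m t n u)
  from WhileTrue.prems show ?case
    by (rule exec_WhileE) (use WhileTrue.hyps WhileTrue.IH in blast)+
qed (auto elim: exec_SkipE exec_IAssignE exec_RAssignE exec_RHashE exec_IHashE)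

text \<open>
  By determinism the infimum below is over at most one number; it is \<open>\<infinity>\<close> if the program does
  not halt.
\<close>

definition run_time :: "hashfun \<Rightarrow> com \<Rightarrow> mem \<Rightarrow> ennreal" where
  "run_time \<omega> c s = (INF n\<in>{n. \<exists>t. exec \<omega> c s n t}. of_nat n)"

definition expected_time :: "com \<Rightarrow> mem \<Rightarrow> ennreal" where
  "expected_time c s = (\<integral>\<^sup>+\<omega>. run_time \<omega> c s \<partial>hash_space)"


section \<open>Input and output conventions\<close>

text \<open>
  A weighted set is given sparsely: its nonzero coordinates, enumerated without repetition in an
  arbitrary order, together with their weights. All other cells are initially 0.
\<close>

definition enumerates :: "nat list \<Rightarrow> nat set \<Rightarrow> bool" where
  "enumerates xs A \<longleftrightarrow> distinct xs \<and> set xs = A"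

definition input :: "nat \<Rightarrow> nat list \<Rightarrow> (nat \<Rightarrow> real) \<Rightarrow> mem" where
  "input k is x =
     \<lparr>imem = (\<lambda>_ _. 0)
        (''k'' := (\<lambda>_. 0)(0 := k),
         ''len'' := (\<lambda>_. 0)(0 := length is),
         ''index'' := (\<lambda>l. if l < length is then is ! l else 0)),
      rmem = (\<lambda>_ _. 0)
        (''weight'' := (\<lambda>l. if l < length is then x (is ! l) else 0))\<rparr>"

definition outputs :: "hashfun \<Rightarrow> com \<Rightarrow> mem \<Rightarrow> nat \<Rightarrow> (nat \<Rightarrow> real) \<Rightarrow> bool" where
  "outputs \<omega> c s k v \<longleftrightarrow> (\<exists>n t. exec \<omega> c s n t \<and> (\<forall>j<k. rmem t ''out'' j = v j))"

end

theory Submission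
  imports Defs "HOL-Real_Asymp.Real_Asymp"
begin

text \<open>
  Throw darts by a Poisson process of unit intensity on coordinate \<open>\<times>\<close> weight \<open>\<times>\<close> time, put each
  dart into one of \<open>k\<close> bins uniformly at random, and let \<open>h\<^sub>j(x)\<close> be the time of the first dart
  of bin \<open>j\<close> below the graph of \<open>K x\<close>, where \<open>K = k (ln k + 1)\<close>. The event that finitely many
  of these times exceed given bounds says that a region contains no dart, so its probability is
  \<open>exp\<close> of minus the area of that region. This gives independence over the bins, because regions
  of different bins are disjoint, and it gives the joint survival function of \<open>h\<^sub>j(x)\<close> and
  \<open>h\<^sub>j(y)\<close>, from which the collision probability follows by a dyadic discretisation of time.

  The quarter plane of weights and times is tiled by cells of area 1, each of which receives a
  Poisson(1) number of darts read off the hash function. Writing \<open>s\<close> for the norm of \<open>x\<close>, the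
  cells that meet the region below \<open>K x\<close> before time \<open>1/s\<close> number
  \<open>O(K + |supp x| log(s + 1/s))\<close>. If some bin receives no dart by that time, the time horizon is
  doubled and everything is recomputed; the \<open>r\<close>-th horizon fails with probability at most
  \<open>exp(-2^r)\<close>, whereas its cost grows only like \<open>2^r\<close>.
\<close>

section \<open>The hash function\<close>

text \<open>The darts must be the same for all inputs, but a fixed sequence of darts would take too
  long to hit a small set. In a Poisson process disjoint regions are independent, so the darts near
  the graph of one input can be generated alone, cell by cell. Only the time horizon depends on the
  input, and this is harmless: a first hit before the horizon stays the first hit when more of the
  process is inspected. One tiling must therefore serve rectangles of every shape, and the dyadic
  cells cover a rectangle with sides a and b by O(1 + a b + ln (max 1 a) + ln (max 1 b)) of them.

  The factor K stretches the weights and not the time because of these logarithms. Write n for the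
  size of the support. Since ln (K x_i) is at most K x_i / s + ln s, the coordinates together cost K
  + n ln s, up to positive parts. A horizon of K / s with unscaled weights would cost ln (K / s) in
  every coordinate, and n ln k is not within the claimed bound.\<close>

abbreviation unif :: "real measure" where
  "unif \<equiv> uniform_measure lborel {0..<1}"

lemma prob_space_unif: "prob_space unif"
  by (rule prob_space_uniform_measure) auto

interpretation hash_prob: prob_space hash_space
  unfolding hash_space_def by (intro prob_space_PiM prob_space_unif)

lemma space_hash_space [simp]: "space hash_space = UNIV"
  by (simp add: hash_space_def space_PiM)

lemma measurable_hash [measurable]: "(\<lambda>\<omega>. \<omega> a) \<in> borel_measurable hash_space"
proof -
  have "(\<lambda>\<omega>. \<omega> a) \<in> measurable (PiM UNIV (\<lambda>_. unif)) unif"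
    by (rule measurable_component_singleton) simp
  then show ?thesis by (simp add: hash_space_def cong: measurable_cong_sets)
qed

lemma measurable_hash_component:
  "a \<in> J \<Longrightarrow> (\<lambda>\<omega>. \<omega> a) \<in> borel_measurable (PiM J (\<lambda>_. unif))"
  using measurable_component_singleton[of a J "\<lambda>_. unif"]
  by (simp cong: measurable_cong_sets)

lemma indep_vars_hash: "hash_prob.indep_vars (\<lambda>_. unif) (\<lambda>a \<omega>. \<omega> a) UNIV"
proof -
  have 1: "hash_space = PiM UNIV (\<lambda>_. unif)" by (simp add: hash_space_def)
  have m: "(\<lambda>\<omega>. \<omega> a) \<in> measurable hash_space unif" for a
    unfolding 1 by (rule measurable_component_singleton) simp
  have d: "distr hash_space unif (\<lambda>\<omega>. \<omega> a) = unif" for a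
    unfolding 1 by (rule distr_PiM_component) (auto intro: prob_space_unif)
  have "distr hash_space (PiM UNIV (\<lambda>_. unif)) (\<lambda>\<omega>. \<lambda>a\<in>UNIV. \<omega> a) = PiM UNIV (\<lambda>a. distr hash_space unif (\<lambda>\<omega>. \<omega> a))"
    unfolding d restrict_UNIV by (simp add: 1 distr_id2)
  then show ?thesis
    by (subst hash_prob.indep_vars_iff_distr_eq_PiM) (use m in auto)
qed

lemma distr_hash: "distr hash_space unif (\<lambda>\<omega>. \<omega> a) = unif"
  unfolding hash_space_def by (rule distr_PiM_component) (auto intro: prob_space_unif)

lemma emeasure_hash:
  assumes "A \<in> sets borel"
  shows "emeasure hash_space {\<omega>. \<omega> a \<in> A} = emeasure lborel ({0..<1} \<inter> A)"
proof -
  have m: "(\<lambda>\<omega>. \<omega> a) \<in> measurable hash_space unif"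
    using measurable_hash[of a] by (simp cong: measurable_cong_sets)
  have "emeasure unif A = emeasure hash_space ((\<lambda>\<omega>. \<omega> a) -` A \<inter> space hash_space)"
    by (subst distr_hash[of a, symmetric], subst emeasure_distr) (use assms m in auto)
  also have "emeasure unif A = emeasure lborel ({0..<1} \<inter> A)"
    using assms by (simp add: divide_ennreal_def)
  finally show ?thesis by (simp add: vimage_def)
qed

text \<open>The space of \<open>hash_space\<close> contains all real-valued functions on keys.
  Pointwise facts about the program assume this range, which holds almost surely by
  \<open>AE_hash_range\<close>.\<close>

abbreviation unit_valued :: "hashfun \<Rightarrow> bool" where
  "unit_valued \<omega> \<equiv> \<forall>a. 0 \<le> \<omega> a \<and> \<omega> a < 1"

lemma AE_hash_range: "AE \<omega> in hash_space. unit_valued \<omega>"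
proof (subst AE_all_countable, rule allI)
  fix a
  have "emeasure hash_space {\<omega>. \<omega> a \<in> - {0..<1}} = 0"
    by (subst emeasure_hash) auto
  moreover have "{\<omega>. \<omega> a \<in> - {0..<1::real}} \<in> sets hash_space"
    using measurable_sets[OF measurable_hash[of a], of "- {0..<1}"] by (simp add: vimage_def)
  ultimately show "AE \<omega> in hash_space. 0 \<le> \<omega> a \<and> \<omega> a < 1"
    by (intro AE_I'[of "{\<omega>. \<omega> a \<in> - {0..<1}}"]) (auto simp: null_sets_def)
qed

text \<open>Each \<open>f i\<close> reads only the keys in \<open>J i\<close>, and disjoint blocks
  of independent hash values are independent. The blocks will be the keys of different cells, of
  different darts of one cell, and the single keys of one dart.\<close>

lemma nn_integral_hash_prod:
  fixes f :: "'i \<Rightarrow> hashfun \<Rightarrow> ennreal"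
  assumes "finite I" "disjoint_family_on J I"
    and meas: "\<And>i. i \<in> I \<Longrightarrow> f i \<in> borel_measurable (PiM (J i) (\<lambda>_. unif))"
    and local: "\<And>i \<omega>. i \<in> I \<Longrightarrow> f i (restrict \<omega> (J i)) = f i \<omega>"
  shows "(\<integral>\<^sup>+\<omega>. (\<Prod>i\<in>I. f i \<omega>) \<partial>hash_space) = (\<Prod>i\<in>I. \<integral>\<^sup>+\<omega>. f i \<omega> \<partial>hash_space)"
proof -
  have "hash_prob.indep_vars (\<lambda>i. PiM (J i) (\<lambda>_. unif)) (\<lambda>i \<omega>. restrict (\<lambda>a. \<omega> a) (J i)) I"
    by (rule hash_prob.indep_vars_restrict[OF indep_vars_hash]) (use assms in auto)
  then have "hash_prob.indep_vars (\<lambda>_. borel) (\<lambda>i \<omega>. f i (restrict (\<lambda>a. \<omega> a) (J i))) I"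
    by (rule hash_prob.indep_vars_compose2) (rule meas)
  then have "hash_prob.indep_vars (\<lambda>_. borel) f I"
    by (subst (asm) hash_prob.indep_vars_cong) (auto simp: local)
  then show ?thesis
    by (intro hash_prob.indep_vars_nn_integral) (use assms in auto)
qed

text \<open>
  A cell \<open>(i, tp, e, q)\<close> belongs to coordinate \<open>i\<close>. For \<open>tp = 0\<close> its weights are those in
  \<open>[2^e, 2^(e+1))\<close> and its times those in \<open>[q/2^e, (q+1)/2^e)\<close>; for \<open>tp = 1\<close> the roles of weight
  and time are exchanged and \<open>q < 2^e\<close>; for \<open>tp = 2\<close> it is the unit square. Weights are scaled
  by \<open>K\<close>. Hash keys extend a cell by two numbers: \<open>0, 0\<close> for the number of darts, and \<open>n + 1, z\<close>
  with \<open>z < 3\<close> for the two coordinates and the bin of the \<open>n\<close>-th dart.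
\<close>

type_synonym cell = "nat \<times> nat \<times> nat \<times> nat"

fun key :: "cell \<Rightarrow> nat \<Rightarrow> nat \<Rightarrow> nat list" where
  "key (i, tp, e, q) m z = [i, tp, e, q, m, z]"

definition cell_keys :: "cell \<Rightarrow> nat list set" where
  "cell_keys c = {key c m z | m z. True}"

definition dart_keys :: "cell \<Rightarrow> nat \<Rightarrow> nat list set" where
  "dart_keys c m = {key c m z | z. True}"

definition poisson_cdf :: "nat \<Rightarrow> real" where
  "poisson_cdf n = (\<Sum>m\<le>n. exp (-1) / fact m)"

text \<open>Inverse transform sampling: the first n at which the Poisson(1) distribution function
  exceeds a uniform value. Such an n exists if the value is below 1.\<close>

definition num_darts :: "hashfun \<Rightarrow> cell \<Rightarrow> nat" where
  "num_darts \<omega> c = (LEAST n. \<omega> (key c 0 0) < poisson_cdf n)"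

fun long_side :: "cell \<Rightarrow> real \<Rightarrow> real" where
  "long_side (i, tp, e, q) z = (if tp = 2 then 0 else 2 ^ e) + 2 ^ e * z"

fun short_side :: "cell \<Rightarrow> real \<Rightarrow> real" where
  "short_side (i, tp, e, q) z = (real q + z) / 2 ^ e"

fun cell_type :: "cell \<Rightarrow> nat" where
  "cell_type (i, tp, e, q) = tp"

definition dart_bin :: "nat \<Rightarrow> hashfun \<Rightarrow> cell \<Rightarrow> nat \<Rightarrow> nat" where
  "dart_bin k \<omega> c n = nat \<lfloor>real k * \<omega> (key c (Suc n) 2)\<rfloor>"

definition dart_weight :: "hashfun \<Rightarrow> cell \<Rightarrow> nat \<Rightarrow> real" where
  "dart_weight \<omega> c n = (if cell_type c = 0 then long_side c (\<omega> (key c (Suc n) 0))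
     else short_side c (\<omega> (key c (Suc n) 1)))"

definition dart_time :: "hashfun \<Rightarrow> cell \<Rightarrow> nat \<Rightarrow> real" where
  "dart_time \<omega> c n = (if cell_type c = 0 then short_side c (\<omega> (key c (Suc n) 1))
     else long_side c (\<omega> (key c (Suc n) 0)))"

definition dart :: "nat \<Rightarrow> hashfun \<Rightarrow> cell \<Rightarrow> nat \<Rightarrow> nat \<times> nat \<times> real \<times> real" where
  "dart k \<omega> c n = (dart_bin k \<omega> c n, fst c, dart_weight \<omega> c n, dart_time \<omega> c n)"

text \<open>Weights from 1 on belong to type 0, smaller weights with times from 1 on to type 1, the
  remaining unit square to type 2. The condition \<open>q < 2 ^ e\<close> keeps type 1 below weight
  1, so that every point of the quarter plane lies in exactly one cell of its coordinate.\<close>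

definition all_cells :: "cell set" where
  "all_cells = {(i, tp, e, q). tp = 0 \<or> tp = 1 \<and> q < 2 ^ e \<or> tp = 2 \<and> e = 0 \<and> q = 0}"

abbreviation dart_space :: "(nat \<times> nat \<times> real \<times> real) measure" where
  "dart_space \<equiv> count_space UNIV \<Otimes>\<^sub>M count_space UNIV \<Otimes>\<^sub>M borel \<Otimes>\<^sub>M borel"

section \<open>Measurability and locality of counts and darts\<close>

lemma key_inj [simp]: "key c m z = key c' m' z' \<longleftrightarrow> c = c' \<and> m = m' \<and> z = z'"
  by (cases c; cases c') auto

lemma measurable_long_side [measurable]: "long_side c \<in> borel_measurable borel"
proof -
  obtain i tp e q where c: "c = (i, tp, e, q)" by (cases c)
  have "long_side c = (\<lambda>z. (if tp = 2 then 0 else 2 ^ e) + 2 ^ e * z)" by (simp add: c fun_eq_iff)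
  then show ?thesis by simp
qed

lemma measurable_short_side [measurable]: "short_side c \<in> borel_measurable borel"
proof -
  obtain i tp e q where c: "c = (i, tp, e, q)" by (cases c)
  have "short_side c = (\<lambda>z. (real q + z) / 2 ^ e)" by (simp add: c fun_eq_iff)
  then show ?thesis by simp
qed

lemma hash_event: "Measurable.pred hash_space P \<Longrightarrow> {\<omega>. P \<omega>} \<in> sets hash_space"
  by (simp add: pred_def)

lemma measurable_num_darts:
  assumes "key c 0 0 \<in> J"
  shows "(\<lambda>\<omega>. num_darts \<omega> c) \<in> measurable (PiM J (\<lambda>_. unif)) (count_space UNIV)"
  unfolding num_darts_def
  using measurable_hash_component[OF assms, measurable] by measurable

lemma measurable_dart:
  assumes "\<And>z. key c (Suc n) z \<in> J"
  shows "(\<lambda>\<omega>. dart k \<omega> c n) \<in> measurable (PiM J (\<lambda>_. unif)) dart_space"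
proof -
  note m = measurable_hash_component[OF assms]
  have [measurable]: "(\<lambda>\<omega>. \<omega> (key c (Suc n) 0)) \<in> borel_measurable (PiM J (\<lambda>_. unif))"
     "(\<lambda>\<omega>. \<omega> (key c (Suc n) 1)) \<in> borel_measurable (PiM J (\<lambda>_. unif))"
     "(\<lambda>\<omega>. \<omega> (key c (Suc n) 2)) \<in> borel_measurable (PiM J (\<lambda>_. unif))"
    by (rule m)+
  show ?thesis
    unfolding dart_def dart_bin_def dart_weight_def dart_time_def
    by measurable
qed

lemma measurable_num_darts_hash [measurable]:
  "(\<lambda>\<omega>. num_darts \<omega> c) \<in> measurable hash_space (count_space UNIV)"
  unfolding hash_space_def by (rule measurable_num_darts) simp

lemma measurable_dart_hash [measurable]:
  "(\<lambda>\<omega>. dart k \<omega> c n) \<in> measurable hash_space dart_space"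
  unfolding hash_space_def by (rule measurable_dart) simp

lemma num_darts_restrict: "key c 0 0 \<in> J \<Longrightarrow> num_darts (restrict \<omega> J) c = num_darts \<omega> c"
  by (simp add: num_darts_def)

lemma dart_restrict: "(\<And>z. key c (Suc n) z \<in> J) \<Longrightarrow> dart k (restrict \<omega> J) c n = dart k \<omega> c n"
  by (simp add: dart_def dart_bin_def dart_weight_def dart_time_def)

section \<open>The laws of the number of darts and of a single dart\<close>

lemma poisson_cdf_less_1: "poisson_cdf n < 1"
proof -
  have s: "(\<lambda>m. exp (-1) * (1 / fact m)) sums (exp (-1) * exp (1::real))"
    using exp_converges[of "1::real"] by (intro sums_mult) (simp add: divide_inverse)
  have "(\<Sum>m<Suc n. exp (-1) * (1 / fact m :: real)) < (\<Sum>m. exp (-1) * (1 / fact m))"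
    by (rule sum_less_suminf[OF sums_summable[OF s]]) auto
  also have "\<dots> = 1" using sums_unique[OF s] by (simp add: exp_minus)
  finally show ?thesis by (simp add: poisson_cdf_def lessThan_Suc_atMost)
qed

lemma poisson_cdf_LIMSEQ: "poisson_cdf \<longlonglongrightarrow> 1"
proof -
  have s: "(\<lambda>m. exp (-1) * (1 / fact m)) sums (exp (-1) * exp (1::real))"
    using exp_converges[of "1::real"] by (intro sums_mult) (simp add: divide_inverse)
  then show ?thesis
    by (simp add: sums_def_le exp_minus poisson_cdf_def[abs_def])
qed

lemma poisson_cdf_exceeds: "u < 1 \<Longrightarrow> \<exists>n. u < poisson_cdf n"
  using order_tendstoD(1)[OF poisson_cdf_LIMSEQ, of u] by (auto simp: eventually_sequentially)

lemma poisson_cdf_mono: "m \<le> n \<Longrightarrow> poisson_cdf m \<le> poisson_cdf n"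
  unfolding poisson_cdf_def by (intro sum_mono2) auto

lemma num_darts_le_iff:
  assumes "\<omega> (key c 0 0) < 1"
  shows "num_darts \<omega> c \<le> n \<longleftrightarrow> \<omega> (key c 0 0) < poisson_cdf n"
proof
  assume "num_darts \<omega> c \<le> n"
  moreover have "\<omega> (key c 0 0) < poisson_cdf (num_darts \<omega> c)"
    unfolding num_darts_def by (rule LeastI_ex) (rule poisson_cdf_exceeds[OF assms])
  ultimately show "\<omega> (key c 0 0) < poisson_cdf n" using poisson_cdf_mono by fastforce
qed (auto simp: num_darts_def intro: Least_le)

lemma emeasure_num_darts:
  "emeasure hash_space {\<omega>. num_darts \<omega> c = n} = ennreal (exp (-1) / fact n)"
proof -
  \<comment> \<open>The count is n when the uniform value lies between the distribution function at
    n - 1 and at n; \<open>a\<close> is the left end, which is 0 for n = 0.\<close>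
  define a where "a = (if n = 0 then 0 else poisson_cdf (n - 1))"
  have ae: "AE \<omega> in hash_space. \<omega> \<in> {\<omega>. num_darts \<omega> c = n} \<longleftrightarrow> \<omega> \<in> {\<omega>. \<omega> (key c 0 0) \<in> {a..<poisson_cdf n}}"
    using AE_hash_range
  proof eventually_elim
    case (elim \<omega>)
    then have u: "0 \<le> \<omega> (key c 0 0)" "\<omega> (key c 0 0) < 1" by auto
    have "num_darts \<omega> c = n \<longleftrightarrow> num_darts \<omega> c \<le> n \<and> (n = 0 \<or> \<not> num_darts \<omega> c \<le> n - 1)"
      by auto
    then show ?case using u by (auto simp: num_darts_le_iff a_def)
  qed
  have a0: "0 \<le> a" by (auto simp: a_def poisson_cdf_def intro!: sum_nonneg)
  have d: "poisson_cdf n = a + exp (-1) / fact n"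
    by (cases n) (auto simp: a_def poisson_cdf_def)
  have "emeasure hash_space {\<omega>. num_darts \<omega> c = n} = emeasure hash_space {\<omega>. \<omega> (key c 0 0) \<in> {a..<poisson_cdf n}}"
    by (rule emeasure_eq_AE[OF ae]; rule hash_event) measurable
  also have "\<dots> = emeasure lborel ({0..<1} \<inter> {a..<poisson_cdf n})"
    by (rule emeasure_hash) simp
  also have "{0..<1} \<inter> {a..<poisson_cdf n} = {a..<poisson_cdf n}"
    using a0 poisson_cdf_less_1[of n] by auto
  finally show ?thesis using d by simp
qed

text \<open>Every dart of a cell is the same function \<open>D\<close> of three hash values, and the
  joint law of the three does not depend on the index of the dart.\<close>

lemma dart_law:
  "distr hash_space dart_space (\<lambda>\<omega>. dart k \<omega> c n) = distr hash_space dart_space (\<lambda>\<omega>. dart k \<omega> c m)"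
proof -
  define f where "f = (\<lambda>n. \<lambda>z\<in>{..<3::nat}. key c (Suc n) z)"
  define D where "D = (\<lambda>y :: nat \<Rightarrow> real. (nat \<lfloor>real k * y 2\<rfloor>, fst c,
     if cell_type c = 0 then long_side c (y 0) else short_side c (y 1),
     if cell_type c = 0 then short_side c (y 1) else long_side c (y 0)))"
  have c: "(\<lambda>y. y z) \<in> borel_measurable (PiM {..<3::nat} (\<lambda>_. unif))" if "z < 3" for z
    using measurable_component_singleton[of z "{..<3::nat}" "\<lambda>_. unif"] that
    by (simp cong: measurable_cong_sets)
  have [measurable]: "(\<lambda>y. y 0) \<in> borel_measurable (PiM {..<3::nat} (\<lambda>_. unif))"
     "(\<lambda>y. y 1) \<in> borel_measurable (PiM {..<3::nat} (\<lambda>_. unif))"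
     "(\<lambda>y. y 2) \<in> borel_measurable (PiM {..<3::nat} (\<lambda>_. unif))"
    by (auto intro!: c)
  have D: "D \<in> measurable (PiM {..<3::nat} (\<lambda>_. unif)) dart_space"
    unfolding D_def by measurable
  have "distr hash_space dart_space (\<lambda>\<omega>. dart k \<omega> c n) = distr (PiM {..<3::nat} (\<lambda>_. unif)) dart_space D" for n
  proof -
    have "PiM {..<3::nat} (\<lambda>_. unif) = distr hash_space (PiM {..<3::nat} (\<lambda>_. unif)) (\<lambda>\<omega>. \<lambda>z\<in>{..<3}. \<omega> (key c (Suc n) z))"
      unfolding hash_space_def
      by (rule distr_PiM_reindex[symmetric]) (auto intro: prob_space_unif inj_onI)
    then have "distr (PiM {..<3::nat} (\<lambda>_. unif)) dart_space D =
      distr (distr hash_space (PiM {..<3::nat} (\<lambda>_. unif)) (\<lambda>\<omega>. \<lambda>z\<in>{..<3}. \<omega> (key c (Suc n) z))) dart_space D"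
      by simp
    also have "\<dots> = distr hash_space dart_space (D \<circ> (\<lambda>\<omega>. \<lambda>z\<in>{..<3}. \<omega> (key c (Suc n) z)))"
    proof (rule distr_distr[OF D])
      show "(\<lambda>\<omega>. \<lambda>z\<in>{..<3}. \<omega> (key c (Suc n) z)) \<in> measurable hash_space (PiM {..<3::nat} (\<lambda>_. unif))"
        unfolding hash_space_def by (rule measurable_restrict) simp
    qed
    also have "D \<circ> (\<lambda>\<omega>. \<lambda>z\<in>{..<3}. \<omega> (key c (Suc n) z)) = (\<lambda>\<omega>. dart k \<omega> c n)"
      by (auto simp: D_def dart_def dart_bin_def dart_weight_def dart_time_def)
    finally show ?thesis by simp
  qed
  then show ?thesis by metis
qed

text \<open>By \<open>dart_law\<close> dart 0 stands for any dart. As the number of darts has mean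
  1, this is also the expected number of darts of the cell in a measurable set \<open>A\<close>,
  that is, the intensity of the process there.\<close>

definition hit_prob :: "nat \<Rightarrow> cell \<Rightarrow> (nat \<times> nat \<times> real \<times> real) set \<Rightarrow> real" where
  "hit_prob k c A = measure hash_space {\<omega>. dart k \<omega> c 0 \<in> A}"

lemma emeasure_dart:
  assumes "A \<in> sets dart_space"
  shows "emeasure hash_space {\<omega>. dart k \<omega> c n \<in> A} = ennreal (hit_prob k c A)"
proof -
  have "emeasure hash_space {\<omega>. dart k \<omega> c m \<in> A} = emeasure (distr hash_space dart_space (\<lambda>\<omega>. dart k \<omega> c m)) A" for m
    by (subst emeasure_distr) (use assms in \<open>auto simp: vimage_def\<close>)
  then have "emeasure hash_space {\<omega>. dart k \<omega> c n \<in> A} = emeasure hash_space {\<omega>. dart k \<omega> c 0 \<in> A}"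
    using dart_law[of k c n 0] by simp
  then show ?thesis by (simp add: hit_prob_def hash_prob.emeasure_eq_measure)
qed

lemma hit_prob_bounds: "0 \<le> hit_prob k c A" "hit_prob k c A \<le> 1"
  by (auto simp: hit_prob_def)

section \<open>Void probabilities, and the expected cost on a void event\<close>

definition misses :: "nat \<Rightarrow> hashfun \<Rightarrow> cell \<Rightarrow> (nat \<times> nat \<times> real \<times> real) set \<Rightarrow> bool" where
  "misses k \<omega> c A \<longleftrightarrow> (\<forall>n<num_darts \<omega> c. dart k \<omega> c n \<notin> A)"

lemma measurable_misses:
  assumes "\<And>m z. key c m z \<in> J" "A \<in> sets dart_space"
  shows "Measurable.pred (PiM J (\<lambda>_. unif)) (\<lambda>\<omega>. misses k \<omega> c A)"
proof -
  note [measurable] = measurable_num_darts[OF assms(1)] measurable_dart[OF assms(1)] assms(2)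
  show ?thesis unfolding misses_def by measurable
qed

lemma measurable_misses_hash [measurable]:
  "A \<in> sets dart_space \<Longrightarrow> Measurable.pred hash_space (\<lambda>\<omega>. misses k \<omega> c A)"
  unfolding hash_space_def by (rule measurable_misses) simp

lemma emeasure_cell_misses:
  assumes A: "A \<in> sets dart_space"
  shows "emeasure hash_space {\<omega>. num_darts \<omega> c = n \<and> (\<forall>m<n. dart k \<omega> c m \<notin> A)}
    = ennreal (exp (-1) / fact n * (1 - hit_prob k c A) ^ n)"
proof -
  \<comment> \<open>Factor 0 is the count and factor m + 1 the m-th dart, in accordance with the
    numbers in their hash keys; so factor i reads exactly from \<open>dart_keys c i\<close>.\<close>
  define f where "f i \<omega> = (case i of 0 \<Rightarrow> indicator {\<omega>. num_darts \<omega> c = n} \<omega>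
     | Suc m \<Rightarrow> (indicator {\<omega>. dart k \<omega> c m \<notin> A} \<omega> :: ennreal))" for i \<omega>
  have fi: "(\<integral>\<^sup>+\<omega>. f i \<omega> \<partial>hash_space) = (case i of 0 \<Rightarrow> ennreal (exp (-1) / fact n) | Suc m \<Rightarrow> ennreal (1 - hit_prob k c A))" for i
  proof (cases i)
    case 0
    have "{\<omega>. num_darts \<omega> c = n} \<in> sets hash_space" by (rule hash_event) measurable
    then show ?thesis using 0 by (simp add: f_def emeasure_num_darts)
  next
    case (Suc m)
    note [measurable] = A
    have "emeasure hash_space {\<omega>. dart k \<omega> c m \<notin> A} = ennreal (1 - measure hash_space {\<omega>. dart k \<omega> c m \<in> A})"
      using hash_prob.prob_compl[of "{\<omega>. dart k \<omega> c m \<in> A}"] hash_event[of "\<lambda>\<omega>. dart k \<omega> c m \<in> A"]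
      by (simp add: hash_prob.emeasure_eq_measure Compl_eq_Diff_UNIV[symmetric] Collect_neg_eq)
    also have "measure hash_space {\<omega>. dart k \<omega> c m \<in> A} = hit_prob k c A"
      using emeasure_dart[OF A, of k c m] by (simp add: hash_prob.emeasure_eq_measure hit_prob_bounds)
    finally have "emeasure hash_space {\<omega>. dart k \<omega> c m \<notin> A} = ennreal (1 - hit_prob k c A)" .
    moreover have "{\<omega>. dart k \<omega> c m \<notin> A} \<in> sets hash_space" by (rule hash_event) measurable
    ultimately show ?thesis using Suc by (simp add: f_def)
  qed
  have "(\<integral>\<^sup>+\<omega>. (\<Prod>i\<le>n. f i \<omega>) \<partial>hash_space) = (\<Prod>i\<le>n. \<integral>\<^sup>+\<omega>. f i \<omega> \<partial>hash_space)"
  proof (rule nn_integral_hash_prod[where J = "dart_keys c"])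
    show "disjoint_family_on (dart_keys c) {..n}"
      by (auto simp: disjoint_family_on_def dart_keys_def)
    fix i
    have [measurable]: "(\<lambda>\<omega>. num_darts \<omega> c) \<in> measurable (PiM (dart_keys c 0) (\<lambda>_. unif)) (count_space UNIV)"
      by (rule measurable_num_darts) (auto simp: dart_keys_def)
    have [measurable]: "(\<lambda>\<omega>. dart k \<omega> c m) \<in> measurable (PiM (dart_keys c (Suc m)) (\<lambda>_. unif)) dart_space" for m
      by (rule measurable_dart) (auto simp: dart_keys_def)
    note [measurable] = A
    show "f i \<in> borel_measurable (PiM (dart_keys c i) (\<lambda>_. unif))"
      unfolding f_def by (cases i) (simp_all, measurable)
    show "f i (restrict \<omega> (dart_keys c i)) = f i \<omega>" for \<omega>
      unfolding f_def by (cases i) (auto simp: indicator_def num_darts_restrict dart_restrict dart_keys_def)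
  qed simp
  also have "(\<Prod>i\<le>n. \<integral>\<^sup>+\<omega>. f i \<omega> \<partial>hash_space) = (\<Prod>i\<le>n. (case i of 0 \<Rightarrow> ennreal (exp (-1) / fact n) | Suc m \<Rightarrow> ennreal (1 - hit_prob k c A)))"
    by (simp add: fi)
  also have "(\<Prod>i\<le>n. (case i of 0 \<Rightarrow> ennreal (exp (-1) / fact n) | Suc m \<Rightarrow> ennreal (1 - hit_prob k c A)))
     = ennreal (exp (-1) / fact n * (1 - hit_prob k c A) ^ n)"
    by (subst ennreal_mult) (auto simp: prod.atMost_shift ennreal_power hit_prob_bounds)
  also have "(\<integral>\<^sup>+\<omega>. (\<Prod>i\<le>n. f i \<omega>) \<partial>hash_space) = (\<integral>\<^sup>+\<omega>. indicator {\<omega>. num_darts \<omega> c = n \<and> (\<forall>m<n. dart k \<omega> c m \<notin> A)} \<omega> \<partial>hash_space)"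
  proof (rule nn_integral_cong)
    fix \<omega>
    have "(\<Prod>m<n. indicator {\<omega>. dart k \<omega> c m \<notin> A} \<omega> :: ennreal) = indicator {\<omega>. \<forall>m<n. dart k \<omega> c m \<notin> A} \<omega>"
      by (induction n) (auto simp: indicator_def less_Suc_eq)
    then show "(\<Prod>i\<le>n. f i \<omega>) = indicator {\<omega>. num_darts \<omega> c = n \<and> (\<forall>m<n. dart k \<omega> c m \<notin> A)} \<omega>"
      by (auto simp: prod.atMost_shift f_def indicator_def)
  qed
  also have "\<dots> = emeasure hash_space {\<omega>. num_darts \<omega> c = n \<and> (\<forall>m<n. dart k \<omega> c m \<notin> A)}"
  proof (rule nn_integral_indicator)
    note [measurable] = A
    have "{\<omega> \<in> space hash_space. num_darts \<omega> c = n \<and> (\<forall>m<n. dart k \<omega> c m \<notin> A)} \<in> sets hash_space"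
      by measurable
    then show "{\<omega>. num_darts \<omega> c = n \<and> (\<forall>m<n. dart k \<omega> c m \<notin> A)} \<in> sets hash_space" by simp
  qed
  finally show ?thesis by simp
qed

text \<open>Summation over the value of the count. The weight \<open>g\<close> is 1 for void
  probabilities and 1 + n for the cost of a cell.\<close>

lemma nn_integral_cell:
  assumes A: "A \<in> sets dart_space" and g: "\<And>n. 0 \<le> g n"
    and s: "(\<lambda>n. g n * (exp (-1) / fact n * (1 - hit_prob k c A) ^ n)) sums S"
  shows "(\<integral>\<^sup>+\<omega>. ennreal (g (num_darts \<omega> c)) * indicator {\<omega>. misses k \<omega> c A} \<omega> \<partial>hash_space) = ennreal S"
proof -
  note [measurable] = A
  define E where "E n = {\<omega>. num_darts \<omega> c = n \<and> (\<forall>m<n. dart k \<omega> c m \<notin> A)}" for n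
  have "{\<omega> \<in> space hash_space. num_darts \<omega> c = n \<and> (\<forall>m<n. dart k \<omega> c m \<notin> A)} \<in> sets hash_space" for n
    by measurable
  then have [measurable]: "E n \<in> sets hash_space" for n by (simp add: E_def)
  have "ennreal (g (num_darts \<omega> c)) * indicator {\<omega>. misses k \<omega> c A} \<omega> = (\<Sum>n. ennreal (g n) * indicator (E n) \<omega>)" for \<omega>
  proof -
    have "(\<Sum>n. ennreal (g n) * indicator (E n) \<omega>) = (\<Sum>n\<in>{num_darts \<omega> c}. ennreal (g n) * indicator (E n) \<omega>)"
      by (rule suminf_finite) (auto simp: E_def)
    then show ?thesis by (simp add: E_def misses_def indicator_def)
  qed
  then have "(\<integral>\<^sup>+\<omega>. ennreal (g (num_darts \<omega> c)) * indicator {\<omega>. misses k \<omega> c A} \<omega> \<partial>hash_space)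
      = (\<integral>\<^sup>+\<omega>. (\<Sum>n. ennreal (g n) * indicator (E n) \<omega>) \<partial>hash_space)" by simp
  also have "\<dots> = (\<Sum>n. ennreal (g n) * emeasure hash_space (E n))"
    by (subst nn_integral_suminf) (auto simp: nn_integral_cmult_indicator)
  also have "\<dots> = (\<Sum>n. ennreal (g n * (exp (-1) / fact n * (1 - hit_prob k c A) ^ n)))"
    unfolding E_def emeasure_cell_misses[OF A]
    by (intro suminf_cong, subst ennreal_mult) (auto simp: g hit_prob_bounds)
  also have "\<dots> = ennreal S"
    using s g by (intro suminf_ennreal_eq) (auto intro!: mult_nonneg_nonneg simp: hit_prob_bounds)
  finally show ?thesis .
qed

text \<open>The generating function of the Poisson(1) law at 1 - a.\<close>

lemma exp_poisson_sums: "(\<lambda>n. exp (-1) / fact n * (1 - a) ^ n) sums exp (- a :: real)"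
proof -
  have "(\<lambda>n. exp (-1) * ((1 - a) ^ n /\<^sub>R fact n)) sums (exp (-1) * exp (1 - a))"
    by (intro sums_mult exp_converges)
  then show ?thesis by (simp add: exp_add[symmetric] divide_inverse mult_ac)
qed

lemma cell_misses_prob:
  assumes A: "A \<in> sets dart_space"
  shows "(\<integral>\<^sup>+\<omega>. indicator {\<omega>. misses k \<omega> c A} \<omega> \<partial>hash_space) = ennreal (exp (- hit_prob k c A))"
  using nn_integral_cell[OF A, of "\<lambda>_. 1", OF _ ] exp_poisson_sums[of "hit_prob k c A"] by simp

text \<open>Given that the cell misses \<open>A\<close>, its count is Poisson with mean 1 - a for
  the hitting probability a of one dart. So the conditional mean of 1 + count is 2 - a, at most
  2.\<close>

lemma cell_misses_cost:
  assumes A: "A \<in> sets dart_space"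
  shows "(\<integral>\<^sup>+\<omega>. ennreal (1 + real (num_darts \<omega> c)) * indicator {\<omega>. misses k \<omega> c A} \<omega> \<partial>hash_space)
     \<le> ennreal (2 * exp (- hit_prob k c A))"
proof -
  define a where "a = hit_prob k c A"
  have "(\<lambda>n. real (Suc n) * (exp (-1) / fact (Suc n) * (1 - a) ^ Suc n)) sums ((1 - a) * exp (- a))"
    using sums_mult[OF exp_poisson_sums[of a], of "1 - a"]
    by (simp add: mult_ac del: of_nat_Suc)
  then have "(\<lambda>n. real n * (exp (-1) / fact n * (1 - a) ^ n)) sums ((1 - a) * exp (- a))"
    by (subst (asm) sums_Suc_iff) simp
  from sums_add[OF exp_poisson_sums[of a] this]
  have "(\<lambda>n. (1 + real n) * (exp (-1) / fact n * (1 - a) ^ n)) sums (exp (- a) + (1 - a) * exp (- a))"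
    by (rule sums_cong[THEN iffD1, rotated]) (simp add: distrib_right add_divide_distrib)
  from nn_integral_cell[OF A _ this[unfolded a_def]]
  have "(\<integral>\<^sup>+\<omega>. ennreal (1 + real (num_darts \<omega> c)) * indicator {\<omega>. misses k \<omega> c A} \<omega> \<partial>hash_space)
     = ennreal (exp (- a) + (1 - a) * exp (- a))" by (simp add: a_def)
  also have "\<dots> \<le> ennreal (2 * exp (- a))"
    using hit_prob_bounds[of k c A] by (intro ennreal_leI) (simp add: a_def algebra_simps)
  finally show ?thesis by (simp add: a_def)
qed

lemma nn_integral_cells_prod:
  assumes C: "finite C" and A: "A \<in> sets dart_space"
  shows "(\<integral>\<^sup>+\<omega>. (\<Prod>c\<in>C. ennreal (g c (num_darts \<omega> c)) * indicator {\<omega>. misses k \<omega> c A} \<omega>) \<partial>hash_space)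
    = (\<Prod>c\<in>C. \<integral>\<^sup>+\<omega>. ennreal (g c (num_darts \<omega> c)) * indicator {\<omega>. misses k \<omega> c A} \<omega> \<partial>hash_space)"
proof (rule nn_integral_hash_prod[where J = cell_keys])
  show "disjoint_family_on cell_keys C"
    by (auto simp: disjoint_family_on_def cell_keys_def)
  fix c
  have [simp]: "key c m z \<in> cell_keys c" for m z by (auto simp: cell_keys_def)
  have [measurable]: "(\<lambda>\<omega>. num_darts \<omega> c) \<in> measurable (PiM (cell_keys c) (\<lambda>_. unif)) (count_space UNIV)"
    by (rule measurable_num_darts) simp
  have [measurable]: "Measurable.pred (PiM (cell_keys c) (\<lambda>_. unif)) (\<lambda>\<omega>. misses k \<omega> c A)"
    by (rule measurable_misses[OF _ A]) simp
  show "(\<lambda>\<omega>. ennreal (g c (num_darts \<omega> c)) * indicator {\<omega>. misses k \<omega> c A} \<omega>) \<in> borel_measurable (PiM (cell_keys c) (\<lambda>_. unif))"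
    by measurable
  show "ennreal (g c (num_darts (restrict \<omega> (cell_keys c)) c)) * indicator {\<omega>. misses k \<omega> c A} (restrict \<omega> (cell_keys c))
      = ennreal (g c (num_darts \<omega> c)) * indicator {\<omega>. misses k \<omega> c A} \<omega>" for \<omega>
    by (simp add: misses_def indicator_def num_darts_restrict dart_restrict)
qed (rule C)

lemma prod_indicator_misses:
  "finite C \<Longrightarrow> (\<Prod>c\<in>C. indicator {\<omega>. misses k \<omega> c A} \<omega> :: ennreal) = indicator {\<omega>. \<forall>c\<in>C. misses k \<omega> c A} \<omega>"
  by (induction C rule: finite_induct) (auto simp: indicator_def)

lemma misses_all_meas [measurable]:
  assumes "A \<in> sets dart_space" "countable C"
  shows "{\<omega>. \<forall>c\<in>C. misses k \<omega> c A} \<in> sets hash_space"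
proof -
  have "{\<omega>. \<forall>c\<in>C. misses k \<omega> c A} = {\<omega>\<in>space hash_space. \<forall>c\<in>C. misses k \<omega> c A}" by simp
  also have "\<dots> \<in> sets hash_space"
    by (intro sets.sets_Collect_countable_Ball assms(2)) (simp add: hash_event measurable_misses_hash assms(1))
  finally show ?thesis .
qed

text \<open>The void probability of a Poisson process. Cells have disjoint keys, so the
  probabilities of single cells multiply and the exponents add up to the intensity of
  \<open>A\<close>.\<close>

lemma emeasure_misses:
  assumes C: "finite C" and A: "A \<in> sets dart_space"
  shows "emeasure hash_space {\<omega>. \<forall>c\<in>C. misses k \<omega> c A} = ennreal (exp (- (\<Sum>c\<in>C. hit_prob k c A)))"
proof -
  have "emeasure hash_space {\<omega>. \<forall>c\<in>C. misses k \<omega> c A} = (\<integral>\<^sup>+\<omega>. indicator {\<omega>. \<forall>c\<in>C. misses k \<omega> c A} \<omega> \<partial>hash_space)"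
    using assms by (simp add: countable_finite misses_all_meas)
  also have "\<dots> = (\<integral>\<^sup>+\<omega>. (\<Prod>c\<in>C. ennreal 1 * indicator {\<omega>. misses k \<omega> c A} \<omega>) \<partial>hash_space)"
    using C by (simp add: prod_indicator_misses)
  also have "\<dots> = (\<Prod>c\<in>C. ennreal (exp (- hit_prob k c A)))"
    by (subst nn_integral_cells_prod[OF C A, of "\<lambda>_ _. 1"]) (simp add: cell_misses_prob[OF A])
  also have "\<dots> = ennreal (exp (- (\<Sum>c\<in>C. hit_prob k c A)))"
    using C by (simp add: prod_ennreal exp_sum sum_negf[symmetric])
  finally show ?thesis .
qed

text \<open>
  Conditioning on a void region can only decrease the number of darts; this decouples the cost of
  a round from the failure of the previous one.
\<close>

lemma misses_cost:
  assumes C: "finite C" and A: "A \<in> sets dart_space" and c0: "c0 \<in> C"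
  shows "(\<integral>\<^sup>+\<omega>. ennreal (1 + real (num_darts \<omega> c0)) * indicator {\<omega>. \<forall>c\<in>C. misses k \<omega> c A} \<omega> \<partial>hash_space)
    \<le> 2 * emeasure hash_space {\<omega>. \<forall>c\<in>C. misses k \<omega> c A}"
proof -
  \<comment> \<open>Only \<open>c0\<close> carries the weight 1 + n; hence the factor 2 of
    \<open>cell_misses_cost\<close> enters once.\<close>
  define g where "g c n = (if c = c0 then 1 + real n else 1)" for c :: cell and n :: nat
  have "(\<integral>\<^sup>+\<omega>. ennreal (1 + real (num_darts \<omega> c0)) * indicator {\<omega>. \<forall>c\<in>C. misses k \<omega> c A} \<omega> \<partial>hash_space)
    = (\<integral>\<^sup>+\<omega>. (\<Prod>c\<in>C. ennreal (g c (num_darts \<omega> c)) * indicator {\<omega>. misses k \<omega> c A} \<omega>) \<partial>hash_space)"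
    using C c0 by (simp add: prod.distrib prod_indicator_misses g_def if_distrib[of ennreal] prod.delta cong: if_cong)
  also have "\<dots> = (\<Prod>c\<in>C. \<integral>\<^sup>+\<omega>. ennreal (g c (num_darts \<omega> c)) * indicator {\<omega>. misses k \<omega> c A} \<omega> \<partial>hash_space)"
    by (rule nn_integral_cells_prod[OF C A])
  also have "\<dots> \<le> (\<Prod>c\<in>C. (if c = c0 then 2 else 1) * ennreal (exp (- hit_prob k c A)))"
    using cell_misses_cost[OF A, of c0 k] cell_misses_prob[OF A, of k]
    by (intro prod_mono_ennreal) (auto simp: g_def ennreal_mult)
  also have "\<dots> = 2 * emeasure hash_space {\<omega>. \<forall>c\<in>C. misses k \<omega> c A}"
    using C c0 by (simp add: emeasure_misses[OF C A] prod.distrib prod_ennreal exp_sum sum_negf[symmetric] prod.delta)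
  finally show ?thesis .
qed

section \<open>Cells\<close>

fun long_low :: "cell \<Rightarrow> real" where
  "long_low (i, tp, e, q) = (if tp = 2 then 0 else 2 ^ e)"

fun short_low :: "cell \<Rightarrow> real" where
  "short_low (i, tp, e, q) = real q / 2 ^ e"

fun scale :: "cell \<Rightarrow> real" where
  "scale (i, tp, e, q) = 2 ^ e"

text \<open>Half-open, so that neighbouring cells are disjoint and each cell contains its lower
  corner.\<close>

definition long_ivl :: "cell \<Rightarrow> real set" where
  "long_ivl c = {long_low c..<long_low c + scale c}"

definition short_ivl :: "cell \<Rightarrow> real set" where
  "short_ivl c = {short_low c..<short_low c + 1 / scale c}"

definition weight_ivl :: "cell \<Rightarrow> real set" where
  "weight_ivl c = (if cell_type c = 0 then long_ivl c else short_ivl c)"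

definition time_ivl :: "cell \<Rightarrow> real set" where
  "time_ivl c = (if cell_type c = 0 then short_ivl c else long_ivl c)"

text \<open>The lower corner of a cell, with \<open>time_low\<close>, decides whether the cell has
  to be visited.\<close>

definition weight_low :: "cell \<Rightarrow> real" where
  "weight_low c = (if cell_type c = 0 then long_low c else short_low c)"

definition time_low :: "cell \<Rightarrow> real" where
  "time_low c = (if cell_type c = 0 then short_low c else long_low c)"

lemma long_side_eq: "long_side c z = long_low c + scale c * z"
  by (cases c) auto

lemma short_side_eq: "short_side c z = short_low c + 1 / scale c * z"
  by (cases c) (auto simp: add_divide_distrib)

lemma scale_pos [simp]: "scale c > 0"
  by (cases c) auto

lemma scale_nonzero [simp]: "scale c \<noteq> 0"
  using scale_pos[of c] by linarith

lemma emeasure_lborel_Ico_max: "emeasure lborel {a..<b :: real} = ennreal (max 0 (b - a))"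
  by (cases "a \<le> b") simp_all

lemma measure_lborel_Ico_max: "measure lborel {a..<b :: real} = max 0 (b - a)"
  by (cases "a \<le> b") simp_all

section \<open>The probability that one dart falls into a rectangle\<close>

lemma emeasure_affine_less:
  fixes lo len a :: real
  assumes "len > 0"
  shows "emeasure hash_space {\<omega>. lo + len * \<omega> x < a} = ennreal (measure lborel ({lo..<lo + len} \<inter> {..<a}) / len)"
proof -
  define r where "r = (a - lo) / len"
  have "{lo..<lo + len} \<inter> {..<a} = {lo..<min (lo + len) a}" by auto
  then have "measure lborel ({lo..<lo + len} \<inter> {..<a}) = max 0 (min (lo + len) a - lo)"
    by (simp only: measure_lborel_Ico_max)
  moreover have "a = lo + len * r" using assms by (simp add: r_def)
  moreover have "max 0 (min (lo + len) (lo + len * r) - lo) = len * max 0 (min 1 r)"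
  proof -
    consider "r < 0" | "0 \<le> r" "r \<le> 1" | "1 < r" by linarith
    then show ?thesis
    proof cases
      case 1
      then have "len * r < 0" using assms by (simp add: mult_pos_neg)
      then show ?thesis using 1 assms by simp
    next
      case 2
      then have "0 \<le> len * r" "len * r \<le> len" using assms by (simp_all add: mult_left_le)
      then show ?thesis using 2 by simp
    next
      case 3
      then have "len < len * r" using assms by simp
      then show ?thesis using 3 assms by simp
    qed
  qed
  ultimately have eq: "max 0 (min 1 r) = measure lborel ({lo..<lo + len} \<inter> {..<a}) / len"
    using assms by simp
  have "lo + len * u < a \<longleftrightarrow> u < r" for u
    unfolding r_def using assms by (subst pos_less_divide_eq) (auto simp: algebra_simps)
  then have "emeasure hash_space {\<omega>. lo + len * \<omega> x < a} = emeasure hash_space {\<omega>. \<omega> x \<in> {..<r}}"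
    by simp
  also have "\<dots> = emeasure lborel ({0..<1} \<inter> {..<r})"
    by (rule emeasure_hash) simp
  also have "{0..<1} \<inter> {..<r} = {0..<min 1 r}" by auto
  also have "emeasure lborel {0..<min 1 r} = ennreal (max 0 (min 1 r))"
    by (simp only: emeasure_lborel_Ico_max diff_zero)
  also have "max 0 (min 1 r) = measure lborel ({lo..<lo + len} \<inter> {..<a}) / len"
    by (rule eq)
  finally show ?thesis .
qed

lemma emeasure_bin:
  assumes "j < k"
  shows "emeasure hash_space {\<omega>. nat \<lfloor>real k * \<omega> x\<rfloor> = j} = ennreal (1 / real k)"
proof -
  have ae: "AE \<omega> in hash_space. \<omega> \<in> {\<omega>. nat \<lfloor>real k * \<omega> x\<rfloor> = j} \<longleftrightarrow> \<omega> \<in> {\<omega>. \<omega> x \<in> {real j / real k..<(real j + 1) / real k}}"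
    using AE_hash_range
  proof eventually_elim
    case (elim \<omega>)
    then have "0 \<le> real k * \<omega> x" by simp
    then have "nat \<lfloor>real k * \<omega> x\<rfloor> = j \<longleftrightarrow> real j \<le> real k * \<omega> x \<and> real k * \<omega> x < real j + 1"
      by linarith
    then show ?case using assms by (simp add: field_simps)
  qed
  have "emeasure hash_space {\<omega>. nat \<lfloor>real k * \<omega> x\<rfloor> = j} = emeasure hash_space {\<omega>. \<omega> x \<in> {real j / real k..<(real j + 1) / real k}}"
    by (rule emeasure_eq_AE[OF ae]; rule hash_event) measurable
  also have "\<dots> = emeasure lborel ({0..<1} \<inter> {real j / real k..<(real j + 1) / real k})"
    by (rule emeasure_hash) simp
  also have "{0..<1} \<inter> {real j / real k..<(real j + 1) / real k} = {real j / real k..<(real j + 1) / real k}"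
    using assms by (auto simp: field_simps)
  also have "emeasure lborel \<dots> = ennreal (1 / real k)"
    by (simp only: emeasure_lborel_Ico_max) (simp add: add_divide_distrib)
  finally show ?thesis .
qed

text \<open>The darts that push the hitting time of bin \<open>j\<close> below \<open>t\<close> for
  an already scaled vector \<open>z\<close>. There are no lower bounds, since the coordinates of a
  dart are nonnegative for unit-valued hash functions.\<close>

definition reach :: "nat \<Rightarrow> (nat \<Rightarrow> real) \<Rightarrow> real \<Rightarrow> (nat \<times> nat \<times> real \<times> real) set" where
  "reach j z t = {(j', i, w, \<tau>). j' = j \<and> w < z i \<and> \<tau> < t}"

lemma reach_sets [measurable]: "reach j z t \<in> sets dart_space"
proof -
  have "reach j z t = {p \<in> space dart_space. fst p = j \<and> fst (snd (snd p)) < z (fst (snd p)) \<and> snd (snd (snd p)) < t}"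
    by (auto simp: reach_def space_pair_measure)
  also have "\<dots> \<in> sets dart_space" by measurable
  finally show ?thesis .
qed

text \<open>A dart is uniform in its cell, which has area 1, and its bin is uniform and independent
  of its place. The right-hand side is kept as a measure of intersections so that areas can be added
  over cells.\<close>

lemma hit_prob_reach:
  assumes "j < k"
  shows "hit_prob k c (reach j z t) =
    measure lborel (weight_ivl c \<inter> {..<z (fst c)}) * measure lborel (time_ivl c \<inter> {..<t}) / real k"
proof -
  \<comment> \<open>\<open>a\<close> bounds the coordinate along the long side and \<open>b\<close>
    the one along the short side; the type says which of them is the weight.\<close>
  define a where "a = (if cell_type c = 0 then z (fst c) else t)"
  define b where "b = (if cell_type c = 0 then t else z (fst c))"
  define E where "E n = (if n = 0 then {\<omega>. long_low c + scale c * \<omega> (key c 1 0) < a}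
    else if n = 1 then {\<omega>. short_low c + 1 / scale c * \<omega> (key c 1 1) < b}
    else {\<omega>. nat \<lfloor>real k * \<omega> (key c 1 2)\<rfloor> = j})" for n :: nat
  have Em: "E n \<in> sets hash_space" for n
  proof -
    have "{\<omega>. long_low c + scale c * \<omega> (key c 1 0) < a} \<in> sets hash_space"
      by (rule hash_event) measurable
    moreover have "{\<omega>. short_low c + 1 / scale c * \<omega> (key c 1 1) < b} \<in> sets hash_space"
      by (rule hash_event) measurable
    moreover have "{\<omega>. nat \<lfloor>real k * \<omega> (key c 1 2)\<rfloor> = j} \<in> sets hash_space"
      by (rule hash_event) measurable
    ultimately show ?thesis unfolding E_def by simp
  qed
  have meas: "(indicator (E n) :: _ \<Rightarrow> ennreal) \<in> borel_measurable (PiM {key c 1 n} (\<lambda>_. unif))"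
    if "E n = {\<omega>. P (\<omega> (key c 1 n))}" "Measurable.pred borel P" for n and P :: "real \<Rightarrow> bool"
  proof -
    note [measurable] = that(2)
    have [measurable]: "(\<lambda>\<omega>. \<omega> (key c 1 n)) \<in> borel_measurable (PiM {key c 1 n} (\<lambda>_. unif))"
      by (rule measurable_hash_component) simp
    show ?thesis unfolding indicator_def that(1) mem_Collect_eq by measurable
  qed
  have E0: "(indicator (E 0) :: _ \<Rightarrow> ennreal) \<in> borel_measurable (PiM {key c 1 0} (\<lambda>_. unif))"
    by (rule meas[of 0 "\<lambda>u. long_low c + scale c * u < a"]) (simp_all add: E_def)
  have E1: "(indicator (E 1) :: _ \<Rightarrow> ennreal) \<in> borel_measurable (PiM {key c 1 1} (\<lambda>_. unif))"
    by (rule meas[of 1 "\<lambda>u. short_low c + 1 / scale c * u < b"]) (simp_all add: E_def)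
  have E2: "(indicator (E 2) :: _ \<Rightarrow> ennreal) \<in> borel_measurable (PiM {key c 1 2} (\<lambda>_. unif))"
    by (rule meas[of 2 "\<lambda>u. nat \<lfloor>real k * u\<rfloor> = j"]) (simp_all add: E_def)
  have "(\<integral>\<^sup>+\<omega>. (\<Prod>n\<in>{0, 1, 2}. indicator (E n) \<omega>) \<partial>hash_space) = (\<Prod>n\<in>{0, 1, 2}. \<integral>\<^sup>+\<omega>. indicator (E n) \<omega> \<partial>hash_space)"
  proof (rule nn_integral_hash_prod[where J = "\<lambda>n. {key c 1 n}"])
    show "disjoint_family_on (\<lambda>n. {key c 1 n}) {0, 1, 2}"
      by (simp add: disjoint_family_on_def)
    fix n :: nat
    assume n: "n \<in> {0, 1, 2}"
    then show "(indicator (E n) :: _ \<Rightarrow> ennreal) \<in> borel_measurable (PiM {key c 1 n} (\<lambda>_. unif))"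
      using E0 E1 E2 by blast
    show "indicator (E n) (restrict \<omega> {key c 1 n}) = (indicator (E n) \<omega> :: ennreal)" for \<omega>
      using n by (auto simp: E_def indicator_def)
  qed simp
  also have "(\<Prod>n\<in>{0, 1, 2}. \<integral>\<^sup>+\<omega>. indicator (E n) \<omega> \<partial>hash_space) = emeasure hash_space (E 0) * emeasure hash_space (E 1) * emeasure hash_space (E 2)"
    using Em by (simp add: mult.assoc)
  also have "emeasure hash_space (E 0) = ennreal (measure lborel (long_ivl c \<inter> {..<a}) / scale c)"
    by (simp add: E_def emeasure_affine_less long_ivl_def)
  also have "emeasure hash_space (E 1) = ennreal (measure lborel (short_ivl c \<inter> {..<b}) * scale c)"
    using emeasure_affine_less[of "1 / scale c" "short_low c" "key c 1 1" b]
    by (simp add: E_def short_ivl_def)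
  also have "emeasure hash_space (E 2) = ennreal (1 / real k)"
    using assms by (simp add: E_def emeasure_bin)
  also have "ennreal (measure lborel (long_ivl c \<inter> {..<a}) / scale c) * ennreal (measure lborel (short_ivl c \<inter> {..<b}) * scale c) * ennreal (1 / real k)
      = ennreal (measure lborel (long_ivl c \<inter> {..<a}) * measure lborel (short_ivl c \<inter> {..<b}) / real k)"
    by (simp add: ennreal_mult[symmetric] less_imp_le)
  also have "measure lborel (long_ivl c \<inter> {..<a}) * measure lborel (short_ivl c \<inter> {..<b}) =
     measure lborel (weight_ivl c \<inter> {..<z (fst c)}) * measure lborel (time_ivl c \<inter> {..<t})"
    by (simp add: a_def b_def weight_ivl_def time_ivl_def)
  also have "(\<integral>\<^sup>+\<omega>. (\<Prod>n\<in>{0, 1, 2}. indicator (E n) \<omega>) \<partial>hash_space) = (\<integral>\<^sup>+\<omega>. indicator {\<omega>. dart k \<omega> c 0 \<in> reach j z t} \<omega> \<partial>hash_space)"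
    by (intro nn_integral_cong)
      (auto simp: E_def indicator_def dart_def reach_def dart_bin_def dart_weight_def dart_time_def
        long_side_eq short_side_eq a_def b_def)
  also have "\<dots> = emeasure hash_space {\<omega>. dart k \<omega> c 0 \<in> reach j z t}"
    by (rule nn_integral_indicator, rule hash_event) measurable
  finally have "emeasure hash_space {\<omega>. dart k \<omega> c 0 \<in> reach j z t} =
     ennreal (measure lborel (weight_ivl c \<inter> {..<z (fst c)}) * measure lborel (time_ivl c \<inter> {..<t}) / real k)" .
  then show ?thesis unfolding hit_prob_def by (simp add: measure_def)
qed

lemma hit_prob_Un:
  assumes "A \<in> sets dart_space" "B \<in> sets dart_space" "A \<inter> B = {}"
  shows "hit_prob k c (A \<union> B) = hit_prob k c A + hit_prob k c B"
proof -
  have "{\<omega>. dart k \<omega> c 0 \<in> A \<union> B} = {\<omega>. dart k \<omega> c 0 \<in> A} \<union> {\<omega>. dart k \<omega> c 0 \<in> B}" by auto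
  then show ?thesis unfolding hit_prob_def using assms
    by (subst hash_prob.finite_measure_Union[symmetric]) (auto intro!: hash_event)
qed

lemma hit_prob_UN:
  assumes "finite I" "\<And>i. i \<in> I \<Longrightarrow> A i \<in> sets dart_space" "disjoint_family_on A I"
  shows "hit_prob k c (\<Union>i\<in>I. A i) = (\<Sum>i\<in>I. hit_prob k c (A i))"
  using assms
proof (induction I rule: finite_induct)
  case empty
  then show ?case by (simp add: hit_prob_def)
next
  case (insert i I)
  have "hit_prob k c (A i \<union> (\<Union>i\<in>I. A i)) = hit_prob k c (A i) + hit_prob k c (\<Union>i\<in>I. A i)"
    using insert by (intro hit_prob_Un) (auto simp: disjoint_family_on_def)
  then show ?case using insert by (simp add: disjoint_family_on_def)
qed

section \<open>The tiling, and the cells that meet a region\<close>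

lemma power2_bracket: "(1::real) \<le> y \<Longrightarrow> \<exists>e. 2 ^ e \<le> y \<and> y < 2 ^ Suc e"
proof -
  assume y: "1 \<le> y"
  obtain n where n: "y < 2 ^ n" using real_arch_pow[of 2 y] by auto
  define m where "m = (LEAST n. y < 2 ^ n)"
  have "y < 2 ^ m" unfolding m_def by (rule LeastI[of "\<lambda>n. y < 2 ^ n"]) (rule n)
  moreover from this y obtain e where e: "m = Suc e" by (cases m) auto
  moreover have "\<not> y < 2 ^ e" using not_less_Least[of e "\<lambda>n. y < 2 ^ n"] e m_def by simp
  ultimately show ?thesis by (intro exI[of _ e]) auto
qed

lemma grid_bracket:
  assumes "(0::real) \<le> y" shows "\<exists>q. real q / 2 ^ e \<le> y \<and> y < (real q + 1) / 2 ^ e"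
proof -
  have "real (nat \<lfloor>z\<rfloor>) \<le> z \<and> z < real (nat \<lfloor>z\<rfloor>) + 1" if "0 \<le> z" for z :: real
    using that by linarith
  from this[of "y * 2 ^ e"] assms obtain q where "real q \<le> y * 2 ^ e" "y * 2 ^ e < real q + 1"
    by (metis mult_nonneg_nonneg zero_le_numeral zero_le_power)
  then show ?thesis by (intro exI[of _ q]) (simp add: pos_divide_le_eq pos_less_divide_eq)
qed

lemma power2_bracket_unique:
  assumes "2 ^ e \<le> y" "(y::real) < 2 ^ Suc e" "2 ^ f \<le> y" "y < 2 ^ Suc f"
  shows "e = f"
proof -
  have "(2::real) ^ e < 2 ^ Suc f" "(2::real) ^ f < 2 ^ Suc e" using assms by linarith+
  then show ?thesis by (metis less_Suc_eq_le order_antisym power_strict_increasing_iff one_less_numeral_iff semiring_norm(76))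
qed

lemma grid_bracket_unique:
  assumes "real q / 2 ^ e \<le> y" "y < (real q + 1) / 2 ^ e" "real r / 2 ^ e \<le> y" "y < (real r + 1) / 2 ^ e"
  shows "q = r"
proof -
  have "real q / 2 ^ e < (real r + 1) / 2 ^ e" "real r / 2 ^ e < (real q + 1) / 2 ^ e" using assms by linarith+
  then show ?thesis by (simp add: divide_less_cancel)
qed

lemma cell_exists:
  assumes "0 \<le> w" "0 \<le> t"
  shows "\<exists>c\<in>all_cells. fst c = i \<and> w \<in> weight_ivl c \<and> t \<in> time_ivl c"
proof -
  consider "w < 1" "t < 1" | "1 \<le> w" | "w < 1" "1 \<le> t" by linarith
  then show ?thesis
  proof cases
    case 1
    then show ?thesis using assms
      by (intro bexI[of _ "(i, 2, 0, 0)"])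
        (auto simp: all_cells_def weight_ivl_def time_ivl_def long_ivl_def short_ivl_def)
  next
    case 2
    obtain e where e: "2 ^ e \<le> w" "w < 2 ^ Suc e" using power2_bracket 2 by blast
    obtain q where "real q / 2 ^ e \<le> t" "t < (real q + 1) / 2 ^ e" using grid_bracket assms by blast
    with e show ?thesis
      by (intro bexI[of _ "(i, 0, e, q)"])
        (auto simp: all_cells_def weight_ivl_def time_ivl_def long_ivl_def short_ivl_def add_divide_distrib)
  next
    case 3
    obtain e where e: "2 ^ e \<le> t" "t < 2 ^ Suc e" using power2_bracket 3 by blast
    obtain q where q: "real q / 2 ^ e \<le> w" "w < (real q + 1) / 2 ^ e" using grid_bracket assms by blast
    have "real q / 2 ^ e < 1" using q 3 by linarith
    then have "real q < 2 ^ e" by simp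
    then have "q < 2 ^ e" by (metis of_nat_less_iff of_nat_numeral of_nat_power)
    with e q show ?thesis
      by (intro bexI[of _ "(i, 1, e, q)"])
        (auto simp: all_cells_def weight_ivl_def time_ivl_def long_ivl_def short_ivl_def add_divide_distrib)
  qed
qed

text \<open>Comparing w and t with 1 reveals the type. Then e is the binary exponent of the
  coordinate along the long side, and q is the index of the other coordinate in the grid of width 1
  / 2^e.\<close>

lemma cell_unique:
  assumes "c \<in> all_cells" "c' \<in> all_cells" "fst c = fst c'"
    "w \<in> weight_ivl c" "t \<in> time_ivl c" "w \<in> weight_ivl c'" "t \<in> time_ivl c'"
  shows "c = c'"
proof -
  obtain i tp e q where c: "c = (i, tp, e, q)" by (cases c)
  obtain i' tp' e' q' where c': "c' = (i', tp', e', q')" by (cases c')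
  have small: "y < 1" if "q < 2 ^ e" "y < real q / 2 ^ e + 1 / 2 ^ e" for y q e
  proof -
    have "real q + 1 \<le> 2 ^ e" using that(1) by (metis Suc_leI add.commute of_nat_Suc of_nat_le_iff of_nat_numeral of_nat_power)
    then have "(real q + 1) / 2 ^ e \<le> 1" by simp
    then show ?thesis using that(2) by (simp add: add_divide_distrib)
  qed
  have big: "1 \<le> y" if "(2::real) ^ e \<le> y" for y e using that one_le_power[of "2::real" e] by linarith
  have ty: "tp = 0 \<and> 1 \<le> w \<or> tp = 1 \<and> w < 1 \<and> 1 \<le> t \<or> tp = 2 \<and> w < 1 \<and> t < 1"
    if "(i, tp, e, q) \<in> all_cells" "w \<in> weight_ivl (i, tp, e, q)" "t \<in> time_ivl (i, tp, e, q)" for i tp e q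
    using that small[of q e w] big[of e w] big[of e t]
    by (auto simp: all_cells_def weight_ivl_def time_ivl_def long_ivl_def short_ivl_def)
  have tp: "tp = tp'"
    using ty[of i tp e q] ty[of i' tp' e' q'] assms unfolding c c' by linarith
  define y where "y = (if tp = 0 then w else t)"
  define v where "v = (if tp = 0 then t else w)"
  have e: "e = e'"
  proof (cases "tp = 2")
    case True
    then show ?thesis using assms tp by (auto simp: all_cells_def c c')
  next
    case False
    have "2 ^ e \<le> y" "y < 2 ^ Suc e" "2 ^ e' \<le> y" "y < 2 ^ Suc e'"
      using assms(4-7) False unfolding c c' tp[symmetric] y_def
      by (auto simp: weight_ivl_def time_ivl_def long_ivl_def)
    then show ?thesis by (rule power2_bracket_unique)
  qed
  have "real q / 2 ^ e \<le> v" "v < (real q + 1) / 2 ^ e" "real q' / 2 ^ e \<le> v" "v < (real q' + 1) / 2 ^ e"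
    using assms(4-7) unfolding c c' tp[symmetric] e[symmetric] v_def
    by (auto simp: weight_ivl_def time_ivl_def short_ivl_def add_divide_distrib)
  then have "q = q'" by (rule grid_bracket_unique)
  with tp e assms(3) show ?thesis by (simp add: c c')
qed

text \<open>A cell contains its lower corner, so these are exactly the cells that meet the region
  below \<open>z\<close> before time \<open>t\<close>.\<close>

definition visit :: "(nat \<Rightarrow> real) \<Rightarrow> real \<Rightarrow> cell set" where
  "visit z t = {c \<in> all_cells. weight_low c < z (fst c) \<and> time_low c < t}"

definition below :: "(nat \<Rightarrow> real) \<Rightarrow> real \<Rightarrow> (nat \<times> nat \<times> real \<times> real) set" where
  "below z t = {(j, i, w, \<tau>). w < z i \<and> \<tau> < t}"

lemma visit_subset: "visit z t \<subseteq> all_cells"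
  by (auto simp: visit_def)

lemma low_nonneg: "0 \<le> weight_low c" "0 \<le> time_low c"
  by (cases c; auto simp: weight_low_def time_low_def)+

lemma low_le_dart:
  assumes "unit_valued \<omega>"
  shows "weight_low c \<le> dart_weight \<omega> c n" "time_low c \<le> dart_time \<omega> c n"
  using assms by (auto simp: dart_weight_def dart_time_def weight_low_def time_low_def long_side_eq short_side_eq less_imp_le)

text \<open>Reduces statements about infinitely many cells to the cells that the program
  inspects.\<close>

lemma misses_outside_visit:
  assumes "unit_valued \<omega>" "A \<subseteq> below z t" "c \<in> all_cells" "c \<notin> visit z t"
  shows "misses k \<omega> c A"
  unfolding misses_def
proof (intro allI impI notI)
  fix n assume "dart k \<omega> c n \<in> A"
  then have "dart_weight \<omega> c n < z (fst c)" "dart_time \<omega> c n < t"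
    using assms(2) by (auto simp: below_def dart_def)
  then have "weight_low c < z (fst c)" "time_low c < t"
    using low_le_dart[OF assms(1), of c n] by linarith+
  then show False using assms(3,4) by (simp add: visit_def)
qed

lemma finite_visit:
  assumes "\<And>i. d \<le> i \<Longrightarrow> z i \<le> 0"
  shows "finite (visit z t)"
proof -
  obtain Z where Z: "\<And>i. z i \<le> Z"
  proof
    fix i show "z i \<le> (\<Sum>i<d. \<bar>z i\<bar>)"
    proof (cases "i < d")
      case True
      then have "\<bar>z i\<bar> \<le> (\<Sum>i<d. \<bar>z i\<bar>)" by (intro member_le_sum) auto
      then show ?thesis by linarith
    next
      case False
      then show ?thesis using assms[of i] by (meson abs_ge_zero not_le order_trans sum_nonneg)
    qed
  qed
  obtain m where m: "max Z t < 2 ^ m" using real_arch_pow[of 2 "max Z t"] by auto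
  \<comment> \<open>Both lower ends are below 2^m. The long side then gives e \<le> m, and the short
    side gives q < 2^m * 2^e \<le> 2^(m + m).\<close>
  have "visit z t \<subseteq> {..<d} \<times> {..2} \<times> {..m} \<times> {..2 ^ (m + m)}"
  proof
    fix c assume c: "c \<in> visit z t"
    obtain i tp e q where [simp]: "c = (i, tp, e, q)" by (cases c)
    have "weight_low c < Z" "time_low c < t" "0 < z i" using c Z[of i] low_nonneg[of c] by (auto simp: visit_def)
    then have low: "weight_low c < 2 ^ m" "time_low c < 2 ^ m" using m by auto
    have "i < d" using assms[of i] \<open>0 < z i\<close> by (meson not_le)
    moreover have "tp \<le> 2" "tp = 2 \<Longrightarrow> e = 0 \<and> q = 0" using c by (auto simp: visit_def all_cells_def)
    moreover have "e \<le> m \<and> q \<le> 2 ^ (m + m)" if "tp \<noteq> 2"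
    proof -
      have l: "(2::real) ^ e < 2 ^ m" "real q / 2 ^ e < 2 ^ m"
        using low that by (auto simp: weight_low_def time_low_def split: if_splits)
      then have "e \<le> m" by simp
      have "real q < 2 ^ m * 2 ^ e" using l(2) by (simp add: field_simps)
      also have "\<dots> \<le> 2 ^ m * 2 ^ m" using l(1) by simp
      also have "\<dots> = real (2 ^ (m + m))" by (simp add: power_add)
      finally show ?thesis using \<open>e \<le> m\<close> by (simp only: of_nat_less_iff) simp
    qed
    ultimately show "c \<in> {..<d} \<times> {..2} \<times> {..m} \<times> {..2 ^ (m + m)}" by (cases "tp = 2") auto
  qed
  then show ?thesis by (rule finite_subset) simp
qed

lemma AE_misses_visit:
  assumes "A \<subseteq> below z t"
  shows "AE \<omega> in hash_space. (\<forall>c\<in>all_cells. misses k \<omega> c A) \<longleftrightarrow> (\<forall>c\<in>visit z t. misses k \<omega> c A)"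
  using AE_hash_range
proof eventually_elim
  case (elim \<omega>)
  then show ?case using misses_outside_visit[OF elim assms] by (meson visit_subset subsetD)
qed

lemma emeasure_misses_all:
  assumes A: "A \<in> sets dart_space" "A \<subseteq> below z t" and z: "\<And>i. d \<le> i \<Longrightarrow> z i \<le> 0"
  shows "emeasure hash_space {\<omega>. \<forall>c\<in>all_cells. misses k \<omega> c A} = ennreal (exp (- (\<Sum>c\<in>visit z t. hit_prob k c A)))"
proof -
  have "emeasure hash_space {\<omega>. \<forall>c\<in>all_cells. misses k \<omega> c A} = emeasure hash_space {\<omega>. \<forall>c\<in>visit z t. misses k \<omega> c A}"
    by (rule emeasure_eq_AE) (use AE_misses_visit[OF A(2), of k] A in \<open>auto intro!: misses_all_meas\<close>)
  then show ?thesis by (simp add: emeasure_misses[OF finite_visit[OF z] A(1)])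
qed

section \<open>Adding up areas over cells\<close>

lemma ivl_sets [measurable]: "weight_ivl c \<in> sets borel" "time_ivl c \<in> sets borel"
  by (simp_all add: weight_ivl_def time_ivl_def long_ivl_def short_ivl_def)

lemma ivl_low: "w \<in> weight_ivl c \<Longrightarrow> weight_low c \<le> w" "t \<in> time_ivl c \<Longrightarrow> time_low c \<le> t"
  by (auto simp: weight_ivl_def time_ivl_def long_ivl_def short_ivl_def weight_low_def time_low_def split: if_splits)

lemma emeasure_lborel_Times:
  fixes A B :: "real set"
  assumes "A \<in> sets borel" "B \<in> sets borel"
  shows "emeasure lborel (A \<times> B) = emeasure lborel A * emeasure lborel B"
proof -
  have "emeasure lborel (A \<times> B) = emeasure (lborel \<Otimes>\<^sub>M lborel) (A \<times> B)" by (simp add: lborel_prod)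
  also have "\<dots> = emeasure lborel A * emeasure lborel B"
    by (rule lborel.emeasure_pair_measure_Times) (use assms in auto)
  finally show ?thesis .
qed

lemma measure_lborel_Times:
  fixes A B :: "real set"
  assumes "A \<in> sets borel" "B \<in> sets borel"
  shows "measure lborel (A \<times> B) = measure lborel A * measure lborel B"
  using emeasure_lborel_Times[OF assms] by (simp add: measure_def enn2real_mult)

text \<open>The cells of a coordinate cut the rectangle with sides \<open>a\<close> and
  \<open>b\<close> into disjoint pieces. \<open>V\<close> may contain more cells than meet the
  rectangle, since these contribute nothing.\<close>

lemma sum_area:
  assumes "finite V" "V \<subseteq> {c \<in> all_cells. fst c = i}" "0 \<le> a" "0 \<le> b"
    and cover: "\<And>c. c \<in> all_cells \<Longrightarrow> fst c = i \<Longrightarrow> weight_low c < a \<Longrightarrow> time_low c < b \<Longrightarrow> c \<in> V"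
  shows "(\<Sum>c\<in>V. measure lborel (weight_ivl c \<inter> {..<a}) * measure lborel (time_ivl c \<inter> {..<b})) = a * b"
proof -
  define S where "S c = (weight_ivl c \<inter> {..<a}) \<times> (time_ivl c \<inter> {..<b})" for c
  have S: "S c \<in> sets lborel" for c
    unfolding S_def lborel_prod[symmetric] by (intro pair_measureI) auto
  have un: "(\<Union>c\<in>V. S c) = {0..<a} \<times> {0..<b}"
  proof (intro set_eqI iffI)
    fix p assume "p \<in> (\<Union>c\<in>V. S c)"
    then obtain c w t where c: "p = (w, t)" "w \<in> weight_ivl c" "t \<in> time_ivl c" "w < a" "t < b"
      by (auto simp: S_def)
    with ivl_low(1)[of w c] ivl_low(2)[of t c] low_nonneg[of c] show "p \<in> {0..<a} \<times> {0..<b}" by auto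
  next
    fix p assume "p \<in> {0..<a} \<times> {0..<b}"
    then obtain w t where p: "p = (w, t)" "0 \<le> w" "w < a" "0 \<le> t" "t < b" by auto
    then obtain c where c: "c \<in> all_cells" "fst c = i" "w \<in> weight_ivl c" "t \<in> time_ivl c"
      using cell_exists by blast
    then have "c \<in> V" using ivl_low(1)[of w c] ivl_low(2)[of t c] p by (intro cover) auto
    then show "p \<in> (\<Union>c\<in>V. S c)" using c p by (auto simp: S_def)
  qed
  have "emeasure lborel (S c) \<noteq> \<infinity>" if "c \<in> V" for c
  proof -
    have "S c \<subseteq> {0..<a} \<times> {0..<b}" using un that by auto
    then have "emeasure lborel (S c) \<le> emeasure lborel ({0..<a} \<times> {0..<b})"
      by (rule emeasure_mono) (simp add: lborel_prod[symmetric])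
    also have "\<dots> = ennreal (a * b)"
      using assms(3,4) by (simp add: emeasure_lborel_Times ennreal_mult)
    finally show ?thesis by (auto simp: top_unique)
  qed
  moreover have "disjoint_family_on S V"
    unfolding disjoint_family_on_def
  proof (intro ballI impI)
    fix c c' assume c: "c \<in> V" "c' \<in> V" "c \<noteq> c'"
    then have "c \<in> all_cells" "c' \<in> all_cells" "fst c = fst c'" using assms(2) by auto
    then have "\<not> (w \<in> weight_ivl c \<and> t \<in> time_ivl c \<and> w \<in> weight_ivl c' \<and> t \<in> time_ivl c')" for w t
      using cell_unique c(3) by blast
    then show "S c \<inter> S c' = {}" by (auto simp: S_def)
  qed
  ultimately have "(\<Sum>c\<in>V. measure lborel (S c)) = measure lborel (\<Union>c\<in>V. S c)"
    using assms(1) S by (intro measure_finite_Union[symmetric]) auto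
  also have "\<dots> = a * b" unfolding un using assms(3,4) by (simp add: measure_lborel_Times)
  finally show ?thesis by (simp add: S_def measure_lborel_Times)
qed

text \<open>\<open>Z\<close> and \<open>T\<close> merely fix a finite set of cells and may exceed
  \<open>z\<close> and \<open>t\<close>. This freedom allows regions of different sizes to be
  measured over one common set of cells.\<close>

lemma sum_hit_prob_reach:
  assumes j: "j < k" and z: "\<And>i. d \<le> i \<Longrightarrow> Z i \<le> 0" "\<And>i. 0 \<le> z i" "\<And>i. z i \<le> Z i"
    and t: "0 \<le> t" "t \<le> T"
  shows "(\<Sum>c\<in>visit Z T. hit_prob k c (reach j z t)) = (\<Sum>i<d. z i) * t / real k"
proof -
  have fin: "finite (visit Z T)" by (rule finite_visit) (rule z(1))
  have sub: "fst ` visit Z T \<subseteq> {..<d}"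
  proof
    fix i assume "i \<in> fst ` visit Z T"
    then obtain c where "c \<in> visit Z T" "fst c = i" by auto
    then have "0 < Z i" using low_nonneg(1)[of c] by (auto simp: visit_def)
    then show "i \<in> {..<d}" using z(1)[of i] by (meson lessThan_iff not_le)
  qed
  have row: "(\<Sum>c\<in>{c\<in>visit Z T. fst c = i}. measure lborel (weight_ivl c \<inter> {..<z i}) * measure lborel (time_ivl c \<inter> {..<t})) = z i * t"
    for i
  proof (rule sum_area)
    fix c assume c: "c \<in> all_cells" "fst c = i" "weight_low c < z i" "time_low c < t"
    then have "weight_low c < Z (fst c)" "time_low c < T" using z(3)[of i] t by auto
    then show "c \<in> {c\<in>visit Z T. fst c = i}" using c by (auto simp: visit_def)
  qed (use fin z t in \<open>auto dest: visit_subset[THEN subsetD]\<close>)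
  have "(\<Sum>c\<in>visit Z T. hit_prob k c (reach j z t)) =
     (\<Sum>c\<in>visit Z T. measure lborel (weight_ivl c \<inter> {..<z (fst c)}) * measure lborel (time_ivl c \<inter> {..<t})) / real k"
    by (simp add: hit_prob_reach[OF j] sum_divide_distrib)
  also have "(\<Sum>c\<in>visit Z T. measure lborel (weight_ivl c \<inter> {..<z (fst c)}) * measure lborel (time_ivl c \<inter> {..<t}))
     = (\<Sum>i<d. \<Sum>c\<in>{c\<in>visit Z T. fst c = i}. measure lborel (weight_ivl c \<inter> {..<z (fst c)}) * measure lborel (time_ivl c \<inter> {..<t}))"
    by (rule sum.group[symmetric, OF fin _ sub]) simp
  also have "\<dots> = (\<Sum>i<d. z i * t)"
    by (intro sum.cong refl, subst row[symmetric]) (auto intro: sum.cong)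
  finally show ?thesis by (simp add: sum_distrib_right)
qed

section \<open>Hitting times\<close>

text \<open>Extended reals, because a bin may receive no dart at all. All cells enter, so the value
  knows nothing of horizons and rounds.\<close>

definition hit_time :: "nat \<Rightarrow> real \<Rightarrow> nat \<Rightarrow> hashfun \<Rightarrow> (nat \<Rightarrow> real) \<Rightarrow> ereal" where
  "hit_time k K j \<omega> x =
     (INF (c, n)\<in>{(c, n). c \<in> all_cells \<and> n < num_darts \<omega> c \<and> dart_bin k \<omega> c n = j \<and> dart_weight \<omega> c n < K * x (fst c)}.
        ereal (dart_time \<omega> c n))"

abbreviation (input) scaled :: "real \<Rightarrow> (nat \<Rightarrow> real) \<Rightarrow> nat \<Rightarrow> real" where
  "scaled K x \<equiv> (\<lambda>i. K * x i)"

text \<open>A lower bound on a hitting time is a void event. All laws of hitting times are derived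
  from this equivalence.\<close>

lemma hit_time_ge:
  "ereal t \<le> hit_time k K j \<omega> x \<longleftrightarrow> (\<forall>c\<in>all_cells. misses k \<omega> c (reach j (scaled K x) t))"
  unfolding hit_time_def le_INF_iff
  by (simp add: misses_def reach_def dart_def Ball_def split_paired_All not_less) (metis not_le)

lemma misses_UN: "misses k \<omega> c (\<Union>l\<in>L. A l) \<longleftrightarrow> (\<forall>l\<in>L. misses k \<omega> c (A l))"
  by (auto simp: misses_def)

text \<open>Finite thresholds suffice, because the value \<infinity> is characterised by countably
  many of them; only these thresholds give void events of bounded regions.\<close>

lemma borel_measurable_erealI_ge:
  fixes f :: "'a \<Rightarrow> ereal"
  assumes "\<And>a. {x \<in> space M. ereal a \<le> f x} \<in> sets M"
  shows "f \<in> borel_measurable M"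
  unfolding borel_measurable_iff_Ici_ereal
proof
  fix a :: ereal
  have top: "(\<forall>n. ereal (real n) \<le> y) \<longleftrightarrow> y = \<infinity>" for y :: ereal
  proof (cases y)
    case (real r)
    obtain n where "r < real n" using reals_Archimedean2 by blast
    then show ?thesis using real by (auto simp: not_le)
  qed auto
  show "f -` {a..} \<inter> space M \<in> sets M"
  proof (cases a)
    case (real r)
    then show ?thesis using assms[of r] by (simp add: vimage_def Int_def conj_commute)
  next
    case PInf
    have "f -` {a..} \<inter> space M = (\<Inter>n. {x \<in> space M. ereal (real n) \<le> f x})"
      using PInf top by (auto simp: vimage_def)
    then show ?thesis using assms by auto
  next
    case MInf
    then have "f -` {a..} \<inter> space M = space M" by auto
    then show ?thesis by simp
  qed
qed

lemma hit_time_ge_event: "{\<omega>. ereal t \<le> hit_time k K j \<omega> x} \<in> sets hash_space"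
  unfolding hit_time_ge by (rule misses_all_meas) auto

lemma measurable_hit_time [measurable]: "(\<lambda>\<omega>. hit_time k K j \<omega> x) \<in> borel_measurable hash_space"
  by (rule borel_measurable_erealI_ge) (simp add: hit_time_ge_event)

text \<open>For a fixed bin these events, with \<open>L\<close> finite, are closed under
  intersection and generate the sigma algebra of its hitting times. It is therefore enough to check
  independence on them.\<close>

definition bounds_event :: "nat \<Rightarrow> real \<Rightarrow> nat \<Rightarrow> ((nat \<Rightarrow> real) \<times> real) set \<Rightarrow> hashfun set" where
  "bounds_event k K j L = {\<omega>. \<forall>(x, a)\<in>L. ereal a \<le> hit_time k K j \<omega> x}"

definition bounds_region :: "real \<Rightarrow> nat \<Rightarrow> ((nat \<Rightarrow> real) \<times> real) set \<Rightarrow> (nat \<times> nat \<times> real \<times> real) set" where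
  "bounds_region K j L = (\<Union>(x, a)\<in>L. reach j (scaled K x) a)"

lemma bounds_event_eq: "bounds_event k K j L = {\<omega>. \<forall>c\<in>all_cells. misses k \<omega> c (bounds_region K j L)}"
  unfolding bounds_event_def bounds_region_def misses_UN by (auto simp: hit_time_ge split_beta)

lemma bounds_region_sets: "finite L \<Longrightarrow> bounds_region K j L \<in> sets dart_space"
  unfolding bounds_region_def by (intro sets.finite_UN) auto

lemma bounds_region_below:
  assumes L: "finite L" "L \<subseteq> weighted_sets d \<times> UNIV" and K: "0 \<le> K"
  shows "\<exists>Z T. (\<forall>i\<ge>d. Z i \<le> 0) \<and> bounds_region K j L \<subseteq> below Z T"
proof (intro exI conjI)
  \<comment> \<open>Sums over \<open>L\<close> serve as common upper bounds, since all their terms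
    are nonnegative.\<close>
  show "\<forall>i\<ge>d. (\<lambda>i. \<Sum>(x, a)\<in>L. K * x i) i \<le> 0"
    using L(2) by (auto simp: weighted_sets_def intro!: sum_nonpos)
  show "bounds_region K j L \<subseteq> below (\<lambda>i. \<Sum>(x, a)\<in>L. K * x i) (\<Sum>(x, a)\<in>L. \<bar>a\<bar>)"
  proof
    fix p assume "p \<in> bounds_region K j L"
    then obtain x a i w t where xa: "(x, a) \<in> L" "p = (j, i, w, t)" "w < K * x i" "t < a"
      by (auto simp: bounds_region_def reach_def)
    have "(case (x, a) of (x, a) \<Rightarrow> K * x i) \<le> (\<Sum>(x, a)\<in>L. K * x i)"
      using L K by (intro member_le_sum xa) (auto simp: weighted_sets_def)
    moreover have "(case (x, a) of (x, a) \<Rightarrow> \<bar>a\<bar>) \<le> (\<Sum>(x, a)\<in>L. \<bar>a\<bar>)"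
      using L by (intro member_le_sum xa) auto
    ultimately show "p \<in> below (\<lambda>i. \<Sum>(x, a)\<in>L. K * x i) (\<Sum>(x, a)\<in>L. \<bar>a\<bar>)"
      using xa by (auto simp: below_def)
  qed
qed

lemma prob_bounds_event:
  assumes L: "finite L" "bounds_region K j L \<subseteq> below Z T" and Z: "\<And>i. d \<le> i \<Longrightarrow> Z i \<le> 0"
  shows "hash_prob.prob (bounds_event k K j L) = exp (- (\<Sum>c\<in>visit Z T. hit_prob k c (bounds_region K j L)))"
proof -
  have "emeasure hash_space {\<omega>. \<forall>c\<in>all_cells. misses k \<omega> c (bounds_region K j L)} =
     ennreal (exp (- (\<Sum>c\<in>visit Z T. hit_prob k c (bounds_region K j L))))"
    using L Z by (intro emeasure_misses_all bounds_region_sets)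
  then show ?thesis by (simp add: bounds_event_eq measure_def)
qed

lemma prob_bounds_events:
  assumes J: "finite J" "J \<noteq> {}" and L: "\<And>j. j \<in> J \<Longrightarrow> finite (L j)" "\<And>j. j \<in> J \<Longrightarrow> L j \<subseteq> weighted_sets d \<times> UNIV"
    and K: "0 \<le> K"
  shows "hash_prob.prob (\<Inter>j\<in>J. bounds_event k K j (L j)) = (\<Prod>j\<in>J. hash_prob.prob (bounds_event k K j (L j)))"
proof -
  define A where "A j = bounds_region K j (L j)" for j
  have "\<forall>j\<in>J. \<exists>Z T. (\<forall>i\<ge>d. Z i \<le> 0) \<and> A j \<subseteq> below Z T"
    using bounds_region_below[OF L K] unfolding A_def by blast
  then obtain Z T where ZT: "\<And>j i. j \<in> J \<Longrightarrow> d \<le> i \<Longrightarrow> Z j i \<le> 0" "\<And>j. j \<in> J \<Longrightarrow> A j \<subseteq> below (Z j) (T j)"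
    by metis
  \<comment> \<open>Common bounds for all bins, so that every void probability is expressed over the
    same finite set of cells.\<close>
  define Y where "Y i = (\<Sum>j\<in>J. max 0 (Z j i))" for i
  define S where "S = (\<Sum>j\<in>J. \<bar>T j\<bar>)"
  have Y: "Y i \<le> 0" if "d \<le> i" for i
    unfolding Y_def using ZT(1) that by (intro sum_nonpos) auto
  have sub: "A j \<subseteq> below Y S" if "j \<in> J" for j
  proof -
    have "max 0 (Z j i) \<le> Y i" for i
      unfolding Y_def using J that by (intro member_le_sum) auto
    moreover have "\<bar>T j\<bar> \<le> S"
      unfolding S_def using J that by (intro member_le_sum) auto
    ultimately have "below (Z j) (T j) \<subseteq> below Y S"
      by (fastforce simp: below_def intro: less_le_trans)
    with ZT(2)[OF that] show ?thesis by blast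
  qed
  have A: "A j \<in> sets dart_space" if "j \<in> J" for j
    unfolding A_def using L that by (intro bounds_region_sets)
  have "(\<Inter>j\<in>J. bounds_event k K j (L j)) = {\<omega>. \<forall>c\<in>all_cells. misses k \<omega> c (\<Union>j\<in>J. A j)}"
    by (auto simp: bounds_event_eq misses_UN A_def)
  moreover have "emeasure hash_space {\<omega>. \<forall>c\<in>all_cells. misses k \<omega> c (\<Union>j\<in>J. A j)} = ennreal (exp (- (\<Sum>c\<in>visit Y S. hit_prob k c (\<Union>j\<in>J. A j))))"
    using sub A J by (intro emeasure_misses_all[OF _ _ Y] sets.finite_UN) auto
  ultimately have "hash_prob.prob (\<Inter>j\<in>J. bounds_event k K j (L j)) = exp (- (\<Sum>c\<in>visit Y S. hit_prob k c (\<Union>j\<in>J. A j)))"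
    by (simp add: measure_def)
  also have "(\<Sum>c\<in>visit Y S. hit_prob k c (\<Union>j\<in>J. A j)) = (\<Sum>c\<in>visit Y S. \<Sum>j\<in>J. hit_prob k c (A j))"
    using A J by (intro sum.cong refl hit_prob_UN) (auto simp: disjoint_family_on_def A_def bounds_region_def reach_def)
  also have "\<dots> = (\<Sum>j\<in>J. \<Sum>c\<in>visit Y S. hit_prob k c (A j))"
    by (rule sum.swap)
  also have "exp (- \<dots>) = (\<Prod>j\<in>J. exp (- (\<Sum>c\<in>visit Y S. hit_prob k c (A j))))"
    using J by (simp add: exp_sum sum_negf[symmetric])
  also have "\<dots> = (\<Prod>j\<in>J. hash_prob.prob (bounds_event k K j (L j)))"
  proof (intro prod.cong refl)
    fix j assume "j \<in> J"
    then show "exp (- (\<Sum>c\<in>visit Y S. hit_prob k c (A j))) = hash_prob.prob (bounds_event k K j (L j))"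
      using L sub Y unfolding A_def by (intro prob_bounds_event[symmetric]) auto
  qed
  finally show ?thesis .
qed

lemma bounds_event_events: "finite L \<Longrightarrow> bounds_event k K j L \<in> sets hash_space"
  unfolding bounds_event_eq by (intro misses_all_meas bounds_region_sets) auto

text \<open>Independence passes from the intersection-stable families \<open>G j\<close> to the
  sigma algebras they generate. The whole functions are measurable there although they have
  uncountably many arguments, because measurability into a product is checked
  coordinatewise.\<close>

lemma indep_vars_hit_time:
  assumes K: "0 \<le> K"
  shows "hash_prob.indep_vars (\<lambda>_. PiM (weighted_sets d) (\<lambda>_. borel))
    (\<lambda>j \<omega>. restrict (hit_time k K j \<omega>) (weighted_sets d)) {..<k}"
proof -
  define G where "G j = {bounds_event k K j L | L. finite L \<and> L \<subseteq> weighted_sets d \<times> UNIV}" for j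
  have "hash_prob.indep_sets G {..<k}"
  proof (rule hash_prob.indep_setsI)
    show "G j \<subseteq> hash_prob.events" for j by (auto simp: G_def bounds_event_events)
    fix A J assume J: "J \<noteq> {}" "finite J" and "\<forall>j\<in>J. A j \<in> G j"
    then have "\<forall>j\<in>J. \<exists>L. A j = bounds_event k K j L \<and> finite L \<and> L \<subseteq> weighted_sets d \<times> UNIV"
      by (auto simp: G_def)
    then obtain L where L: "\<And>j. j \<in> J \<Longrightarrow> A j = bounds_event k K j (L j)"
      "\<And>j. j \<in> J \<Longrightarrow> finite (L j)" "\<And>j. j \<in> J \<Longrightarrow> L j \<subseteq> weighted_sets d \<times> UNIV"
      by metis
    have "hash_prob.prob (\<Inter>j\<in>J. bounds_event k K j (L j)) = (\<Prod>j\<in>J. hash_prob.prob (bounds_event k K j (L j)))"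
      using J L K by (intro prob_bounds_events[where d = d]) auto
    then show "hash_prob.prob (\<Inter>j\<in>J. A j) = (\<Prod>j\<in>J. hash_prob.prob (A j))"
      using L(1) by simp
  qed
  moreover have "Int_stable (G j)" for j
  proof (rule Int_stableI)
    fix a b assume "a \<in> G j" "b \<in> G j"
    then obtain L L' where "a = bounds_event k K j L" "finite L" "L \<subseteq> weighted_sets d \<times> UNIV"
       "b = bounds_event k K j L'" "finite L'" "L' \<subseteq> weighted_sets d \<times> UNIV" by (auto simp: G_def)
    then show "a \<inter> b \<in> G j"
      unfolding G_def by (intro CollectI exI[of _ "L \<union> L'"]) (auto simp: bounds_event_def)
  qed
  ultimately have ind: "hash_prob.indep_sets (\<lambda>j. sigma_sets UNIV (G j)) {..<k}"
    using hash_prob.indep_sets_sigma[of G "{..<k}"] by simp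
  have meas: "(\<lambda>\<omega>. restrict (hit_time k K j \<omega>) (weighted_sets d)) \<in> measurable (sigma UNIV (G j)) (PiM (weighted_sets d) (\<lambda>_. borel))" for j
  proof (rule measurable_restrict)
    fix x assume x: "x \<in> weighted_sets d"
    have "{\<omega>. ereal a \<le> hit_time k K j \<omega> x} \<in> G j" for a
      unfolding G_def using x by (intro CollectI exI[of _ "{(x, a)}"]) (auto simp: bounds_event_def)
    then show "(\<lambda>\<omega>. hit_time k K j \<omega> x) \<in> borel_measurable (sigma UNIV (G j))"
      by (intro borel_measurable_erealI_ge) auto
  qed
  show ?thesis
    unfolding hash_prob.indep_vars_def2
  proof (intro conjI ballI)
    show "(\<lambda>\<omega>. restrict (hit_time k K j \<omega>) (weighted_sets d)) \<in> measurable hash_space (PiM (weighted_sets d) (\<lambda>_. borel))" for j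
      by (rule measurable_restrict) measurable
    show "hash_prob.indep_sets (\<lambda>j. {(\<lambda>\<omega>. restrict (hit_time k K j \<omega>) (weighted_sets d)) -` A \<inter> space hash_space |A.
       A \<in> sets (PiM (weighted_sets d) (\<lambda>_. borel))}) {..<k}"
      using ind
    proof (rule hash_prob.indep_sets_mono_sets, safe)
      fix j A assume "A \<in> sets (PiM (weighted_sets d) (\<lambda>_. borel :: ereal measure))"
      from measurable_sets[OF meas[of j] this]
      show "(\<lambda>\<omega>. restrict (hit_time k K j \<omega>) (weighted_sets d)) -` A \<inter> space hash_space \<in> sigma_sets UNIV (G j)"
        by simp
    qed
  qed
qed

text \<open>Up to time \<open>s\<close> no dart may lie below the pointwise maximum of the two
  vectors; from \<open>s\<close> to \<open>t\<close> none may lie below \<open>y\<close>. The second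
  region is a difference of two \<open>reach\<close> sets of known intensity.\<close>

lemma prob_hit_time_pair:
  assumes j: "j < k" and K: "0 \<le> K" and x: "x \<in> weighted_sets d" and y: "y \<in> weighted_sets d"
    and st: "0 \<le> s" "s \<le> t"
  shows "hash_prob.prob {\<omega>. ereal s \<le> hit_time k K j \<omega> x \<and> ereal t \<le> hit_time k K j \<omega> y}
    = exp (- (K / k * ((\<Sum>i<d. max (x i) (y i)) * s + norm1 d y * (t - s))))"
proof -
  define L where "L = {(x, s), (y, t)}"
  define m where "m i = max (x i) (y i)" for i
  have m0: "0 \<le> m i" "x i \<le> m i" "y i \<le> m i" "0 \<le> y i" for i using x y by (auto simp: m_def weighted_sets_def le_max_iff_disj)
  have mz: "K * m i \<le> 0" if "d \<le> i" for i using x y that by (auto simp: m_def weighted_sets_def)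
  have A: "bounds_region K j L = reach j (scaled K m) s \<union> (reach j (scaled K y) t - reach j (scaled K y) s)" (is "_ = ?A \<union> (?B - ?C)")
  proof -
    have "w < K * m i \<longleftrightarrow> w < K * x i \<or> w < K * y i" for w i
      using K by (simp add: m_def max_mult_distrib_left less_max_iff_disj)
    then show ?thesis using st by (auto simp: bounds_region_def L_def reach_def)
  qed
  have CB: "?C \<subseteq> ?B" "?A \<inter> (?B - ?C) = {}"
    using st K m0(3) by (auto simp: reach_def) (meson less_le_trans mult_left_mono)?
  have hp: "hit_prob k c (bounds_region K j L) = hit_prob k c ?A + (hit_prob k c ?B - hit_prob k c ?C)" for c
  proof -
    have "hit_prob k c ?B = hit_prob k c (?C \<union> (?B - ?C))" using CB(1) by (simp add: Un_absorb1)
    also have "\<dots> = hit_prob k c ?C + hit_prob k c (?B - ?C)" by (rule hit_prob_Un) auto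
    finally have "hit_prob k c (?B - ?C) = hit_prob k c ?B - hit_prob k c ?C" by simp
    moreover have "hit_prob k c (bounds_region K j L) = hit_prob k c ?A + hit_prob k c (?B - ?C)"
      unfolding A by (rule hit_prob_Un) (use CB in auto)
    ultimately show ?thesis by simp
  qed
  have below: "bounds_region K j L \<subseteq> below (scaled K m) t"
    unfolding A using st K m0(3) by (auto simp: reach_def below_def intro: less_le_trans mult_left_mono)
  have "{\<omega>. ereal s \<le> hit_time k K j \<omega> x \<and> ereal t \<le> hit_time k K j \<omega> y} = bounds_event k K j L"
    by (auto simp: bounds_event_def L_def)
  then have "hash_prob.prob {\<omega>. ereal s \<le> hit_time k K j \<omega> x \<and> ereal t \<le> hit_time k K j \<omega> y}
     = exp (- (\<Sum>c\<in>visit (scaled K m) t. hit_prob k c (bounds_region K j L)))"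
    using prob_bounds_event[of L K j "scaled K m" t d k] below mz by (simp add: L_def)
  also have "(\<Sum>c\<in>visit (scaled K m) t. hit_prob k c (bounds_region K j L)) =
    (\<Sum>i<d. K * m i) * s / k + ((\<Sum>i<d. K * y i) * t / k - (\<Sum>i<d. K * y i) * s / k)"
    unfolding hp sum.distrib sum_subtractf
    using j mz m0 K st by (subst (1 2 3) sum_hit_prob_reach) (auto intro: mult_left_mono)
  also have "\<dots> = K / k * ((\<Sum>i<d. m i) * s + norm1 d y * (t - s))"
    using j by (simp add: sum_distrib_left[symmetric] norm1_def field_simps)
  finally show ?thesis by (simp add: m_def)
qed

lemma prob_hit_time:
  assumes "j < k" "0 \<le> K" "x \<in> weighted_sets d" "0 \<le> t"
  shows "hash_prob.prob {\<omega>. ereal t \<le> hit_time k K j \<omega> x} = exp (- (K / k * (norm1 d x * t)))"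
  using prob_hit_time_pair[of j k K x d x t t] assms by (simp add: norm1_def)

lemma AE_hit_time_nonneg: "AE \<omega> in hash_space. 0 \<le> hit_time k K j \<omega> x"
  using AE_hash_range
proof eventually_elim
  case (elim \<omega>)
  have "0 \<le> dart_time \<omega> c n" for c n
    by (rule order_trans[OF low_nonneg(2) low_le_dart(2)[OF elim]])
  then show ?case unfolding hit_time_def by (auto intro!: INF_greatest)
qed

lemma norm1_pos: "x \<in> weighted_sets d \<Longrightarrow> 0 < norm1 d x"
  by (simp add: weighted_sets_def)

lemma AE_hit_time_finite:
  assumes "j < k" "0 < K" "x \<in> weighted_sets d"
  shows "AE \<omega> in hash_space. hit_time k K j \<omega> x < \<infinity>"
proof -
  define r where "r = K / k * norm1 d x"
  have r: "0 < r" using assms norm1_pos by (simp add: r_def)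
  have "(\<lambda>n. exp (- (r * real n))) \<longlonglongrightarrow> 0"
    using r by real_asymp
  moreover have "hash_prob.prob {\<omega>. hit_time k K j \<omega> x = \<infinity>} \<le> exp (- (r * real n))" for n
  proof -
    have "hash_prob.prob {\<omega>. hit_time k K j \<omega> x = \<infinity>} \<le> hash_prob.prob {\<omega>. ereal (real n) \<le> hit_time k K j \<omega> x}"
      by (rule hash_prob.finite_measure_mono) (auto simp: hit_time_ge_event)
    also have "\<dots> = exp (- (r * real n))"
      using assms by (subst prob_hit_time[where d = d]) (auto simp: r_def mult_ac)
    finally show ?thesis .
  qed
  ultimately have "hash_prob.prob {\<omega>. hit_time k K j \<omega> x = \<infinity>} \<le> 0"
    by (intro LIMSEQ_le_const) auto
  then have "hash_prob.prob {\<omega>. hit_time k K j \<omega> x = \<infinity>} = 0" by (simp add: measure_le_0_iff)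
  then have "emeasure hash_space {\<omega>. hit_time k K j \<omega> x = \<infinity>} = 0"
    by (simp add: hash_prob.emeasure_eq_measure)
  then show ?thesis
    by (intro AE_I'[of "{\<omega>. hit_time k K j \<omega> x = \<infinity>}"])
      (auto simp: null_sets_def intro!: hash_event)
qed

section \<open>The collision probability\<close>

lemma eq_event:
  fixes X Y :: "hashfun \<Rightarrow> 'a :: {linorder_topology, second_countable_topology}"
  assumes [measurable]: "X \<in> borel_measurable hash_space" "Y \<in> borel_measurable hash_space"
  shows "{\<omega>. X \<omega> = Y \<omega>} \<in> sets hash_space"
proof -
  have lt: "{\<omega>. X \<omega> < Y \<omega>} \<in> sets hash_space" by (rule hash_event) measurable
  have gt: "{\<omega>. Y \<omega> < X \<omega>} \<in> sets hash_space" by (rule hash_event) measurable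
  have eq: "{\<omega>. X \<omega> = Y \<omega>} = space hash_space - ({\<omega>. X \<omega> < Y \<omega>} \<union> {\<omega>. Y \<omega> < X \<omega>})" by auto
  show ?thesis unfolding eq by (intro sets.Diff sets.top sets.Un lt gt)
qed

text \<open>The value is the probability that the first dart below the maximum of \<open>x\<close>
  and \<open>y\<close> is not below \<open>y\<close>. The joint survival function gives it by
  approximation: X < Y holds when some dyadic grid point separates X from Y.\<close>

lemma prob_hit_time_less:
  assumes j: "j < k" and K: "0 < K" and x: "x \<in> weighted_sets d" and y: "y \<in> weighted_sets d"
  shows "hash_prob.prob {\<omega>. hit_time k K j \<omega> x < hit_time k K j \<omega> y}
    = ((\<Sum>i<d. max (x i) (y i)) - norm1 d y) / (\<Sum>i<d. max (x i) (y i))"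
proof -
  define M where "M = (\<Sum>i<d. max (x i) (y i))"
  \<comment> \<open>\<open>a\<close> is the rate at which darts of bin \<open>j\<close> arrive below
    the pointwise maximum, and \<open>b\<close> the rate at which they arrive below
    \<open>y\<close>.\<close>
  define a where "a = K / k * M"
  define b where "b = K / k * norm1 d y"
  define X where "X \<omega> = hit_time k K j \<omega> x" for \<omega>
  define Y where "Y \<omega> = hit_time k K j \<omega> y" for \<omega>
  have [measurable]: "X \<in> borel_measurable hash_space" "Y \<in> borel_measurable hash_space"
    unfolding X_def Y_def by measurable
  have "norm1 d y \<le> M" unfolding M_def norm1_def by (intro sum_mono) auto
  with norm1_pos[OF y] have M: "0 < M" by linarith
  then have a: "0 < a" using j K by (simp add: a_def)
  have pair: "hash_prob.prob {\<omega>. ereal s \<le> X \<omega> \<and> ereal t \<le> Y \<omega>} = exp (- (a * s + b * (t - s)))"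
    if "0 \<le> s" "s \<le> t" for s t
  proof -
    have "K / k * (M * s + norm1 d y * (t - s)) = a * s + b * (t - s)"
      unfolding a_def b_def by (simp only: distrib_left mult.assoc)
    then show ?thesis
      using prob_hit_time_pair[OF j less_imp_le[OF K] x y that] by (simp add: X_def Y_def M_def)
  qed
  define e :: "nat \<Rightarrow> real" where "e n = 1 / 2 ^ n" for n
  have e: "0 < e n" for n by (simp add: e_def)
  \<comment> \<open>X lies in the m-th interval of length 2^-n and Y is not before the end of that
    interval. For fixed n these events are disjoint, and their probabilities form a geometric series
    in m.\<close>
  define E where "E n m = {\<omega>. ereal (m * e n) \<le> X \<omega> \<and> X \<omega> < ereal ((m + 1) * e n) \<and> ereal ((m + 1) * e n) \<le> Y \<omega>}" for n and m :: nat
  have E_events: "E n m \<in> sets hash_space" for n m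
    unfolding E_def by (rule hash_event) measurable
  have probE: "hash_prob.prob (E n m) = exp (- (a * e n)) ^ m * (exp (- (b * e n)) - exp (- (a * e n)))" for n m
  proof -
    let ?A = "{\<omega>. ereal (m * e n) \<le> X \<omega> \<and> ereal ((m + 1) * e n) \<le> Y \<omega>}"
    let ?B = "{\<omega>. ereal ((m + 1) * e n) \<le> X \<omega> \<and> ereal ((m + 1) * e n) \<le> Y \<omega>}"
    have le: "m * e n \<le> (m + 1) * e n" using e[of n] by (simp add: distrib_right)
    then have "ereal (m * e n) \<le> ereal ((m + 1) * e n)" by simp
    then have "?B \<subseteq> ?A" using order_trans by blast
    moreover have "E n m = ?A - ?B" unfolding E_def by auto
    moreover have "?A \<in> sets hash_space" by (rule hash_event) measurable
    moreover have "?B \<in> sets hash_space" by (rule hash_event) measurable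
    ultimately have "hash_prob.prob (E n m) = hash_prob.prob ?A - hash_prob.prob ?B"
      by (simp add: hash_prob.finite_measure_Diff)
    also have "hash_prob.prob ?A = exp (- (a * (m * e n) + b * ((m + 1) * e n - m * e n)))"
      using e[of n] le by (intro pair) auto
    also have "hash_prob.prob ?B = exp (- (a * ((m + 1) * e n) + b * ((m + 1) * e n - (m + 1) * e n)))"
      using e[of n] by (intro pair) auto
    also have "- (a * (m * e n) + b * ((m + 1) * e n - m * e n)) = m * (- (a * e n)) + - (b * e n)"
      by (simp add: algebra_simps)
    also have "- (a * ((m + 1) * e n) + b * ((m + 1) * e n - (m + 1) * e n)) = m * (- (a * e n)) + - (a * e n)"
      by (simp add: algebra_simps)
    finally show ?thesis
      unfolding exp_add exp_of_nat_mult right_diff_distrib .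
  qed
  have probU: "hash_prob.prob (\<Union>m. E n m) = (exp (- (b * e n)) - exp (- (a * e n))) / (1 - exp (- (a * e n)))" for n
  proof -
    have "disjoint_family (E n)"
      unfolding disjoint_family_on_def
    proof (intro ballI impI)
      fix m m' :: nat assume "m \<noteq> m'"
      have "E n m \<inter> E n m' = {}" if "m < m'" for m m'
      proof -
        have "(m + 1) * e n \<le> m' * e n" using that e[of n] by (intro mult_right_mono) auto
        then have le: "ereal ((m + 1) * e n) \<le> ereal (m' * e n)" by simp
        show ?thesis
        proof (rule equals0I)
          fix \<omega> assume "\<omega> \<in> E n m \<inter> E n m'"
          then have "X \<omega> < ereal ((m + 1) * e n)" "ereal (m' * e n) \<le> X \<omega>" by (simp_all add: E_def)
          with le show False by (meson leD order_trans)
        qed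
      qed
      with \<open>m \<noteq> m'\<close> show "E n m \<inter> E n m' = {}" by (metis inf_commute nat_neq_iff)
    qed
    then have "(\<lambda>m. hash_prob.prob (E n m)) sums hash_prob.prob (\<Union>m. E n m)"
      using E_events by (intro hash_prob.finite_measure_UNION) auto
    moreover have "(\<lambda>m. hash_prob.prob (E n m)) sums (1 / (1 - exp (- (a * e n))) * (exp (- (b * e n)) - exp (- (a * e n))))"
      unfolding probE using a e[of n] by (intro sums_mult2 geometric_sums) auto
    ultimately show ?thesis using sums_unique2 by fastforce
  qed
  \<comment> \<open>Interval m of one level splits into the intervals 2 m and 2 m + 1 of the next.
    Either half that contains X ends no later than the old interval, so Y remains beyond it.\<close>
  have inc: "incseq (\<lambda>n. \<Union>m. E n m)"
  proof (rule incseq_SucI, rule subsetI)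
    fix n \<omega> assume "\<omega> \<in> (\<Union>m. E n m)"
    then obtain m :: nat where m: "ereal (m * e n) \<le> X \<omega>" "X \<omega> < ereal ((m + 1) * e n)" "ereal ((m + 1) * e n) \<le> Y \<omega>"
      by (auto simp: E_def)
    have en: "e n = 2 * e (Suc n)" by (simp add: e_def)
    show "\<omega> \<in> (\<Union>m. E (Suc n) m)"
    proof (cases "X \<omega> < ereal ((2 * m + 1) * e (Suc n))")
      case True
      have "ereal ((2 * m + 1) * e (Suc n)) \<le> ereal ((m + 1) * e n)"
        using e[of "Suc n"] by (simp add: en algebra_simps)
      then have "ereal ((2 * m + 1) * e (Suc n)) \<le> Y \<omega>" using m(3) by (rule order_trans)
      moreover have "ereal (2 * m * e (Suc n)) \<le> X \<omega>" using m(1) by (simp add: en mult.assoc mult.left_commute)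
      ultimately have "\<omega> \<in> E (Suc n) (2 * m)"
        using True by (simp add: E_def)
      then show ?thesis by blast
    next
      case False
      have "(real (2 * m + 1) + 1) * e (Suc n) = (m + 1) * e n" by (simp add: en algebra_simps)
      moreover have "real (2 * m + 1) = 2 * real m + 1" by simp
      ultimately have "\<omega> \<in> E (Suc n) (2 * m + 1)"
        unfolding E_def using m False by (simp only: mem_Collect_eq not_less) simp
      then show ?thesis by blast
    qed
  qed
  have "(\<lambda>n. hash_prob.prob (\<Union>m. E n m)) \<longlonglongrightarrow> hash_prob.prob (\<Union>n. \<Union>m. E n m)"
    using E_events inc by (intro hash_prob.finite_Lim_measure_incseq) auto
  \<comment> \<open>For small \<epsilon>, exp(-b \<epsilon>) - exp(-a \<epsilon>) behaves like (a -
    b) \<epsilon> and 1 - exp(-a \<epsilon>) like a \<epsilon>.\<close>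
  moreover have "(\<lambda>n. hash_prob.prob (\<Union>m. E n m)) \<longlonglongrightarrow> (a - b) / a"
    unfolding probU e_def divide_inverse[of "a - b"] using a by real_asymp
  ultimately have "hash_prob.prob (\<Union>n. \<Union>m. E n m) = (a - b) / a"
    by (rule LIMSEQ_unique)
  moreover have "hash_prob.prob (\<Union>n. \<Union>m. E n m) = hash_prob.prob {\<omega>. X \<omega> < Y \<omega>}"
  proof (rule measure_eq_AE)
    show "AE \<omega> in hash_space. \<omega> \<in> (\<Union>n. \<Union>m. E n m) \<longleftrightarrow> \<omega> \<in> {\<omega>. X \<omega> < Y \<omega>}"
      using AE_hit_time_nonneg[of k K j x]
    proof eventually_elim
      case (elim \<omega>)
      show ?case
      proof
        assume "\<omega> \<in> {\<omega>. X \<omega> < Y \<omega>}"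
        then have lt: "X \<omega> < Y \<omega>" by simp
        have "0 \<le> X \<omega>" using elim by (simp add: X_def)
        then obtain r where r: "X \<omega> = ereal r" "0 \<le> r" using lt by (cases "X \<omega>") auto
        obtain u where u: "r < u" "ereal u \<le> Y \<omega>"
          using lt r by (metis ereal_dense2 ereal_less(2) less_ereal.simps(1) less_imp_le)
        obtain n where n: "1 / 2 ^ n < u - r"
          using u real_arch_pow_inv[of "u - r" "1 / 2"] by (auto simp: power_one_over)
        define m where "m = nat \<lfloor>r / e n\<rfloor>"
        have "0 \<le> r / e n" using r e[of n] by simp
        then have "m \<le> r / e n" "r / e n < m + 1" unfolding m_def by linarith+
        then have m: "m * e n \<le> r" "r < (m + 1) * e n" using e[of n] by (simp_all add: field_simps)
        then have "(m + 1) * e n \<le> u" using n by (simp add: e_def algebra_simps add_divide_distrib)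
        then have "ereal ((m + 1) * e n) \<le> Y \<omega>" using u(2) by (meson ereal_less_eq(3) order_trans)
        then have "\<omega> \<in> E n m" using m r by (simp add: E_def)
        then show "\<omega> \<in> (\<Union>n. \<Union>m. E n m)" by blast
      qed (auto simp: E_def intro: less_le_trans)
    qed
    show "(\<Union>n. \<Union>m. E n m) \<in> sets hash_space" using E_events by auto
    show "{\<omega>. X \<omega> < Y \<omega>} \<in> sets hash_space" by (rule hash_event) measurable
  qed
  moreover have "(a - b) / a = (M - norm1 d y) / M"
  proof -
    have "a - b = K / k * (M - norm1 d y)" unfolding a_def b_def by (simp only: right_diff_distrib)
    then show ?thesis using j K unfolding a_def by (simp only:) (rule mult_divide_mult_cancel_left, simp)
  qed
  ultimately show ?thesis by (simp add: X_def Y_def M_def)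
qed

text \<open>Equality is what remains after the two strict inequalities; the sum of the minima is the
  sum of both norms minus the sum of the maxima.\<close>

lemma prob_hit_time_eq:
  assumes j: "j < k" and K: "0 < K" and x: "x \<in> weighted_sets d" and y: "y \<in> weighted_sets d"
  shows "hash_prob.prob {\<omega>. hit_time k K j \<omega> x = hit_time k K j \<omega> y} = jaccard d x y"
proof -
  define M where "M = (\<Sum>i<d. max (x i) (y i))"
  define X where "X \<omega> = hit_time k K j \<omega> x" for \<omega>
  define Y where "Y \<omega> = hit_time k K j \<omega> y" for \<omega>
  have [measurable]: "X \<in> borel_measurable hash_space" "Y \<in> borel_measurable hash_space"
    unfolding X_def Y_def by measurable
  have "norm1 d y \<le> M" unfolding M_def norm1_def by (intro sum_mono) auto
  with norm1_pos[OF y] have M: "0 < M" by linarith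
  have lt: "{\<omega>. X \<omega> < Y \<omega>} \<in> sets hash_space" by (rule hash_event) measurable
  have gt: "{\<omega>. Y \<omega> < X \<omega>} \<in> sets hash_space" by (rule hash_event) measurable
  have eq: "{\<omega>. X \<omega> = Y \<omega>} \<in> sets hash_space" by (rule eq_event) (simp_all add: X_def[abs_def] Y_def[abs_def])
  note ev = lt gt eq
  have "{\<omega>. X \<omega> = Y \<omega>} \<union> ({\<omega>. X \<omega> < Y \<omega>} \<union> {\<omega>. Y \<omega> < X \<omega>}) = space hash_space" by auto
  then have "1 = hash_prob.prob ({\<omega>. X \<omega> = Y \<omega>} \<union> ({\<omega>. X \<omega> < Y \<omega>} \<union> {\<omega>. Y \<omega> < X \<omega>}))"
    by (simp only: hash_prob.prob_space)
  also have "\<dots> = hash_prob.prob {\<omega>. X \<omega> = Y \<omega>} + (hash_prob.prob {\<omega>. X \<omega> < Y \<omega>} + hash_prob.prob {\<omega>. Y \<omega> < X \<omega>})"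
    using ev by (subst hash_prob.finite_measure_Union, (auto)[3], subst hash_prob.finite_measure_Union) auto
  also have "hash_prob.prob {\<omega>. X \<omega> < Y \<omega>} = (M - norm1 d y) / M"
    using prob_hit_time_less[OF j K x y] by (simp add: X_def Y_def M_def)
  also have "hash_prob.prob {\<omega>. Y \<omega> < X \<omega>} = (M - norm1 d x) / M"
    using prob_hit_time_less[OF j K y x] by (simp add: X_def Y_def M_def max.commute)
  finally have "hash_prob.prob {\<omega>. X \<omega> = Y \<omega>} = (norm1 d x + norm1 d y - M) / M"
    using M by (simp add: diff_divide_distrib add_divide_distrib)
  also have "norm1 d x + norm1 d y - M = (\<Sum>i<d. min (x i) (y i))"
    unfolding norm1_def M_def by (simp add: sum.distrib[symmetric] sum_subtractf[symmetric] min_def max_def if_distrib cong: if_cong sum.cong)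
  finally show ?thesis by (simp add: jaccard_def X_def Y_def M_def)
qed

text \<open>An infinite hitting time is turned into 0; for the bins below \<open>k\<close>, positive
  \<open>K\<close> and weighted sets this happens with probability 0.\<close>

definition minhash :: "nat \<Rightarrow> real \<Rightarrow> nat \<Rightarrow> hashfun \<Rightarrow> (nat \<Rightarrow> real) \<Rightarrow> real" where
  "minhash k K j \<omega> x = real_of_ereal (hit_time k K j \<omega> x)"

lemma indep_weighted_minhashes_minhash:
  assumes K: "0 < K"
  shows "indep_weighted_minhashes d k hash_space (minhash k K)"
  unfolding indep_weighted_minhashes_def
proof (intro conjI allI impI)
  fix j assume j: "j < k"
  show "weighted_minhash d hash_space (minhash k K j)"
    unfolding weighted_minhash_def
  proof (intro conjI ballI)
    show "prob_space hash_space" by (rule hash_prob.prob_space_axioms)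
    show "(\<lambda>\<omega>. minhash k K j \<omega> x) \<in> borel_measurable hash_space" for x
      unfolding minhash_def by measurable
    fix x y assume x: "x \<in> weighted_sets d" and y: "y \<in> weighted_sets d"
    have "hash_prob.prob {\<omega>. minhash k K j \<omega> x = minhash k K j \<omega> y} = hash_prob.prob {\<omega>. hit_time k K j \<omega> x = hit_time k K j \<omega> y}"
    proof (rule measure_eq_AE)
      show "AE \<omega> in hash_space. \<omega> \<in> {\<omega>. minhash k K j \<omega> x = minhash k K j \<omega> y} \<longleftrightarrow> \<omega> \<in> {\<omega>. hit_time k K j \<omega> x = hit_time k K j \<omega> y}"
        using AE_hit_time_nonneg[of k K j x] AE_hit_time_nonneg[of k K j y] AE_hit_time_finite[OF j K x] AE_hit_time_finite[OF j K y]
      proof eventually_elim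
        case (elim \<omega>)
        then show ?case
          by (cases "hit_time k K j \<omega> x"; cases "hit_time k K j \<omega> y") (auto simp: minhash_def)
      qed
    qed (rule eq_event; simp add: minhash_def)+
    then show "measure hash_space {\<omega> \<in> space hash_space. minhash k K j \<omega> x = minhash k K j \<omega> y} = jaccard d x y"
      using prob_hit_time_eq[OF j K x y] by simp
  qed
next
  have "hash_prob.indep_vars (\<lambda>_. PiM (weighted_sets d) (\<lambda>_. borel))
    (\<lambda>j \<omega>. (\<lambda>x\<in>weighted_sets d. real_of_ereal (restrict (hit_time k K j \<omega>) (weighted_sets d) x))) {..<k}"
  proof (rule hash_prob.indep_vars_compose2[OF indep_vars_hit_time[OF less_imp_le[OF K], of d k]])
    show "(\<lambda>f. \<lambda>x\<in>weighted_sets d. real_of_ereal (f x)) \<in> measurable (PiM (weighted_sets d) (\<lambda>_. borel)) (PiM (weighted_sets d) (\<lambda>_. borel))"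
      by (rule measurable_restrict) measurable
  qed
  moreover have "(\<lambda>j \<omega>. (\<lambda>x\<in>weighted_sets d. real_of_ereal (restrict (hit_time k K j \<omega>) (weighted_sets d) x)))
     = (\<lambda>j \<omega>. restrict (minhash k K j \<omega>) (weighted_sets d))"
    by (auto simp: minhash_def fun_eq_iff)
  ultimately show "hash_prob.indep_vars (\<lambda>_. PiM (weighted_sets d) (\<lambda>_. borel))
       (\<lambda>j \<omega>. restrict (minhash k K j \<omega>) (weighted_sets d)) {..<k}" by simp
qed

section \<open>The program\<close>

text \<open>Total correctness, with the number of steps passed to the postcondition. By determinism
  the existence of one run says everything about the program.\<close>

definition wp :: "hashfun \<Rightarrow> com \<Rightarrow> (nat \<Rightarrow> mem \<Rightarrow> bool) \<Rightarrow> mem \<Rightarrow> bool" where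
  "wp \<omega> c Q s \<longleftrightarrow> (\<exists>n t. exec \<omega> c s n t \<and> Q n t)"

lemma wp_mono: "wp \<omega> c Q s \<Longrightarrow> (\<And>n t. Q n t \<Longrightarrow> Q' n t) \<Longrightarrow> wp \<omega> c Q' s"
  by (auto simp: wp_def)

lemma wp_Skip [simp]: "wp \<omega> Skip Q s \<longleftrightarrow> Q 1 s"
  unfolding wp_def by (metis exec.Skip exec_SkipE)

lemma wp_IAssign [simp]: "wp \<omega> (IAssign a i e) Q s \<longleftrightarrow> Q 1 (iset a (ival s i) (ival s e) s)"
  unfolding wp_def by (metis exec.IAssign exec_IAssignE)

lemma wp_RAssign [simp]: "wp \<omega> (RAssign a i e) Q s \<longleftrightarrow> Q 1 (rset a (ival s i) (rval s e) s)"
  unfolding wp_def by (metis exec.RAssign exec_RAssignE)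

lemma wp_RHash [simp]: "wp \<omega> (RHash a i es) Q s \<longleftrightarrow> Q 1 (rset a (ival s i) (\<omega> (map (ival s) es)) s)"
  unfolding wp_def by (metis exec.RHash exec_RHashE)

lemma wp_IHash [simp]: "wp \<omega> (IHash a i m es) Q s \<longleftrightarrow>
    Q 1 (iset a (ival s i) (nat \<lfloor>real (ival s m) * \<omega> (map (ival s) es)\<rfloor>) s)"
  unfolding wp_def by (metis exec.IHash exec_IHashE)

lemma wp_Seq [simp]: "wp \<omega> (Seq c c') Q s \<longleftrightarrow> wp \<omega> c (\<lambda>m t. wp \<omega> c' (\<lambda>n. Q (m + n)) t) s"
  unfolding wp_def by (blast intro: exec.Seq elim: exec_SeqE)

lemma wp_Cond [simp]: "wp \<omega> (Cond b c c') Q s \<longleftrightarrow>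
    (if bval s b then wp \<omega> c (\<lambda>n. Q (Suc n)) s else wp \<omega> c' (\<lambda>n. Q (Suc n)) s)"
proof (cases "bval s b")
  case True
  then show ?thesis unfolding wp_def by simp (blast intro: exec.CondTrue elim: exec_CondE)
next
  case False
  then show ?thesis unfolding wp_def by simp (blast intro: exec.CondFalse elim: exec_CondE)
qed

lemma wp_While: "wp \<omega> (While b c) Q s \<longleftrightarrow>
    (if bval s b then wp \<omega> c (\<lambda>m t. wp \<omega> (While b c) (\<lambda>n. Q (Suc (m + n))) t) s else Q 1 s)"
proof (cases "bval s b")
  case True
  then show ?thesis unfolding wp_def by simp (blast intro: exec.WhileTrue elim: exec_WhileE)
next
  case False
  then show ?thesis unfolding wp_def by simp (metis One_nat_def exec.WhileFalse exec_WhileE)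
qed

text \<open>Treats a loop as a counted one, with a number of iterations known to the proof and not
  to the program. Each iteration costs its test and its body, and the last, failing test costs
  1.\<close>

lemma wp_for:
  fixes f :: "nat \<Rightarrow> nat"
  assumes test: "\<And>q s. q \<le> N \<Longrightarrow> I q s \<Longrightarrow> bval s b \<longleftrightarrow> q < N"
    and body: "\<And>q s. q < N \<Longrightarrow> I q s \<Longrightarrow> wp \<omega> c (\<lambda>m t. m \<le> f q \<and> I (Suc q) t) s"
    and init: "I 0 s"
  shows "wp \<omega> (While b c) (\<lambda>m t. m \<le> 1 + (\<Sum>q<N. 1 + f q) \<and> I N t) s"
proof -
  have "wp \<omega> (While b c) (\<lambda>m t. m \<le> 1 + (\<Sum>q=q0..<N. 1 + f q) \<and> I N t) s" if "I q0 s" "q0 \<le> N" for q0 s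
    using that
  proof (induction "N - q0" arbitrary: q0 s)
    case 0
    then show ?case using test[of q0 s] by (subst wp_While) simp
  next
    case (Suc d)
    then have q0: "q0 < N" by simp
    have "wp \<omega> c (\<lambda>m t. wp \<omega> (While b c) (\<lambda>n u. Suc (m + n) \<le> 1 + (\<Sum>q=q0..<N. 1 + f q) \<and> I N u) t) s"
    proof (rule wp_mono[OF body[OF q0 Suc.prems(1)]], elim conjE)
      fix m t assume m: "m \<le> f q0" and t: "I (Suc q0) t"
      have "wp \<omega> (While b c) (\<lambda>m t. m \<le> 1 + (\<Sum>q=Suc q0..<N. 1 + f q) \<and> I N t) t"
        using Suc t q0 by (intro Suc.hyps(1)) auto
      then show "wp \<omega> (While b c) (\<lambda>n u. Suc (m + n) \<le> 1 + (\<Sum>q=q0..<N. 1 + f q) \<and> I N u) t"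
        by (rule wp_mono) (use m q0 in \<open>simp add: sum.atLeast_Suc_lessThan\<close>)
    qed
    then show ?case using test[of q0 s] Suc.prems q0 by (subst wp_While) simp
  qed
  from this[OF init] show ?thesis by (simp add: atLeast0LessThan)
qed

lemma imem_iset [simp]: "imem (iset a i v s) b j = (if b = a \<and> j = i then v else imem s b j)"
  by (simp add: iset_def)

lemma imem_rset [simp]: "imem (rset a i v s) = imem s"
  by (simp add: rset_def)

lemma rmem_rset [simp]: "rmem (rset a i v s) b j = (if b = a \<and> j = i then v else rmem s b j)"
  by (simp add: rset_def)

lemma rmem_iset [simp]: "rmem (iset a i v s) = rmem s"
  by (simp add: iset_def)

definition frame :: "string set \<Rightarrow> mem \<Rightarrow> mem \<Rightarrow> bool" where
  "frame W s t \<longleftrightarrow> (\<forall>a. a \<notin> W \<longrightarrow> (\<forall>i. imem t a i = imem s a i \<and> rmem t a i = rmem s a i))"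

lemma frame_refl [simp]: "frame W s s"
  by (simp add: frame_def)

lemma frame_iset [simp]: "a \<in> W \<Longrightarrow> frame W s t \<Longrightarrow> frame W s (iset a i v t)"
  by (auto simp: frame_def)

lemma frame_rset [simp]: "a \<in> W \<Longrightarrow> frame W s t \<Longrightarrow> frame W s (rset a i v t)"
  by (auto simp: frame_def)

lemma frame_trans: "frame W s t \<Longrightarrow> frame W' t u \<Longrightarrow> W \<subseteq> W'' \<Longrightarrow> W' \<subseteq> W'' \<Longrightarrow> frame W'' s u"
  unfolding frame_def by (metis subsetD)

lemma frameD: "frame W s t \<Longrightarrow> a \<notin> W \<Longrightarrow> imem t a i = imem s a i"
  "frame W s t \<Longrightarrow> a \<notin> W \<Longrightarrow> rmem t a i = rmem s a i"
  by (auto simp: frame_def)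

section \<open>The text of the program\<close>

abbreviation "iv a \<equiv> ICell a (INum 0)"
abbreviation "rv a \<equiv> RCell a (INum 0)"
abbreviation "iasg a e \<equiv> IAssign a (INum 0) e"
abbreviation "rasg a e \<equiv> RAssign a (INum 0) e"
abbreviation "rnum n \<equiv> RNat (INum n)"

definition dart_key :: "iexp \<Rightarrow> nat \<Rightarrow> iexp list" where
  "dart_key m z = [iv ''i'', iv ''tp'', iv ''e'', iv ''q'', m, INum z]"

definition sample_prog :: com where
  "sample_prog =
    Seq (RHash ''a'' (INum 0) (dart_key (IPlus (iv ''n'') (INum 1)) 0))
   (Seq (RHash ''b'' (INum 0) (dart_key (IPlus (iv ''n'') (INum 1)) 1))
   (Seq (IHash ''j'' (INum 0) (iv ''k'') (dart_key (IPlus (iv ''n'') (INum 1)) 2))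
   (Seq (rasg ''a'' (RPlus (rv ''lo'') (RTimes (rv ''p'') (rv ''a''))))
   (Seq (rasg ''b'' (RDivide (RPlus (RNat (iv ''q'')) (rv ''b'')) (rv ''p'')))
        (Cond (ILess (iv ''tp'') (INum 1))
          (Seq (rasg ''w'' (rv ''a'')) (rasg ''t'' (rv ''b'')))
          (Seq (rasg ''w'' (rv ''b'')) (rasg ''t'' (rv ''a''))))))))"

definition record_prog :: com where
  "record_prog =
    Cond (ILess (ICell ''found'' (iv ''j'')) (INum 1))
      (Seq (IAssign ''found'' (iv ''j'') (INum 1))
      (Seq (iasg ''cnt'' (IPlus (iv ''cnt'') (INum 1)))
           (RAssign ''out'' (iv ''j'') (rv ''t''))))
      (Cond (RLess (rv ''t'') (RCell ''out'' (iv ''j'')))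
        (RAssign ''out'' (iv ''j'') (rv ''t''))
        Skip)"

definition dart_prog :: com where
  "dart_prog = Seq sample_prog
    (Cond (BAnd (RLess (rv ''w'') (rv ''u'')) (RLess (rv ''t'') (rv ''V''))) record_prog Skip)"

text \<open>The search for the number of darts is itself the loop over the darts: \<open>cdf\<close>
  grows by one Poisson weight per dart until it exceeds the uniform value. \<open>pr\<close> is kept
  equal to exp(-1) / n! by one division.\<close>

definition cell_prog :: com where
  "cell_prog =
    Seq (RHash ''U'' (INum 0) (dart_key (INum 0) 0))
   (Seq (iasg ''n'' (INum 0))
   (Seq (rasg ''pr'' (RExp (RMinus (rnum 0) (rnum 1))))
   (Seq (rasg ''cdf'' (rv ''pr''))
        (While (BNot (RLess (rv ''U'') (rv ''cdf'')))
          (Seq dart_prog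
          (Seq (iasg ''n'' (IPlus (iv ''n'') (INum 1)))
          (Seq (rasg ''pr'' (RDivide (rv ''pr'') (RNat (iv ''n''))))
               (rasg ''cdf'' (RPlus (rv ''cdf'') (rv ''pr''))))))))))"

text \<open>All cells of one type, where \<open>X\<close> bounds the coordinate along the long side
  and \<open>Y\<close> the other one. Reals cannot be rounded to naturals, so exponents and indices
  are found by counting up with comparisons, and \<open>p\<close> = 2^e by doubling.\<close>

definition sweep_prog :: com where
  "sweep_prog =
    Seq (iasg ''e'' (INum 0))
   (Seq (rasg ''p'' (rnum 1))
        (While (RLess (rv ''p'') (rv ''X''))
          (Seq (rasg ''lo'' (rv ''p''))
          (Seq (iasg ''q'' (INum 0))
          (Seq (While (RLess (RDivide (RNat (iv ''q'')) (rv ''p'')) (rv ''Y''))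
                 (Seq cell_prog (iasg ''q'' (IPlus (iv ''q'') (INum 1)))))
          (Seq (rasg ''p'' (RPlus (rv ''p'') (rv ''p'')))
               (iasg ''e'' (IPlus (iv ''e'') (INum 1)))))))))"

text \<open>In the second sweep the short side is the weight. Cutting \<open>Y\<close> off at 1
  enforces the condition \<open>q < 2 ^ e\<close> of type 1.\<close>

definition coordinate_prog :: com where
  "coordinate_prog =
    Seq (iasg ''i'' (ICell ''index'' (iv ''l'')))
   (Seq (rasg ''u'' (RTimes (rv ''K'') (RCell ''weight'' (iv ''l''))))
   (Seq (iasg ''tp'' (INum 2))
   (Seq (iasg ''e'' (INum 0))
   (Seq (iasg ''q'' (INum 0))
   (Seq (rasg ''lo'' (rnum 0))
   (Seq (rasg ''p'' (rnum 1))
   (Seq cell_prog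
   (Seq (iasg ''tp'' (INum 0))
   (Seq (rasg ''X'' (rv ''u''))
   (Seq (rasg ''Y'' (rv ''V''))
   (Seq sweep_prog
   (Seq (iasg ''tp'' (INum 1))
   (Seq (rasg ''X'' (rv ''V''))
   (Seq (Cond (RLess (rv ''u'') (rnum 1)) (rasg ''Y'' (rv ''u'')) (rasg ''Y'' (rnum 1)))
   (Seq sweep_prog
        (iasg ''l'' (IPlus (iv ''l'') (INum 1))))))))))))))))))"

definition round_prog :: com where
  "round_prog =
    Seq (iasg ''l'' (INum 0))
   (Seq (While (ILess (iv ''l'') (iv ''len'')) coordinate_prog)
        (rasg ''V'' (RPlus (rv ''V'') (rv ''V''))))"

text \<open>
  Recomputing with a larger \<open>V\<close> finds all earlier darts again. Since recording a dart twice has no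
  effect, nothing needs to be reset between rounds.
\<close>

definition minhash_prog :: com where
  "minhash_prog =
    Seq (While (ILess (iv ''l'') (iv ''len''))
          (Seq (rasg ''s'' (RPlus (rv ''s'') (RCell ''weight'' (iv ''l''))))
               (iasg ''l'' (IPlus (iv ''l'') (INum 1)))))
   (Seq (rasg ''K'' (RTimes (RNat (iv ''k'')) (RPlus (RLn (RNat (iv ''k''))) (rnum 1))))
   (Seq (rasg ''V'' (RDivide (rnum 1) (rv ''s'')))
        (While (ILess (iv ''cnt'') (iv ''k'')) round_prog)))"

text \<open>Describes the memory through the set of pairs of bin and time seen so far. Sets absorb
  repetitions, so each part of the program just adds its own hits by a union.\<close>

definition recorded :: "(nat \<times> real) set \<Rightarrow> mem \<Rightarrow> bool" where
  "recorded D s \<longleftrightarrow> finite D \<and> (\<forall>j. imem s ''found'' j = (if j \<in> fst ` D then 1 else 0)) \<and>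
     imem s ''cnt'' 0 = card (fst ` D) \<and>
     (\<forall>j\<in>fst ` D. (j, rmem s ''out'' j) \<in> D \<and> (\<forall>t. (j, t) \<in> D \<longrightarrow> rmem s ''out'' j \<le> t))"

section \<open>Correctness and step counts of the program, from the inside out\<close>

lemma recorded_frame:
  assumes "recorded D s" "frame W s t" "''found'' \<notin> W" "''cnt'' \<notin> W" "''out'' \<notin> W"
  shows "recorded D t"
  using assms by (auto simp: recorded_def frame_def)

lemma recorded_update:
  assumes "recorded D s" "\<And>j. imem t ''found'' j = imem s ''found'' j" "\<And>j. imem t ''cnt'' j = imem s ''cnt'' j"
    "\<And>j. rmem t ''out'' j = rmem s ''out'' j"
  shows "recorded D t"
  using assms by (auto simp: recorded_def)

lemma wp_record_prog:
  assumes "recorded D s"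
  shows "wp \<omega> record_prog (\<lambda>m s'. m \<le> 5 \<and> frame {''found'', ''cnt'', ''out''} s s' \<and>
    recorded (insert (imem s ''j'' 0, rmem s ''t'' 0) D) s') s"
proof -
  define j where "j = imem s ''j'' 0"
  define t where "t = rmem s ''t'' 0"
  have D: "finite D" "\<And>j. imem s ''found'' j = (if j \<in> fst ` D then 1 else 0)"
     "imem s ''cnt'' 0 = card (fst ` D)"
     "\<And>j. j \<in> fst ` D \<Longrightarrow> (j, rmem s ''out'' j) \<in> D"
     "\<And>j t. (j, t) \<in> D \<Longrightarrow> rmem s ''out'' j \<le> t"
    using assms by (force simp: recorded_def)+
  show ?thesis
  proof (cases "j \<in> fst ` D")
    case False
    then have nD: "(j, t') \<notin> D" for t' by force
    let ?s = "rset ''out'' j t (iset ''cnt'' 0 (Suc (card (fst ` D))) (iset ''found'' j 1 s))"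
    have "recorded (insert (j, t) D) ?s"
      using False D nD unfolding recorded_def by (auto simp: image_iff)
    then show ?thesis using False D(2)[of j] D(3)
      by (simp add: record_prog_def j_def[symmetric] t_def[symmetric])
  next
    case True
    note out = D(4)[OF True]
    have img: "fst ` insert (j, t) D = fst ` D" using True by auto
    have rec: "recorded (insert (j, t) D) (if t < rmem s ''out'' j then rset ''out'' j t s else s)"
      unfolding recorded_def img using D True by (auto simp: not_less intro: order_trans dest: D(5))
    then show ?thesis using True D(2)[of j]
      by (auto simp: record_prog_def j_def[symmetric] t_def[symmetric])
  qed
qed

abbreviation "cell_vars \<equiv> {''a'', ''b'', ''j'', ''w'', ''t'', ''found'', ''cnt'', ''out'', ''U'', ''n'', ''pr'', ''cdf''}"

definition at_cell :: "cell \<Rightarrow> mem \<Rightarrow> bool" where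
  "at_cell c s \<longleftrightarrow> (\<exists>i tp e q. c = (i, tp, e, q) \<and> imem s ''i'' 0 = i \<and> imem s ''tp'' 0 = tp \<and>
     imem s ''e'' 0 = e \<and> imem s ''q'' 0 = q \<and> rmem s ''lo'' 0 = (if tp = 2 then 0 else 2 ^ e) \<and> rmem s ''p'' 0 = 2 ^ e)"

definition at_params :: "nat \<Rightarrow> real \<Rightarrow> real \<Rightarrow> mem \<Rightarrow> bool" where
  "at_params k u V s \<longleftrightarrow> imem s ''k'' 0 = k \<and> rmem s ''u'' 0 = u \<and> rmem s ''V'' 0 = V"

lemma at_cell_frame: "at_cell c s \<Longrightarrow> frame cell_vars s t \<Longrightarrow> at_cell c t"
  by (auto simp: at_cell_def frameD)

lemma at_params_frame: "at_params k u V s \<Longrightarrow> frame W s t \<Longrightarrow> ''k'' \<notin> W \<Longrightarrow> ''u'' \<notin> W \<Longrightarrow> ''V'' \<notin> W \<Longrightarrow> at_params k u V t"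
  by (auto simp: at_params_def frameD)

lemma wp_sample_prog:
  assumes "at_cell c s" "at_params k u V s" "imem s ''n'' 0 = n"
  shows "wp \<omega> sample_prog (\<lambda>m s'. m \<le> 8 \<and> frame {''a'', ''b'', ''j'', ''w'', ''t''} s s' \<and>
    imem s' ''j'' 0 = dart_bin k \<omega> c n \<and> rmem s' ''w'' 0 = dart_weight \<omega> c n \<and> rmem s' ''t'' 0 = dart_time \<omega> c n) s"
proof -
  obtain i tp e q where c: "c = (i, tp, e, q)" and [simp]: "imem s ''i'' 0 = i" "imem s ''tp'' 0 = tp"
     "imem s ''e'' 0 = e" "imem s ''q'' 0 = q" "rmem s ''lo'' 0 = (if tp = 2 then 0 else 2 ^ e)" "rmem s ''p'' 0 = 2 ^ e"
     "imem s ''k'' 0 = k" "imem s ''n'' 0 = n"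
    using assms by (auto simp: at_cell_def at_params_def)
  show ?thesis
    unfolding sample_prog_def dart_key_def c
    by (simp add: dart_bin_def dart_weight_def dart_time_def)
qed

lemma wp_dart_prog:
  assumes "at_cell c s" "at_params k u V s" "imem s ''n'' 0 = n" "recorded D s"
  shows "wp \<omega> dart_prog (\<lambda>m s'. m \<le> 14 \<and> frame {''a'', ''b'', ''j'', ''w'', ''t'', ''found'', ''cnt'', ''out''} s s' \<and>
    recorded (if dart_weight \<omega> c n < u \<and> dart_time \<omega> c n < V then insert (dart_bin k \<omega> c n, dart_time \<omega> c n) D else D) s') s"
  unfolding dart_prog_def wp_Seq
proof (rule wp_mono[OF wp_sample_prog[OF assms(1,2,3)]], elim conjE)
  fix m :: nat and t :: mem
  assume m: "m \<le> 8" and f: "frame {''a'', ''b'', ''j'', ''w'', ''t''} s t"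
    and t: "imem t ''j'' 0 = dart_bin k \<omega> c n" "rmem t ''w'' 0 = dart_weight \<omega> c n" "rmem t ''t'' 0 = dart_time \<omega> c n"
  have p: "rmem t ''u'' 0 = u" "rmem t ''V'' 0 = V"
    using at_params_frame[OF assms(2) f] by (auto simp: at_params_def)
  have rec: "recorded D t" by (rule recorded_frame[OF assms(4) f]) auto
  have fr: "frame {''a'', ''b'', ''j'', ''w'', ''t'', ''found'', ''cnt'', ''out''} s t'"
    if "frame {''found'', ''cnt'', ''out''} t t'" for t'
    by (rule frame_trans[OF f that]) auto
  show "wp \<omega> (Cond (BAnd (RLess (rv ''w'') (rv ''u'')) (RLess (rv ''t'') (rv ''V''))) record_prog Skip)
     (\<lambda>n' s'. m + n' \<le> 14 \<and> frame {''a'', ''b'', ''j'', ''w'', ''t'', ''found'', ''cnt'', ''out''} s s' \<and>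
    recorded (if dart_weight \<omega> c n < u \<and> dart_time \<omega> c n < V then insert (dart_bin k \<omega> c n, dart_time \<omega> c n) D else D) s') t"
  proof (cases "dart_weight \<omega> c n < u \<and> dart_time \<omega> c n < V")
    case True
    have "wp \<omega> record_prog (\<lambda>m' s'. m' \<le> 5 \<and> frame {''found'', ''cnt'', ''out''} t s' \<and>
      recorded (insert (dart_bin k \<omega> c n, dart_time \<omega> c n) D) s') t"
      using wp_record_prog[OF rec] t by simp
    then have "wp \<omega> record_prog (\<lambda>n' s'. m + Suc n' \<le> 14 \<and> frame {''a'', ''b'', ''j'', ''w'', ''t'', ''found'', ''cnt'', ''out''} s s' \<and>
      recorded (insert (dart_bin k \<omega> c n, dart_time \<omega> c n) D) s') t"
      by (rule wp_mono) (use m fr in auto)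
    then show ?thesis using True t p by simp
  next
    case False
    then show ?thesis using t p rec fr[of t] m by auto
  qed
qed

text \<open>The bound \<open>N\<close> is a parameter, separate from the number of darts of the
  cell, so that initial segments of the darts can appear in the loop invariant.\<close>

definition hits :: "nat \<Rightarrow> hashfun \<Rightarrow> real \<Rightarrow> real \<Rightarrow> cell \<Rightarrow> nat \<Rightarrow> (nat \<times> real) set" where
  "hits k \<omega> u V c N = {(dart_bin k \<omega> c n, dart_time \<omega> c n) | n. n < N \<and> dart_weight \<omega> c n < u \<and> dart_time \<omega> c n < V}"

lemma hits_0 [simp]: "hits k \<omega> u V c 0 = {}"
  by (simp add: hits_def)

lemma hits_Suc: "hits k \<omega> u V c (Suc n) =
    (if dart_weight \<omega> c n < u \<and> dart_time \<omega> c n < V then insert (dart_bin k \<omega> c n, dart_time \<omega> c n) (hits k \<omega> u V c n) else hits k \<omega> u V c n)"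
  by (auto simp: hits_def less_Suc_eq)

lemma wp_cell_prog:
  assumes "at_cell c s" "at_params k u V s" "recorded D s" and U: "unit_valued \<omega>"
  shows "wp \<omega> cell_prog (\<lambda>m t. m \<le> 18 * (1 + num_darts \<omega> c) \<and> frame cell_vars s t \<and>
    recorded (D \<union> hits k \<omega> u V c (num_darts \<omega> c)) t) s"
proof -
  define N where "N = num_darts \<omega> c"
  define u0 where "u0 = \<omega> (key c 0 0)"
  define I where "I n t \<longleftrightarrow> frame cell_vars s t \<and> recorded (D \<union> hits k \<omega> u V c n) t \<and> imem t ''n'' 0 = n \<and>
     rmem t ''U'' 0 = u0 \<and> rmem t ''pr'' 0 = exp (-1) / fact n \<and> rmem t ''cdf'' 0 = poisson_cdf n" for n t
  define body where "body = Seq dart_prog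
          (Seq (iasg ''n'' (IPlus (iv ''n'') (INum 1)))
          (Seq (rasg ''pr'' (RDivide (rv ''pr'') (RNat (iv ''n''))))
               (rasg ''cdf'' (RPlus (rv ''cdf'') (rv ''pr'')))))"
  define b where "b = BNot (RLess (rv ''U'') (rv ''cdf''))"
  \<comment> \<open>17 is made up of at most 14 steps for the dart and three assignments.\<close>
  have loop: "wp \<omega> (While b body) (\<lambda>m t. m \<le> 1 + (\<Sum>n<N. 1 + 17) \<and> I N t) t" if "I 0 t" for t
  proof (rule wp_for[where I = I])
    fix n t assume "n \<le> N" and I: "I n t"
    have "num_darts \<omega> c \<le> n \<longleftrightarrow> u0 < poisson_cdf n"
      unfolding u0_def using U by (intro num_darts_le_iff) auto
    then show "bval t b \<longleftrightarrow> n < N" using I by (auto simp: b_def I_def N_def)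
  next
    fix n t assume "n < N" and I: "I n t"
    then have t: "frame cell_vars s t" "recorded (D \<union> hits k \<omega> u V c n) t" "imem t ''n'' 0 = n"
       "rmem t ''U'' 0 = u0" "rmem t ''pr'' 0 = exp (-1) / fact n" "rmem t ''cdf'' 0 = poisson_cdf n"
      by (auto simp: I_def)
    have "at_params k u V t" by (rule at_params_frame[OF assms(2) t(1)]) auto
    from wp_dart_prog[OF at_cell_frame[OF assms(1) t(1)] this t(3) t(2), of \<omega>]
    show "wp \<omega> body (\<lambda>m t. m \<le> 17 \<and> I (Suc n) t) t"
      unfolding body_def wp_Seq
    proof (rule wp_mono, elim conjE)
      fix m :: nat and t' :: mem
      assume m: "m \<le> 14" and f: "frame {''a'', ''b'', ''j'', ''w'', ''t'', ''found'', ''cnt'', ''out''} t t'"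
        and rec: "recorded (if dart_weight \<omega> c n < u \<and> dart_time \<omega> c n < V
           then insert (dart_bin k \<omega> c n, dart_time \<omega> c n) (D \<union> hits k \<omega> u V c n) else D \<union> hits k \<omega> u V c n) t'"
      have rec': "recorded (D \<union> hits k \<omega> u V c (Suc n)) t'"
      proof -
        have "D \<union> hits k \<omega> u V c (Suc n) = (if dart_weight \<omega> c n < u \<and> dart_time \<omega> c n < V
           then insert (dart_bin k \<omega> c n, dart_time \<omega> c n) (D \<union> hits k \<omega> u V c n) else D \<union> hits k \<omega> u V c n)"
          by (simp add: hits_Suc)
        with rec show ?thesis by (simp only:)
      qed
      have f': "frame cell_vars s t'" by (rule frame_trans[OF t(1) f]) auto
      have v: "imem t' ''n'' 0 = n" "rmem t' ''U'' 0 = u0" "rmem t' ''pr'' 0 = exp (-1) / fact n" "rmem t' ''cdf'' 0 = poisson_cdf n"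
        using t f by (auto simp: frameD)
      show "wp \<omega> (iasg ''n'' (IPlus (iv ''n'') (INum 1)))
            (\<lambda>ma. wp \<omega> (rasg ''pr'' (RDivide (rv ''pr'') (RNat (iv ''n''))))
              (\<lambda>mb. wp \<omega> (rasg ''cdf'' (RPlus (rv ''cdf'') (rv ''pr''))) (\<lambda>n' t. m + (ma + (mb + n')) \<le> 17 \<and> I (Suc n) t))) t'"
        using m f' v by (simp add: I_def recorded_update[OF rec'] poisson_cdf_def)
    qed
  next
    show "I 0 t" by (rule that)
  qed
  obtain i tp e q where c: "c = (i, tp, e, q)" and v: "imem s ''i'' 0 = i" "imem s ''tp'' 0 = tp"
     "imem s ''e'' 0 = e" "imem s ''q'' 0 = q"
    using assms(1) by (auto simp: at_cell_def)
  show ?thesis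
    unfolding cell_prog_def body_def[symmetric] b_def[symmetric] wp_Seq
    apply (simp only: wp_RHash wp_IAssign wp_RAssign)
    apply (rule wp_mono[OF loop])
     apply (simp add: I_def recorded_update[OF assms(3)] u0_def c v dart_key_def poisson_cdf_def)
    apply (auto simp: I_def N_def)
    done
qed

lemma initial_segment:
  assumes "\<And>q. P (Suc q) \<Longrightarrow> P q" "\<exists>q. \<not> P q"
  obtains N where "\<And>q. P q \<longleftrightarrow> q < (N::nat)"
proof
  define N where "N = (LEAST q. \<not> P q)"
  have N: "\<not> P N" unfolding N_def using assms(2) by (rule LeastI_ex)
  have down: "\<not> P q \<Longrightarrow> \<not> P (q + m)" for q m
    by (induction m) (use assms(1) in auto)
  fix q show "P q \<longleftrightarrow> q < N"
    using not_less_Least[of q "\<lambda>q. \<not> P q"] down[OF N, of "q - N"] by (cases "q < N") (auto simp: N_def)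
qed

lemma power2_segment: "\<exists>E. \<forall>e. (2::real) ^ e < X \<longleftrightarrow> e < E"
proof -
  obtain E where "\<And>e. (2::real) ^ e < X \<longleftrightarrow> e < E"
  proof (rule initial_segment[of "\<lambda>e. (2::real) ^ e < X"])
    show "2 ^ e < X" if "2 ^ Suc e < X" for e
      using that zero_less_power[of "2::real" e] by (simp del: zero_less_power)
    obtain n where "X < 2 ^ n" using real_arch_pow[of 2 X] by auto
    then show "\<exists>e. \<not> 2 ^ e < X" by (intro exI[of _ n]) simp
  qed blast
  then show ?thesis by blast
qed

definition cell_cost :: "hashfun \<Rightarrow> cell \<Rightarrow> nat" where
  "cell_cost \<omega> c = 1 + num_darts \<omega> c"

definition cell_hits :: "nat \<Rightarrow> hashfun \<Rightarrow> real \<Rightarrow> real \<Rightarrow> cell \<Rightarrow> (nat \<times> real) set" where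
  "cell_hits k \<omega> u V c = hits k \<omega> u V c (num_darts \<omega> c)"

lemma wp_Seq_iasg: "wp \<omega> (Seq (iasg a e) c) Q s \<longleftrightarrow> wp \<omega> c (\<lambda>n. Q (1 + n)) (iset a 0 (ival s e) s)"
  by simp

lemma wp_Seq_rasg: "wp \<omega> (Seq (rasg a e) c) Q s \<longleftrightarrow> wp \<omega> c (\<lambda>n. Q (1 + n)) (rset a 0 (rval s e) s)"
  by simp

abbreviation "sweep_vars \<equiv> cell_vars \<union> {''e'', ''p'', ''lo'', ''q''}"

lemma wp_row:
  assumes s: "imem s ''i'' 0 = i" "imem s ''tp'' 0 = tp" "imem s ''e'' 0 = e" "rmem s ''lo'' 0 = 2 ^ e" "rmem s ''p'' 0 = 2 ^ e"
      "rmem s ''Y'' 0 = Y" "at_params k u V s" "recorded D s" "imem s ''q'' 0 = 0"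
    and tp: "tp \<noteq> 2" and U: "unit_valued \<omega>" and N: "\<And>q. real q / 2 ^ e < Y \<longleftrightarrow> q < N"
  shows "wp \<omega> (While (RLess (RDivide (RNat (iv ''q'')) (rv ''p'')) (rv ''Y'')) (Seq cell_prog (iasg ''q'' (IPlus (iv ''q'') (INum 1)))))
    (\<lambda>m t. m \<le> 1 + (\<Sum>q<N. 20 * cell_cost \<omega> (i, tp, e, q)) \<and> frame (cell_vars \<union> {''q''}) s t \<and>
       recorded (D \<union> (\<Union>q<N. cell_hits k \<omega> u V (i, tp, e, q))) t) s"
proof -
  define I where "I q t \<longleftrightarrow> frame (cell_vars \<union> {''q''}) s t \<and> imem t ''q'' 0 = q \<and>
    recorded (D \<union> (\<Union>q<q. cell_hits k \<omega> u V (i, tp, e, q))) t" for q t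
  have "wp \<omega> (While (RLess (RDivide (RNat (iv ''q'')) (rv ''p'')) (rv ''Y'')) (Seq cell_prog (iasg ''q'' (IPlus (iv ''q'') (INum 1)))))
    (\<lambda>m t. m \<le> 1 + (\<Sum>q<N. 1 + (18 * cell_cost \<omega> (i, tp, e, q) + 1)) \<and> I N t) s"
  proof (rule wp_for[where I = I])
    fix q t assume I: "I q t"
    then have "frame (cell_vars \<union> {''q''}) s t" by (simp add: I_def)
    from frameD(2)[OF this, of "''p''"] frameD(2)[OF this, of "''Y''"] I show "bval t (RLess (RDivide (RNat (iv ''q'')) (rv ''p'')) (rv ''Y'')) \<longleftrightarrow> q < N"
      using s N by (simp add: I_def)
  next
    fix q t assume "q < N" and I: "I q t"
    then have f: "frame (cell_vars \<union> {''q''}) s t" and q: "imem t ''q'' 0 = q"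
      and rec: "recorded (D \<union> (\<Union>q<q. cell_hits k \<omega> u V (i, tp, e, q))) t" by (auto simp: I_def)
    have c: "at_cell (i, tp, e, q) t" using f q s tp by (simp add: at_cell_def frameD)
    have p: "at_params k u V t" by (rule at_params_frame[OF s(7) f]) auto
    show "wp \<omega> (Seq cell_prog (iasg ''q'' (IPlus (iv ''q'') (INum 1))))
       (\<lambda>m t. m \<le> 18 * cell_cost \<omega> (i, tp, e, q) + 1 \<and> I (Suc q) t) t"
      unfolding wp_Seq
    proof (rule wp_mono[OF wp_cell_prog[OF c p rec U]], elim conjE)
      fix m :: nat and t'
      assume m: "m \<le> 18 * (1 + num_darts \<omega> (i, tp, e, q))" and f': "frame cell_vars t t'"
        and rec': "recorded (D \<union> (\<Union>q<q. cell_hits k \<omega> u V (i, tp, e, q)) \<union> hits k \<omega> u V (i, tp, e, q) (num_darts \<omega> (i, tp, e, q))) t'"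
      have f'': "frame (cell_vars \<union> {''q''}) s t'" by (rule frame_trans[OF f f']) auto
      have q': "imem t' ''q'' 0 = q" using f' q by (simp add: frameD)
      have eq: "D \<union> (\<Union>q<q. cell_hits k \<omega> u V (i, tp, e, q)) \<union> hits k \<omega> u V (i, tp, e, q) (num_darts \<omega> (i, tp, e, q))
        = D \<union> (\<Union>q<Suc q. cell_hits k \<omega> u V (i, tp, e, q))"
        by (auto simp: lessThan_Suc cell_hits_def)
      show "wp \<omega> (iasg ''q'' (IPlus (iv ''q'') (INum 1))) (\<lambda>n t. m + n \<le> 18 * cell_cost \<omega> (i, tp, e, q) + 1 \<and> I (Suc q) t) t'"
        using m f'' q' rec'[unfolded eq] by (simp add: I_def recorded_update cell_cost_def)
    qed
  next
    show "I 0 s" using s by (simp add: I_def)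
  qed
  then show ?thesis
  proof (rule wp_mono, elim conjE)
    fix m :: nat and t
    assume m: "m \<le> 1 + (\<Sum>q<N. 1 + (18 * cell_cost \<omega> (i, tp, e, q) + 1))" and I: "I N t"
    have "(\<Sum>q<N. 1 + (18 * cell_cost \<omega> (i, tp, e, q) + 1)) \<le> (\<Sum>q<N. 20 * cell_cost \<omega> (i, tp, e, q))"
      by (intro sum_mono) (simp add: cell_cost_def)
    with m I show "m \<le> 1 + (\<Sum>q<N. 20 * cell_cost \<omega> (i, tp, e, q)) \<and> frame (cell_vars \<union> {''q''}) s t \<and>
       recorded (D \<union> (\<Union>q<N. cell_hits k \<omega> u V (i, tp, e, q))) t" by (simp add: I_def)
  qed
qed

definition sweep_cells :: "nat \<Rightarrow> nat \<Rightarrow> real \<Rightarrow> real \<Rightarrow> cell set" where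
  "sweep_cells i tp X Y = {(i, tp, e, q) | e q. 2 ^ e < X \<and> real q / 2 ^ e < Y}"

lemma wp_sweep_prog:
  assumes s: "imem s ''i'' 0 = i" "imem s ''tp'' 0 = tp" "rmem s ''X'' 0 = X" "rmem s ''Y'' 0 = Y" "at_params k u V s" "recorded D s"
    and tp: "tp \<noteq> 2" and U: "unit_valued \<omega>" and Y: "0 < Y"
  shows "wp \<omega> sweep_prog
    (\<lambda>m t. m \<le> 3 + 26 * (\<Sum>c\<in>sweep_cells i tp X Y. cell_cost \<omega> c) \<and> frame sweep_vars s t \<and>
       recorded (D \<union> (\<Union>c\<in>sweep_cells i tp X Y. cell_hits k \<omega> u V c)) t) s"
proof -
  obtain E where E: "\<And>e. (2::real) ^ e < X \<longleftrightarrow> e < E" using power2_segment by metis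
  have "\<exists>N. \<forall>q. real q / 2 ^ e < Y \<longleftrightarrow> q < N" for e
  proof -
    obtain N where "\<And>q. real q / 2 ^ e < Y \<longleftrightarrow> q < N"
    proof (rule initial_segment[of "\<lambda>q. real q / 2 ^ e < Y"])
      show "real q / 2 ^ e < Y" if "real (Suc q) / 2 ^ e < Y" for q
        by (rule le_less_trans[OF _ that]) (simp add: divide_right_mono)
      obtain n where "Y * 2 ^ e < real n" using reals_Archimedean2 by blast
      then show "\<exists>q. \<not> real q / 2 ^ e < Y" by (intro exI[of _ n]) (simp add: field_simps)
    qed blast
    then show ?thesis by blast
  qed
  then obtain N where N: "\<And>e q. real q / 2 ^ e < Y \<longleftrightarrow> q < N e" by metis
  have N1: "1 \<le> N e" for e using N[of 0 e] Y by simp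
  have cells: "sweep_cells i tp X Y = (\<lambda>(e, q). (i, tp, e, q)) ` (SIGMA e:{..<E}. {..<N e})"
    by (auto simp: sweep_cells_def E N)
  have sum_cells: "(\<Sum>c\<in>sweep_cells i tp X Y. cell_cost \<omega> c) = (\<Sum>e<E. \<Sum>q<N e. cell_cost \<omega> (i, tp, e, q))"
    unfolding cells by (subst sum.reindex) (auto simp: inj_on_def sum.Sigma split_beta)
  have UN_cells: "(\<Union>c\<in>sweep_cells i tp X Y. cell_hits k \<omega> u V c) = (\<Union>e<E. \<Union>q<N e. cell_hits k \<omega> u V (i, tp, e, q))"
    unfolding cells by auto
  let ?F = "\<lambda>e. \<Union>e<e. \<Union>q<N e. cell_hits k \<omega> u V (i, tp, e, q)"
  let ?R = "\<lambda>e. \<Union>q<N e. cell_hits k \<omega> u V (i, tp, e, q)"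
  let ?S = "\<lambda>e. \<Sum>q<N e. 20 * cell_cost \<omega> (i, tp, e, q)"
  define I where "I e t \<longleftrightarrow> frame sweep_vars s t \<and> imem t ''e'' 0 = e \<and> rmem t ''p'' 0 = 2 ^ e \<and>
    recorded (D \<union> ?F e) t" for e t
  define row where "row = While (RLess (RDivide (RNat (iv ''q'')) (rv ''p'')) (rv ''Y'')) (Seq cell_prog (iasg ''q'' (IPlus (iv ''q'') (INum 1))))"
  define body where "body = Seq (rasg ''lo'' (rv ''p'')) (Seq (iasg ''q'' (INum 0)) (Seq row
          (Seq (rasg ''p'' (RPlus (rv ''p'') (rv ''p''))) (iasg ''e'' (IPlus (iv ''e'') (INum 1))))))"
  have loop: "wp \<omega> (While (RLess (rv ''p'') (rv ''X'')) body)
    (\<lambda>m t. m \<le> 1 + (\<Sum>e<E. 1 + (5 + ?S e)) \<and> I E t) t" if "I 0 t" for t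
  proof (rule wp_for[where I = I])
    fix e t assume I: "I e t"
    then have "frame sweep_vars s t" by (simp add: I_def)
    from frameD(2)[OF this, of "''X''"] I show "bval t (RLess (rv ''p'') (rv ''X'')) \<longleftrightarrow> e < E"
      using s E by (simp add: I_def)
  next
    fix e t assume "e < E" and I: "I e t"
    then have f: "frame sweep_vars s t" and e: "imem t ''e'' 0 = e" "rmem t ''p'' 0 = 2 ^ e"
      and rec: "recorded (D \<union> ?F e) t" by (auto simp: I_def)
    let ?t = "iset ''q'' 0 0 (rset ''lo'' 0 (2 ^ e) t)"
    have f0: "frame sweep_vars s ?t" using f by simp
    have p0: "at_params k u V ?t" by (rule at_params_frame[OF s(5) f0]) auto
    have rec0: "recorded (D \<union> ?F e) ?t"
      by (rule recorded_update[OF rec]) auto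
    have "wp \<omega> row (\<lambda>m t'. m \<le> 1 + ?S e \<and> frame (cell_vars \<union> {''q''}) ?t t' \<and>
       recorded (D \<union> ?F e \<union> ?R e) t') ?t"
      unfolding row_def
      by (rule wp_row[where Y = Y]) (use frameD(1)[OF f, of "''i''"] frameD(1)[OF f, of "''tp''"] frameD(2)[OF f, of "''Y''"] e s p0 rec0 tp U N in auto)
    then have "wp \<omega> row (\<lambda>m t'. wp \<omega> (Seq (rasg ''p'' (RPlus (rv ''p'') (rv ''p''))) (iasg ''e'' (IPlus (iv ''e'') (INum 1))))
        (\<lambda>n t. 1 + (1 + (m + n)) \<le> 5 + ?S e \<and> I (Suc e) t) t') ?t"
    proof (rule wp_mono, elim conjE)
      fix m :: nat and t'
      assume m: "m \<le> 1 + ?S e" and f': "frame (cell_vars \<union> {''q''}) ?t t'"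
        and rec': "recorded (D \<union> ?F e \<union> ?R e) t'"
      have f'': "frame sweep_vars s t'" by (rule frame_trans[OF f0 f']) auto
      have e': "imem t' ''e'' 0 = e" "rmem t' ''p'' 0 = 2 ^ e" using f' e by (simp_all add: frameD)
      have eq: "D \<union> ?F e \<union> ?R e
        = D \<union> (\<Union>e<Suc e. \<Union>q<N e. cell_hits k \<omega> u V (i, tp, e, q))"
        by (auto simp: lessThan_Suc)
      show "wp \<omega> (Seq (rasg ''p'' (RPlus (rv ''p'') (rv ''p''))) (iasg ''e'' (IPlus (iv ''e'') (INum 1))))
        (\<lambda>n t. 1 + (1 + (m + n)) \<le> 5 + ?S e \<and> I (Suc e) t) t'"
        using m f'' e' by (simp add: I_def recorded_update[OF rec'[unfolded eq]])
    qed
    then show "wp \<omega> body (\<lambda>m t. m \<le> 5 + ?S e \<and> I (Suc e) t) t"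
      unfolding body_def using e by simp
  next
    show "I 0 t" by (rule that)
  qed
  \<comment> \<open>As \<open>Y\<close> is positive, every row contains at least the cell with q =
    0. The 6 steps of overhead of a row are charged to its cells, which raises the factor from 20 to
    26.\<close>
  have bound: "(\<Sum>e<E. 1 + (5 + ?S e)) \<le> 26 * (\<Sum>e<E. \<Sum>q<N e. cell_cost \<omega> (i, tp, e, q))"
    unfolding sum_distrib_left
  proof (intro sum_mono)
    fix e
    have "1 \<le> (\<Sum>q<N e. 1::nat)" using N1[of e] by simp
    also have "\<dots> \<le> (\<Sum>q<N e. cell_cost \<omega> (i, tp, e, q))" by (intro sum_mono) (simp add: cell_cost_def)
    finally show "1 + (5 + ?S e) \<le> (\<Sum>q<N e. 26 * cell_cost \<omega> (i, tp, e, q))"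
      unfolding sum_distrib_left[symmetric] by linarith
  qed
  have I0: "I 0 (rset ''p'' 0 1 (iset ''e'' 0 0 s))"
    by (simp add: I_def recorded_update[OF s(6)])
  have "wp \<omega> (While (RLess (rv ''p'') (rv ''X'')) body)
    (\<lambda>m t. 1 + (1 + m) \<le> 3 + 26 * (\<Sum>c\<in>sweep_cells i tp X Y. cell_cost \<omega> c) \<and> frame sweep_vars s t \<and>
       recorded (D \<union> (\<Union>c\<in>sweep_cells i tp X Y. cell_hits k \<omega> u V c)) t) (rset ''p'' 0 1 (iset ''e'' 0 0 s))"
    unfolding sum_cells UN_cells
    by (rule wp_mono[OF loop[OF I0]]) (use bound in \<open>auto simp: I_def\<close>)
  then show ?thesis
    unfolding sweep_prog_def body_def row_def by simp
qed

abbreviation "coordinate_vars \<equiv> sweep_vars \<union> {''i'', ''u'', ''tp'', ''X'', ''Y'', ''l''}"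

text \<open>The visited cells by type. For type 1 the condition \<open>q < 2 ^ e\<close> says that
  the lower weight is below 1, which explains the minimum. Positivity of both bounds puts the unit
  square among the visited cells.\<close>

lemma visit_coordinate:
  assumes "0 < z i" "0 < V"
  shows "{c \<in> visit z V. fst c = i} = insert (i, 2, 0, 0) (sweep_cells i 0 (z i) V \<union> sweep_cells i 1 V (min (z i) 1))"
proof -
  have "real q / 2 ^ e < 1 \<longleftrightarrow> q < 2 ^ e" for q e
  proof -
    have "real q / 2 ^ e < 1 \<longleftrightarrow> real q < real (2 ^ e)" by simp
    then show ?thesis by (simp only: of_nat_less_iff)
  qed
  then show ?thesis using assms
    by (auto simp: visit_def all_cells_def sweep_cells_def weight_low_def time_low_def)
qed

lemma finite_visit_coordinate: "finite {c \<in> visit z V. fst c = i}"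
proof -
  have "{c \<in> visit z V. fst c = i} \<subseteq> visit (\<lambda>i'. if i' = i then z i else 0) V"
    by (auto simp: visit_def)
  then show ?thesis by (rule finite_subset) (rule finite_visit[of "Suc i"], auto)
qed

lemma wp_coordinate_prog:
  assumes s: "imem s ''index'' (imem s ''l'' 0) = i" "rmem s ''K'' 0 * rmem s ''weight'' (imem s ''l'' 0) = z i"
     "imem s ''k'' 0 = k" "rmem s ''V'' 0 = V" "recorded D s"
    and U: "unit_valued \<omega>" and pos: "0 < z i" "0 < V"
  shows "wp \<omega> coordinate_prog
    (\<lambda>m t. m \<le> 60 * (\<Sum>c\<in>{c \<in> visit z V. fst c = i}. cell_cost \<omega> c) \<and> frame coordinate_vars s t \<and>
       imem t ''l'' 0 = Suc (imem s ''l'' 0) \<and>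
       recorded (D \<union> (\<Union>c\<in>{c \<in> visit z V. fst c = i}. cell_hits k \<omega> (z (fst c)) V c)) t) s"
proof -
  let ?H = "cell_hits k \<omega> (z i) V"
  define A where "A = sweep_cells i 0 (z i) V"
  define B where "B = sweep_cells i 1 V (min (z i) 1)"
  define c0 where "c0 = (i, 2::nat, 0::nat, 0::nat)"
  have cells: "{c \<in> visit z V. fst c = i} = insert c0 (A \<union> B)"
    unfolding visit_coordinate[where z = z and i = i and V = V, OF pos] A_def B_def c0_def ..
  have fin: "finite A" "finite B"
    using finite_visit_coordinate[of z V i] unfolding cells by auto
  have dis: "A \<inter> B = {}" "c0 \<notin> A \<union> B" by (auto simp: A_def B_def c0_def sweep_cells_def)
  have sum_cells: "(\<Sum>c\<in>insert c0 (A \<union> B). cell_cost \<omega> c) = cell_cost \<omega> c0 + (\<Sum>c\<in>A. cell_cost \<omega> c) + (\<Sum>c\<in>B. cell_cost \<omega> c)"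
    using fin dis by (simp add: sum.union_disjoint)
  have UN_cells: "(\<Union>c\<in>insert c0 (A \<union> B). cell_hits k \<omega> (z (fst c)) V c) = ?H c0 \<union> (\<Union>c\<in>A. ?H c) \<union> (\<Union>c\<in>B. ?H c)"
    by (auto simp: A_def B_def c0_def sweep_cells_def)
  define l where "l = imem s ''l'' 0"
  let ?rest = "Seq (iasg ''tp'' (INum 1)) (Seq (rasg ''X'' (rv ''V''))
      (Seq (Cond (RLess (rv ''u'') (rnum 1)) (rasg ''Y'' (rv ''u'')) (rasg ''Y'' (rnum 1)))
      (Seq sweep_prog (iasg ''l'' (IPlus (iv ''l'') (INum 1))))))"
  let ?Q = "\<lambda>m t'. m \<le> 60 * (\<Sum>c\<in>insert c0 (A \<union> B). cell_cost \<omega> c) \<and> frame coordinate_vars s t' \<and>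
    imem t' ''l'' 0 = Suc l \<and> recorded (D \<union> (?H c0 \<union> (\<Union>c\<in>A. ?H c) \<union> (\<Union>c\<in>B. ?H c))) t'"
  define s1 where "s1 = rset ''p'' 0 1 (rset ''lo'' 0 0 (iset ''q'' 0 0 (iset ''e'' 0 0 (iset ''tp'' 0 2 (rset ''u'' 0 (z i) (iset ''i'' 0 i s))))))"
  have f1: "frame coordinate_vars s s1" by (simp add: s1_def)
  have r1: "recorded D s1" by (rule recorded_update[OF s(5)]) (auto simp: s1_def)
  have p1: "at_params k (z i) V s1" using s by (simp add: s1_def at_params_def)
  have c1: "at_cell c0 s1" by (simp add: s1_def at_cell_def c0_def)
  \<comment> \<open>The program is treated from its end backwards, and \<open>m\<close> stands for
    the steps already spent. All constants are finally absorbed by the cost of the unit square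
    \<open>c0\<close>, which is at least 1.\<close>
  have step3: "wp \<omega> (Seq sweep_prog (iasg ''l'' (IPlus (iv ''l'') (INum 1))))
      (\<lambda>m' t'. ?Q (m + m') t') t"
    if f: "frame coordinate_vars s t" "imem t ''l'' 0 = l" and p: "at_params k (z i) V t"
      and m: "m \<le> 20 + 18 * cell_cost \<omega> c0 + 26 * (\<Sum>c\<in>A. cell_cost \<omega> c)"
      and r: "recorded (D \<union> ?H c0 \<union> (\<Union>c\<in>A. ?H c)) t"
      and t: "imem t ''i'' 0 = i" "imem t ''tp'' 0 = 1" "rmem t ''X'' 0 = V" "rmem t ''Y'' 0 = min (z i) 1"
    for t and m :: nat
  proof -
    have "wp \<omega> sweep_prog (\<lambda>m t'. m \<le> 3 + 26 * (\<Sum>c\<in>B. cell_cost \<omega> c) \<and> frame sweep_vars t t' \<and>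
       recorded (D \<union> ?H c0 \<union> (\<Union>c\<in>A. ?H c) \<union> (\<Union>c\<in>B. ?H c)) t') t"
      unfolding B_def by (rule wp_sweep_prog) (use t p r U pos in auto)
    then show ?thesis
      unfolding wp_Seq
    proof (rule wp_mono, elim conjE)
      fix m' :: nat and t'
      assume m': "m' \<le> 3 + 26 * (\<Sum>c\<in>B. cell_cost \<omega> c)" and f': "frame sweep_vars t t'"
        and r': "recorded (D \<union> ?H c0 \<union> (\<Union>c\<in>A. ?H c) \<union> (\<Union>c\<in>B. ?H c)) t'"
      have "frame coordinate_vars s t'" by (rule frame_trans[OF f(1) f']) auto
      moreover have "imem t' ''l'' 0 = l" using frameD(1)[OF f', of "''l''"] f(2) by simp
      moreover have "1 \<le> cell_cost \<omega> c0" by (simp add: cell_cost_def)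
      ultimately show "wp \<omega> (iasg ''l'' (IPlus (iv ''l'') (INum 1)))
         (\<lambda>n t'. ?Q (m + (m' + n)) t') t'"
        using m m' unfolding sum_cells by (simp add: recorded_update[OF r'[unfolded Un_assoc]] Un_assoc)
    qed
  qed
  have step2: "wp \<omega> (Seq sweep_prog ?rest)
      (\<lambda>m' t'. ?Q (m + m') t') t"
    if f: "frame coordinate_vars s t" "imem t ''l'' 0 = l" and p: "at_params k (z i) V t"
      and m: "m \<le> 10 + 18 * cell_cost \<omega> c0"
      and r: "recorded (D \<union> ?H c0) t"
      and t: "imem t ''i'' 0 = i" "imem t ''tp'' 0 = 0" "rmem t ''X'' 0 = z i" "rmem t ''Y'' 0 = V"
    for t and m :: nat
  proof -
    have "wp \<omega> sweep_prog (\<lambda>m t'. m \<le> 3 + 26 * (\<Sum>c\<in>A. cell_cost \<omega> c) \<and> frame sweep_vars t t' \<and>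
       recorded (D \<union> ?H c0 \<union> (\<Union>c\<in>A. ?H c)) t') t"
      unfolding A_def by (rule wp_sweep_prog) (use t p r U pos in auto)
    then show ?thesis
      unfolding wp_Seq[of _ sweep_prog "Seq (iasg ''tp'' (INum 1)) _"]
    proof (rule wp_mono, elim conjE)
      fix m' :: nat and t'
      assume m': "m' \<le> 3 + 26 * (\<Sum>c\<in>A. cell_cost \<omega> c)" and f': "frame sweep_vars t t'"
        and r': "recorded (D \<union> ?H c0 \<union> (\<Union>c\<in>A. ?H c)) t'"
      let ?t = "rset ''Y'' 0 (min (z i) 1) (rset ''X'' 0 V (iset ''tp'' 0 1 t'))"
      have f1: "frame coordinate_vars s t'" by (rule frame_trans[OF f(1) f']) auto
      have p': "at_params k (z i) V t'" by (rule at_params_frame[OF p f']) auto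
      then have v: "rmem t' ''u'' 0 = z i" "rmem t' ''V'' 0 = V" by (auto simp: at_params_def)
      have l': "imem t' ''l'' 0 = l" "imem t' ''i'' 0 = i" using frameD(1)[OF f', of "''l''"] frameD(1)[OF f', of "''i''"] f(2) t by simp_all
      have "wp \<omega> (Seq sweep_prog (iasg ''l'' (IPlus (iv ''l'') (INum 1))))
        (\<lambda>n t'. ?Q (m + (m' + (1 + (1 + (2 + n))))) t') ?t"
        by (rule wp_mono[OF step3[of ?t "m + (m' + 4)"]])
          (use m m' f1 l' p' v in \<open>auto simp: at_params_def recorded_update[OF r']\<close>)
      then show "wp \<omega> ?rest
         (\<lambda>n t'. ?Q (m + (m' + n)) t') t'"
        by (simp only: wp_Seq_iasg wp_Seq_rasg wp_Seq[of _ "Cond _ _ _"], cases "z i < 1") (simp_all add: v not_less del: wp_Seq)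
    qed
  qed
  have "wp \<omega> cell_prog (\<lambda>m' t'. wp \<omega> (Seq (iasg ''tp'' (INum 0)) (Seq (rasg ''X'' (rv ''u'')) (Seq (rasg ''Y'' (rv ''V''))
      (Seq sweep_prog ?rest))))
      (\<lambda>n t'. ?Q (Suc (Suc (Suc (Suc (Suc (Suc (Suc (m' + n)))))))) t') t') s1"
  proof (rule wp_mono[OF wp_cell_prog[OF c1 p1 r1 U]], elim conjE)
    fix m' :: nat and t'
    assume m': "m' \<le> 18 * (1 + num_darts \<omega> c0)" and f': "frame cell_vars s1 t'"
      and r': "recorded (D \<union> hits k \<omega> (z i) V c0 (num_darts \<omega> c0)) t'"
    let ?t = "rset ''Y'' 0 V (rset ''X'' 0 (z i) (iset ''tp'' 0 0 t'))"
    have f2: "frame coordinate_vars s t'" by (rule frame_trans[OF f1 f']) auto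
    have p': "at_params k (z i) V t'" by (rule at_params_frame[OF p1 f']) auto
    then have v: "rmem t' ''u'' 0 = z i" "rmem t' ''V'' 0 = V" by (auto simp: at_params_def)
    have l': "imem t' ''l'' 0 = l" "imem t' ''i'' 0 = i"
      using frameD(1)[OF f', of "''l''"] frameD(1)[OF f', of "''i''"] by (simp_all add: s1_def l_def)
    have "wp \<omega> (Seq sweep_prog ?rest)
      (\<lambda>n t'. ?Q (Suc (Suc (Suc (Suc (Suc (Suc (Suc (m' + (1 + (1 + (1 + n))))))))))) t') ?t"
      by (rule wp_mono[OF step2[of ?t "10 + m'"]])
        (use m' f2 l' p' v in \<open>auto simp: at_params_def recorded_update[OF r'] cell_cost_def cell_hits_def\<close>)
    then show "wp \<omega> (Seq (iasg ''tp'' (INum 0)) (Seq (rasg ''X'' (rv ''u'')) (Seq (rasg ''Y'' (rv ''V''))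
      (Seq sweep_prog ?rest))))
      (\<lambda>n t'. ?Q (Suc (Suc (Suc (Suc (Suc (Suc (Suc (m' + n)))))))) t') t'"
      by (simp only: wp_Seq_iasg wp_Seq_rasg) (simp add: v del: wp_Seq)
  qed
  then show ?thesis
    unfolding coordinate_prog_def cells UN_cells l_def[symmetric]
    by (simp only: wp_Seq_iasg wp_Seq_rasg wp_Seq[of _ cell_prog])
      (simp add: s s1_def l_def del: wp_Seq)
qed

definition found :: "nat \<Rightarrow> hashfun \<Rightarrow> (nat \<Rightarrow> real) \<Rightarrow> real \<Rightarrow> (nat \<times> real) set" where
  "found k \<omega> z V = (\<Union>c\<in>visit z V. cell_hits k \<omega> (z (fst c)) V c)"

definition visit_cost :: "hashfun \<Rightarrow> (nat \<Rightarrow> real) \<Rightarrow> real \<Rightarrow> nat" where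
  "visit_cost \<omega> z V = (\<Sum>c\<in>visit z V. cell_cost \<omega> c)"

lemma found_mono: "V \<le> V' \<Longrightarrow> found k \<omega> z V \<subseteq> found k \<omega> z V'"
  unfolding found_def cell_hits_def hits_def visit_def by (fastforce intro: less_le_trans)

lemma found_bins:
  assumes "unit_valued \<omega>" "1 \<le> k"
  shows "fst ` found k \<omega> z V \<subseteq> {..<k}"
proof -
  have "dart_bin k \<omega> c n < k" for c n
  proof -
    have "real k * \<omega> (key c (Suc n) 2) < real k * 1"
      using assms by (intro mult_strict_left_mono) auto
    then have "\<lfloor>real k * \<omega> (key c (Suc n) 2)\<rfloor> < int k" by (simp add: floor_less_iff)
    then show ?thesis using assms by (simp add: dart_bin_def nat_less_iff)
  qed
  then show ?thesis by (auto simp: found_def cell_hits_def hits_def)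
qed

lemma wp_round_prog:
  assumes len: "imem s ''len'' 0 = length is" and idx: "\<And>l. l < length is \<Longrightarrow> imem s ''index'' l = is ! l"
    and wt: "\<And>l. l < length is \<Longrightarrow> rmem s ''K'' 0 * rmem s ''weight'' l = z (is ! l)"
    and s: "imem s ''k'' 0 = k" "rmem s ''V'' 0 = V" "recorded D s"
    and U: "unit_valued \<omega>" and pos: "0 < V" "\<And>l. l < length is \<Longrightarrow> 0 < z (is ! l)"
    and lst: "distinct is" "\<And>i. i \<notin> set is \<Longrightarrow> z i \<le> 0"
  shows "wp \<omega> round_prog
    (\<lambda>m t. m \<le> 3 + 61 * visit_cost \<omega> z V \<and> frame (coordinate_vars \<union> {''V''}) s t \<and>
       rmem t ''V'' 0 = 2 * V \<and> recorded (D \<union> found k \<omega> z V) t) s"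
proof -
  define C where "C i = {c \<in> visit z V. fst c = i}" for i
  have fC: "finite (C i)" for i unfolding C_def by (rule finite_visit_coordinate)
  have visit_eq: "visit z V = (\<Union>l<length is. C (is ! l))"
  proof (intro set_eqI iffI)
    fix c assume c: "c \<in> visit z V"
    then have "0 < z (fst c)" using low_nonneg(1)[of c] by (auto simp: visit_def)
    then have "fst c \<in> set is" using lst(2)[of "fst c"] by (meson not_le)
    then obtain l where "l < length is" "is ! l = fst c" by (meson in_set_conv_nth)
    then have "c \<in> C (is ! l)" using c by (simp add: C_def)
    then show "c \<in> (\<Union>l<length is. C (is ! l))" using \<open>l < length is\<close> by blast
  qed (auto simp: C_def)
  have cost: "visit_cost \<omega> z V = (\<Sum>l<length is. \<Sum>c\<in>C (is ! l). cell_cost \<omega> c)"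
    unfolding visit_cost_def visit_eq
    using lst(1) fC by (intro sum.UNION_disjoint) (auto simp: C_def nth_eq_iff_index_eq)
  have found_eq: "found k \<omega> z V = (\<Union>l<length is. \<Union>c\<in>C (is ! l). cell_hits k \<omega> (z (fst c)) V c)"
    unfolding found_def visit_eq by blast
  let ?F = "\<lambda>l. \<Union>l<l. \<Union>c\<in>C (is ! l). cell_hits k \<omega> (z (fst c)) V c"
  let ?R = "\<lambda>l. \<Union>c\<in>{c \<in> visit z V. fst c = is ! l}. cell_hits k \<omega> (z (fst c)) V c"
  let ?S = "\<lambda>l. \<Sum>c\<in>C (is ! l). cell_cost \<omega> c"
  define I where "I l t \<longleftrightarrow> frame coordinate_vars s t \<and> imem t ''l'' 0 = l \<and>
     recorded (D \<union> ?F l) t" for l t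
  have loop: "wp \<omega> (While (ILess (iv ''l'') (iv ''len'')) coordinate_prog)
    (\<lambda>m t. m \<le> 1 + (\<Sum>l<length is. 1 + 60 * ?S l) \<and> I (length is) t) t" if "I 0 t" for t
  proof (rule wp_for[where I = I])
    fix l t assume I: "I l t"
    then have "frame coordinate_vars s t" by (simp add: I_def)
    from frameD(1)[OF this, of "''len''"] I show "bval t (ILess (iv ''l'') (iv ''len'')) \<longleftrightarrow> l < length is"
      using len by (simp add: I_def)
  next
    fix l t assume l: "l < length is" and I: "I l t"
    then have f: "frame coordinate_vars s t" and l': "imem t ''l'' 0 = l"
      and rec: "recorded (D \<union> ?F l) t" by (auto simp: I_def)
    have t: "imem t ''index'' (imem t ''l'' 0) = is ! l" "rmem t ''K'' 0 * rmem t ''weight'' (imem t ''l'' 0) = z (is ! l)"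
       "imem t ''k'' 0 = k" "rmem t ''V'' 0 = V"
      using frameD(1)[OF f, of "''index''" l] frameD(2)[OF f, of "''K''" 0] frameD(2)[OF f, of "''weight''" l]
        frameD(1)[OF f, of "''k''" 0] frameD(2)[OF f, of "''V''" 0] idx[OF l] wt[OF l] s l' by simp_all
    from wp_coordinate_prog[where z = z, OF t rec U pos(2)[OF l] pos(1)]
    show "wp \<omega> coordinate_prog (\<lambda>m t. m \<le> 60 * ?S l \<and> I (Suc l) t) t"
    proof (rule wp_mono, elim conjE)
      fix m :: nat and t'
      assume m: "m \<le> 60 * sum (cell_cost \<omega>) {c \<in> visit z V. fst c = is ! l}" and f': "frame coordinate_vars t t'"
        and l2: "imem t' ''l'' 0 = Suc (imem t ''l'' 0)"
        and r: "recorded (D \<union> ?F l \<union> ?R l) t'"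
      have eq: "D \<union> ?F l \<union> ?R l
        = D \<union> ?F (Suc l)"
        unfolding C_def[symmetric] lessThan_Suc by blast
      have "frame coordinate_vars s t'" by (rule frame_trans[OF f f']) auto
      then show "m \<le> 60 * ?S l \<and> I (Suc l) t'"
        using m l2 l' r[unfolded eq] by (simp add: I_def C_def)
    qed
  next
    show "I 0 t" by (rule that)
  qed
  \<comment> \<open>The loop test of each coordinate is charged to its unit square.\<close>
  have "(\<Sum>l<length is. 1 + 60 * ?S l) \<le> (\<Sum>l<length is. 61 * ?S l)"
  proof (intro sum_mono)
    fix l assume "l \<in> {..<length is}"
    then have "(is ! l, 2, 0, 0) \<in> C (is ! l)"
      unfolding C_def using pos by (subst visit_coordinate) auto
    then have "cell_cost \<omega> (is ! l, 2, 0, 0) \<le> ?S l"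
      using fC by (intro member_le_sum) auto
    then show "1 + 60 * ?S l \<le> 61 * ?S l"
      by (simp add: cell_cost_def)
  qed
  also have "\<dots> = 61 * visit_cost \<omega> z V"
    unfolding cost by (rule sum_distrib_left[symmetric])
  finally have bound: "(\<Sum>l<length is. 1 + 60 * ?S l) \<le> 61 * visit_cost \<omega> z V" .
  have I0: "I 0 (iset ''l'' 0 0 s)"
    by (simp add: I_def recorded_update[OF s(3)])
  have "wp \<omega> (While (ILess (iv ''l'') (iv ''len'')) coordinate_prog)
    (\<lambda>m t. wp \<omega> (rasg ''V'' (RPlus (rv ''V'') (rv ''V''))) (\<lambda>n t. 1 + (m + n) \<le> 3 + 61 * visit_cost \<omega> z V \<and> frame (coordinate_vars \<union> {''V''}) s t \<and>
       rmem t ''V'' 0 = 2 * V \<and> recorded (D \<union> found k \<omega> z V) t) t) (iset ''l'' 0 0 s)"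
  proof (rule wp_mono[OF loop[OF I0]], elim conjE)
    fix m :: nat and t
    assume m: "m \<le> 1 + (\<Sum>l<length is. 1 + 60 * ?S l)" and I: "I (length is) t"
    then have f: "frame coordinate_vars s t" and rec: "recorded (D \<union> found k \<omega> z V) t" by (simp_all add: I_def found_eq)
    have "frame (coordinate_vars \<union> {''V''}) s t" by (rule frame_trans[OF f frame_refl[of "{}"]]) auto
    moreover have "rmem t ''V'' 0 = V" using frameD(2)[OF f, of "''V''"] s(2) by simp
    ultimately show "wp \<omega> (rasg ''V'' (RPlus (rv ''V'') (rv ''V''))) (\<lambda>n t. 1 + (m + n) \<le> 3 + 61 * visit_cost \<omega> z V \<and> frame (coordinate_vars \<union> {''V''}) s t \<and>
       rmem t ''V'' 0 = 2 * V \<and> recorded (D \<union> found k \<omega> z V) t) t"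
      using m bound by (simp add: recorded_update[OF rec])
  qed
  then show ?thesis
    unfolding round_prog_def by simp
qed

text \<open>As for coupon collecting: before time 1 / \<open>norm1 d x\<close> every bin expects ln
  k + 1 darts, so by the union bound some bin stays empty with probability at most k exp(-(ln k +
  1)) = exp(-1).\<close>

definition scaling :: "nat \<Rightarrow> real" where
  "scaling k = real k * (ln (real k) + 1)"

lemma scaling_pos: "1 \<le> k \<Longrightarrow> 0 < scaling k"
  unfolding scaling_def by (intro mult_pos_pos add_nonneg_pos) auto

lemma input_simps:
  "imem (input k is x) ''k'' 0 = k" "imem (input k is x) ''len'' 0 = length is"
  "l < length is \<Longrightarrow> imem (input k is x) ''index'' l = is ! l"
  "l < length is \<Longrightarrow> rmem (input k is x) ''weight'' l = x (is ! l)"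
  "imem (input k is x) ''l'' i = 0" "rmem (input k is x) ''s'' i = 0"
  "imem (input k is x) ''cnt'' i = 0" "imem (input k is x) ''found'' i = 0"
  by (simp_all add: input_def)

text \<open>\<open>R\<close> is the first round that fills all bins. The rounds 0 to
  \<open>R\<close> are run, and what is recorded at the end is what the last of them finds.\<close>

lemma wp_minhash_prog:
  assumes k: "1 \<le> k" and x: "x \<in> weighted_sets d" and en: "enumerates is (supp d x)"
    and U: "unit_valued \<omega>"
    and R: "\<And>r. r < R \<Longrightarrow> card (fst ` found k \<omega> (scaled (scaling k) x) (2 ^ r / norm1 d x)) < k"
      "card (fst ` found k \<omega> (scaled (scaling k) x) (2 ^ R / norm1 d x)) = k"
  shows "wp \<omega> minhash_prog (\<lambda>m t. m \<le> 4 + 3 * length is + (\<Sum>r\<le>R. 4 + 61 * visit_cost \<omega> (scaled (scaling k) x) (2 ^ r / norm1 d x)) \<and>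
      recorded (found k \<omega> (scaled (scaling k) x) (2 ^ R / norm1 d x)) t) (input k is x)"
proof -
  define s0 where "s0 = input k is x"
  define z where "z = scaled (scaling k) x"
  define T where "T r = 2 ^ r / norm1 d x" for r
  define F where "F r = found k \<omega> z (T r)" for r
  have dis: "distinct is" and set: "set is = supp d x" using en by (auto simp: enumerates_def)
  have n1: "0 < norm1 d x" using x by (rule norm1_pos)
  have xpos: "0 < x (is ! l)" if "l < length is" for l
  proof -
    have "is ! l \<in> supp d x" using that set nth_mem by blast
    then show ?thesis using x by (auto simp: supp_def weighted_sets_def less_le)
  qed
  have norm: "(\<Sum>l<length is. x (is ! l)) = norm1 d x"
  proof -
    have "(\<Sum>l<length is. x (is ! l)) = (\<Sum>i\<in>supp d x. x i)"
      by (rule sum.reindex_bij_betw) (use bij_betw_nth[OF dis, of "{..<length is}" "set is"] set in simp)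
    also have "\<dots> = norm1 d x" unfolding norm1_def by (intro sum.mono_neutral_left) (auto simp: supp_def)
    finally show ?thesis .
  qed
  have s0: "imem s0 ''k'' 0 = k" "imem s0 ''len'' 0 = length is" "imem s0 ''l'' 0 = 0" "rmem s0 ''s'' 0 = 0"
    "\<And>l. l < length is \<Longrightarrow> imem s0 ''index'' l = is ! l" "\<And>l. l < length is \<Longrightarrow> rmem s0 ''weight'' l = x (is ! l)"
    unfolding s0_def by (simp_all add: input_simps)
  have rec0: "recorded {} s0"
    unfolding s0_def recorded_def by (simp add: input_simps)
  define I where "I l t \<longleftrightarrow> frame {''l'', ''s''} s0 t \<and> imem t ''l'' 0 = l \<and> rmem t ''s'' 0 = (\<Sum>l<l. x (is ! l)) \<and> recorded {} t" for l t
  have loop1: "wp \<omega> (While (ILess (iv ''l'') (iv ''len''))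
          (Seq (rasg ''s'' (RPlus (rv ''s'') (RCell ''weight'' (iv ''l''))))
               (iasg ''l'' (IPlus (iv ''l'') (INum 1)))))
      (\<lambda>m t. m \<le> 1 + (\<Sum>l<length is. 1 + 2) \<and> I (length is) t) s0"
  proof (rule wp_for[where I = I])
    fix l t assume I: "I l t"
    then have f: "frame {''l'', ''s''} s0 t" by (simp add: I_def)
    from frameD(1)[OF this, of "''len''" 0] I show "bval t (ILess (iv ''l'') (iv ''len'')) \<longleftrightarrow> l < length is"
      by (simp add: I_def s0)
  next
    fix l t assume l: "l < length is" and I: "I l t"
    then have f: "frame {''l'', ''s''} s0 t" "recorded {} t" by (simp_all add: I_def)
    from frameD(2)[OF f(1), of "''weight''" l] I l show "wp \<omega> (Seq (rasg ''s'' (RPlus (rv ''s'') (RCell ''weight'' (iv ''l''))))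
               (iasg ''l'' (IPlus (iv ''l'') (INum 1)))) (\<lambda>m t. m \<le> 2 \<and> I (Suc l) t) t"
      by (simp add: I_def s0 recorded_update[OF f(2)])
  next
    show "I 0 s0" using rec0 s0 by (simp add: I_def)
  qed
  let ?W = "coordinate_vars \<union> {''V'', ''K'', ''s''}"
  \<comment> \<open>Before round r the memory reflects round r - 1, and nothing for r = 0. Earlier
    rounds leave no further trace, because \<open>found\<close> grows with the horizon.\<close>
  define J where "J r t \<longleftrightarrow> frame ?W s0 t \<and> rmem t ''K'' 0 = scaling k \<and> rmem t ''V'' 0 = T r \<and> recorded (if r = 0 then {} else F (r - 1)) t" for r t
  have loop2: "wp \<omega> (While (ILess (iv ''cnt'') (iv ''k'')) round_prog)
      (\<lambda>m t. m \<le> 1 + (\<Sum>r<Suc R. 1 + (3 + 61 * visit_cost \<omega> z (T r))) \<and> J (Suc R) t) t" if "J 0 t" for t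
  proof (rule wp_for[where I = J])
    fix r t assume r: "r \<le> Suc R" and J: "J r t"
    then have f: "frame ?W s0 t" and rec: "recorded (if r = 0 then {} else F (r - 1)) t" by (simp_all add: J_def)
    have kk: "imem t ''k'' 0 = k" using frameD(1)[OF f, of "''k''" 0] by (simp add: s0)
    show "bval t (ILess (iv ''cnt'') (iv ''k'')) \<longleftrightarrow> r < Suc R"
    proof (cases r)
      case 0
      then show ?thesis using rec kk k by (simp add: recorded_def)
    next
      case (Suc r')
      then have "imem t ''cnt'' 0 = card (fst ` F r')" using rec by (simp add: recorded_def)
      then show ?thesis using kk R(1)[of r'] R(2) r Suc unfolding F_def z_def T_def
        by (cases "r' = R") auto
    qed
  next
    fix r t assume r: "r < Suc R" and J: "J r t"
    then have f: "frame ?W s0 t" and KV: "rmem t ''K'' 0 = scaling k" "rmem t ''V'' 0 = T r"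
      and rec: "recorded (if r = 0 then {} else F (r - 1)) t" by (simp_all add: J_def)
    have sub: "(if r = 0 then {} else F (r - 1)) \<subseteq> F r"
    proof (cases "r = 0")
      case False
      have "T (r - 1) \<le> T r"
        unfolding T_def using n1 by (intro divide_right_mono power_increasing) auto
      then have "F (r - 1) \<subseteq> F r" unfolding F_def by (rule found_mono)
      then show ?thesis using False by simp
    qed simp
    have un: "(if r = 0 then {} else F (r - 1)) \<union> found k \<omega> z (T r) = F r"
      using sub unfolding F_def[of r] by (rule Un_absorb1)
    have "wp \<omega> round_prog (\<lambda>m t'. m \<le> 3 + 61 * visit_cost \<omega> z (T r) \<and> frame (coordinate_vars \<union> {''V''}) t t' \<and>
       rmem t' ''V'' 0 = 2 * T r \<and> recorded ((if r = 0 then {} else F (r - 1)) \<union> found k \<omega> z (T r)) t') t"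
    proof (rule wp_round_prog)
      show "imem t ''len'' 0 = length is" using frameD(1)[OF f, of "''len''" 0] by (simp add: s0)
      show "imem t ''k'' 0 = k" using frameD(1)[OF f, of "''k''" 0] by (simp add: s0)
      fix l assume l: "l < length is"
      then show "imem t ''index'' l = is ! l" using frameD(1)[OF f, of "''index''" l] by (simp add: s0)
      show "rmem t ''K'' 0 * rmem t ''weight'' l = z (is ! l)"
        using l frameD(2)[OF f, of "''weight''" l] KV by (simp add: s0 z_def)
      show "0 < z (is ! l)" using xpos[OF l] scaling_pos[OF k] by (simp add: z_def)
    next
      show "z i \<le> 0" if "i \<notin> set is" for i
        using that x unfolding set by (cases "i < d") (auto simp: supp_def z_def weighted_sets_def)
    qed (use KV rec U n1 dis in \<open>auto simp: T_def\<close>)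
    then show "wp \<omega> round_prog (\<lambda>m t'. m \<le> 3 + 61 * visit_cost \<omega> z (T r) \<and> J (Suc r) t') t"
    proof (rule wp_mono, elim conjE)
      fix m :: nat and t'
      assume m: "m \<le> 3 + 61 * visit_cost \<omega> z (T r)" and f': "frame (coordinate_vars \<union> {''V''}) t t'"
        and V': "rmem t' ''V'' 0 = 2 * T r" and r': "recorded ((if r = 0 then {} else F (r - 1)) \<union> found k \<omega> z (T r)) t'"
      have "frame ?W s0 t'" by (rule frame_trans[OF f f']) auto
      then show "m \<le> 3 + 61 * visit_cost \<omega> z (T r) \<and> J (Suc r) t'"
        using m V' r'[unfolded un] KV(1) frameD(2)[OF f', of "''K''" 0] by (simp add: J_def T_def)
    qed
  next
    show "J 0 t" by (rule that)
  qed
  show ?thesis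
    unfolding minhash_prog_def z_def[symmetric] T_def[symmetric] F_def[symmetric] s0_def[symmetric] wp_Seq
  proof (rule wp_mono[OF loop1], elim conjE)
    fix m :: nat and t
    assume m: "m \<le> 1 + (\<Sum>l<length is. 1 + 2)" and I: "I (length is) t"
    then have f: "frame {''l'', ''s''} s0 t" and t: "rmem t ''s'' 0 = norm1 d x" "recorded {} t" using norm by (simp_all add: I_def)
    have kk: "imem t ''k'' 0 = k" using frameD(1)[OF f, of "''k''" 0] by (simp add: s0)
    have f': "frame ?W s0 t" by (rule frame_trans[OF f frame_refl[of "{}"]]) auto
    let ?t = "rset ''V'' 0 (1 / norm1 d x) (rset ''K'' 0 (real k * (ln (real k) + 1)) t)"
    have J0: "J 0 ?t"
      using f' by (simp add: J_def scaling_def T_def recorded_update[OF t(2)])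
    have "wp \<omega> (While (ILess (iv ''cnt'') (iv ''k'')) round_prog)
      (\<lambda>n t. m + (1 + (1 + n)) \<le> 4 + 3 * length is + (\<Sum>r\<le>R. 4 + 61 * visit_cost \<omega> z (T r)) \<and> recorded (F R) t) ?t"
      by (rule wp_mono[OF loop2[OF J0]]) (use m in \<open>auto simp: J_def lessThan_Suc_atMost\<close>)
    then show "wp \<omega> (rasg ''K'' (RTimes (RNat (iv ''k'')) (RPlus (RLn (RNat (iv ''k''))) (rnum 1))))
       (\<lambda>ma. wp \<omega> (rasg ''V'' (RDivide (rnum 1) (rv ''s'')))
         (\<lambda>mb. wp \<omega> (While (ILess (iv ''cnt'') (iv ''k'')) round_prog)
           (\<lambda>n t. m + (ma + (mb + n)) \<le> 4 + 3 * length is + (\<Sum>r\<le>R. 4 + 61 * visit_cost \<omega> z (T r)) \<and> recorded (F R) t))) t"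
      by (simp add: kk t)
  qed
qed

section \<open>Expected running time\<close>

text \<open>Row e has Y 2^e cells, rounded up. The main terms form a geometric series dominated by
  the last row, whose 2^e is below X; the roundings add one per row, and there are at most 1 + 2 ln
  X rows if there are any.\<close>

lemma card_sweep_cells:
  assumes X: "0 \<le> X" and Y: "0 < Y"
  shows "finite (sweep_cells i tp X Y)"
    "real (card (sweep_cells i tp X Y)) \<le> 2 * X * Y + (1 + 2 * ln (max 1 X))"
proof -
  obtain E where E: "\<And>e. (2::real) ^ e < X \<longleftrightarrow> e < E" using power2_segment by metis
  define N where "N e = nat \<lceil>Y * 2 ^ e\<rceil>" for e :: nat
  have N: "real q / 2 ^ e < Y \<longleftrightarrow> q < N e" for e q
  proof -
    have "real q / 2 ^ e < Y \<longleftrightarrow> real q < Y * 2 ^ e" by (simp add: pos_divide_less_eq)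
    also have "\<dots> \<longleftrightarrow> q < N e" unfolding N_def by linarith
    finally show ?thesis .
  qed
  have cells: "sweep_cells i tp X Y = (\<lambda>(e, q). (i, tp, e, q)) ` (SIGMA e:{..<E}. {..<N e})"
    by (auto simp: sweep_cells_def E N)
  show "finite (sweep_cells i tp X Y)" unfolding cells by auto
  have "card (sweep_cells i tp X Y) = card (SIGMA e:{..<E}. {..<N e})"
    unfolding cells by (rule card_image) (auto simp: inj_on_def)
  also have "\<dots> = (\<Sum>e<E. N e)" by simp
  finally have "real (card (sweep_cells i tp X Y)) = (\<Sum>e<E. real (N e))" by simp
  also have "\<dots> \<le> (\<Sum>e<E. Y * 2 ^ e + 1)"
  proof (rule sum_mono)
    fix e :: nat
    have "0 \<le> Y * 2 ^ e" using Y by simp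
    then show "real (N e) \<le> Y * 2 ^ e + 1" unfolding N_def by linarith
  qed
  also have "\<dots> = Y * (2 ^ E - 1) + E"
    by (simp add: sum.distrib sum_distrib_left[symmetric] sum_gp_strict)
  also have "\<dots> \<le> 2 * X * Y + (1 + 2 * ln (max 1 X))"
  proof (cases E)
    case 0
    then show ?thesis using X Y by simp
  next
    case (Suc e)
    then have lt: "2 ^ e < X" using E by simp
    have "Y * (2 ^ E - 1) \<le> Y * (2 * X)"
      using lt Y Suc by (intro mult_left_mono) auto
    moreover have "real e \<le> 2 * ln (max 1 X)"
    proof -
      have X1: "1 < X" using lt one_le_power[of "2::real" e] by linarith
      have "real e * ln 2 = ln (2 ^ e)" by (simp add: ln_realpow)
      also have "\<dots> \<le> ln X" using lt by (intro ln_mono) auto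
      finally have "real e * ln 2 \<le> ln X" .
      moreover have "real e * (1 / 2) \<le> real e * ln 2"
        using ln2_ge_two_thirds by (intro mult_left_mono) auto
      ultimately show ?thesis using X1 by simp
    qed
    ultimately show ?thesis using Suc by (simp add: mult_ac)
  qed
  finally show "real (card (sweep_cells i tp X Y)) \<le> 2 * X * Y + (1 + 2 * ln (max 1 X))" .
qed

lemma ln_max_mult:
  assumes "0 < a" "0 < b"
  shows "ln (max 1 (a * b)) \<le> ln (max 1 a) + ln (max (1::real) b)"
proof -
  have "max 1 (a * b) \<le> max 1 a * max 1 b"
  proof (rule max.boundedI)
    have "1 * 1 \<le> max 1 a * max 1 b" by (rule mult_mono) auto
    then show "1 \<le> max 1 a * max 1 b" by simp
    show "a * b \<le> max 1 a * max 1 b" using assms by (intro mult_mono) auto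
  qed
  then have "ln (max 1 (a * b)) \<le> ln (max 1 a * max 1 b)" by (intro ln_mono) auto
  also have "\<dots> = ln (max 1 a) + ln (max 1 b)" by (rule ln_mult_pos) auto
  finally show ?thesis .
qed

lemma ln_max_le: "0 \<le> a \<Longrightarrow> ln (max 1 a) \<le> (a::real)"
  using ln_le_minus_one[of "max 1 a"] by (auto simp: max_def split: if_splits)

context
  fixes d :: nat and x :: "nat \<Rightarrow> real"
  assumes x: "x \<in> weighted_sets d"
begin

abbreviation (input) "weight_log \<equiv> ln (norm1 d x + 1 / norm1 d x)"

lemma norm1_sum_supp: "norm1 d x = (\<Sum>i\<in>supp d x. x i)"
  unfolding norm1_def by (intro sum.mono_neutral_right) (auto simp: supp_def)

lemma finite_supp: "finite (supp d x)"
  by (simp add: supp_def)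

lemma norm0_ge_1: "1 \<le> norm0 d x"
proof -
  have "supp d x \<noteq> {}" using norm1_pos[OF x] norm1_sum_supp by auto
  then show ?thesis unfolding norm0_def using finite_supp by (simp add: Suc_leI card_gt_0_iff)
qed

text \<open>s + 1 / s is at least 2, so the logarithm is bounded away from 0 and can pay for the
  constant cost of a coordinate.\<close>

lemma weight_log_bounds: "1 / 2 \<le> weight_log" "ln (max 1 (norm1 d x)) \<le> weight_log" "ln (max 1 (1 / norm1 d x)) \<le> weight_log"
proof -
  define s where "s = norm1 d x"
  have s: "0 < s" using norm1_pos[OF x] by (simp add: s_def)
  have "0 \<le> (s - 1)\<^sup>2" by simp
  then have "2 * s \<le> s * s + 1" by (simp add: power2_eq_square algebra_simps)
  then have two: "2 \<le> s + 1 / s" using s by (simp add: field_simps)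
  have "1 / 2 \<le> ln (2::real)" using ln2_ge_two_thirds by simp
  also have "\<dots> \<le> ln (s + 1 / s)" using two by (intro ln_mono) auto
  finally show "1 / 2 \<le> weight_log" by (simp add: s_def)
  have "max 1 s \<le> s + 1 / s" "max 1 (1 / s) \<le> s + 1 / s" using two s by (auto simp: max_def)
  then show "ln (max 1 (norm1 d x)) \<le> weight_log" "ln (max 1 (1 / norm1 d x)) \<le> weight_log"
    unfolding s_def by (auto intro!: ln_mono)
qed

text \<open>The areas of all coordinates add up to 2^r K, and every coordinate adds a constant and
  two logarithms, one for its scaled weight and one for the horizon. The horizon contributes r to
  its logarithm, which 2^r absorbs.\<close>

lemma card_visit:
  assumes K: "0 < K"
  shows "real (card (visit (scaled K x) (2 ^ r / norm1 d x))) \<le> 2 ^ r * (14 * (K + norm0 d x * weight_log))"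
proof -
  define s where "s = norm1 d x"
  define V where "V = 2 ^ r / s"
  define n where "n = real (norm0 d x)"
  have s: "0 < s" using norm1_pos[OF x] by (simp add: s_def)
  then have V: "0 < V" by (simp add: V_def)
  have xpos: "0 < x i" if "i \<in> supp d x" for i
    using that x by (auto simp: supp_def weighted_sets_def less_le)
  have lnV: "ln (max 1 V) \<le> r + weight_log"
  proof -
    have "ln (max 1 V) \<le> ln (max 1 (2 ^ r)) + ln (max 1 (1 / s))"
      using ln_max_mult[of "2 ^ r" "1 / s"] s by (simp add: V_def)
    also have "ln (max 1 (2 ^ r)) = real r * ln 2" by (simp add: ln_realpow max_absorb2)
    also have "\<dots> \<le> real r" using ln_le_minus_one[of "2::real"] by (intro mult_left_le) auto
    finally show ?thesis using weight_log_bounds(3) by (simp add: s_def)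
  qed
  have "visit (scaled K x) V = (\<Union>i\<in>supp d x. {c \<in> visit (scaled K x) V. fst c = i})"
  proof (intro set_eqI iffI)
    fix c assume c: "c \<in> visit (scaled K x) V"
    then have "0 < K * x (fst c)" using low_nonneg(1)[of c] by (auto simp: visit_def)
    then have "x (fst c) \<noteq> 0" by auto
    moreover have "fst c < d" using x \<open>x (fst c) \<noteq> 0\<close> by (auto simp: weighted_sets_def not_le[symmetric])
    ultimately show "c \<in> (\<Union>i\<in>supp d x. {c \<in> visit (scaled K x) V. fst c = i})" using c by (auto simp: supp_def)
  qed auto
  then have "card (visit (scaled K x) V) \<le> (\<Sum>i\<in>supp d x. card {c \<in> visit (scaled K x) V. fst c = i})"
    using card_UN_le[OF finite_supp, of "\<lambda>i. {c \<in> visit (scaled K x) V. fst c = i}"] by simp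
  then have "real (card (visit (scaled K x) V)) \<le> (\<Sum>i\<in>supp d x. real (card {c \<in> visit (scaled K x) V. fst c = i}))"
    unfolding of_nat_sum[symmetric] of_nat_le_iff .
  also have "\<dots> \<le> (\<Sum>i\<in>supp d x. (3 + 4 * weight_log + 2 * r) + (4 * V * K + 2 * K / s) * x i)"
  proof (rule sum_mono)
    fix i assume i: "i \<in> supp d x"
    have u: "0 < K * x i" using K xpos[OF i] by simp
    have m: "0 < min (K * x i) 1" using u by simp
    let ?A = "sweep_cells i 0 (K * x i) V" and ?B = "sweep_cells i 1 V (min (K * x i) 1)"
    note A = card_sweep_cells[OF less_imp_le[OF u] V, of i 0]
    note B = card_sweep_cells[OF less_imp_le[OF V] m, of i 1]
    have "card {c \<in> visit (scaled K x) V. fst c = i} \<le> Suc (card (?A \<union> ?B))"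
      unfolding visit_coordinate[where z = "scaled K x" and i = i and V = V, OF u V]
      using A(1) B(1) by (subst card_insert_if) auto
    also have "card (?A \<union> ?B) \<le> card ?A + card ?B" by (rule card_Un_le)
    finally have "real (card {c \<in> visit (scaled K x) V. fst c = i}) \<le> 1 + real (card ?A) + real (card ?B)" by simp
    also have "\<dots> \<le> 1 + (2 * (K * x i) * V + (1 + 2 * ln (max 1 (K * x i)))) + (2 * V * min (K * x i) 1 + (1 + 2 * ln (max 1 V)))"
      using A(2) B(2) by linarith
    also have "2 * V * min (K * x i) 1 \<le> 2 * V * (K * x i)" using V by (intro mult_left_mono) auto
    \<comment> \<open>Dividing by s before applying ln a \<le> a is what avoids a term ln K in every
      coordinate: the summands K x_i / s add up to K.\<close>
    also have "ln (max 1 (K * x i)) \<le> K * x i / s + weight_log"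
    proof -
      have "ln (max 1 (K * x i)) \<le> ln (max 1 (K * x i / s)) + ln (max 1 s)"
        using ln_max_mult[of "K * x i / s" s] u s by simp
      also have "ln (max 1 (K * x i / s)) \<le> K * x i / s" using u s by (intro ln_max_le) simp
      also have "ln (max 1 s) \<le> weight_log" using weight_log_bounds(2) by (simp add: s_def)
      finally show ?thesis by simp
    qed
    finally show "real (card {c \<in> visit (scaled K x) V. fst c = i}) \<le> (3 + 4 * weight_log + 2 * r) + (4 * V * K + 2 * K / s) * x i"
      using lnV by (simp add: algebra_simps)
  qed
  also have "\<dots> = n * (3 + 4 * weight_log + 2 * r) + (4 * V * K + 2 * K / s) * s"
    unfolding sum.distrib sum_distrib_left[symmetric] by (simp add: n_def norm0_def s_def norm1_sum_supp distrib_left)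
  also have "(4 * V * K + 2 * K / s) * s = 4 * 2 ^ r * K + 2 * K"
  proof -
    have "V * s = 2 ^ r" using s by (simp add: V_def)
    moreover have "(4 * V * K + 2 * K / s) * s = 4 * (V * s) * K + 2 * K"
      using s by (simp add: algebra_simps)
    ultimately show ?thesis by simp
  qed
  \<comment> \<open>With L for the logarithm and n \<le> 2 n L: 3 n \<le> 6 n L, and 2 n r \<le> 4 n
    L 2^r. Together with 4 n L this makes 14 n L 2^r; the terms with K stay below 6 K 2^r.\<close>
  also have "n * (3 + 4 * weight_log + 2 * r) + (4 * 2 ^ r * K + 2 * K) \<le> 2 ^ r * (14 * (K + n * weight_log))"
  proof -
    have p: "1 \<le> (2::real) ^ r" "real r \<le> 2 ^ r" using of_nat_less_two_power[of r] by (auto simp: less_imp_le)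
    have nL: "n \<le> 2 * (n * weight_log)" using mult_left_mono[OF weight_log_bounds(1), of n] by (simp add: n_def)
    have nL0: "0 \<le> n" "0 \<le> n * weight_log" using weight_log_bounds(1) by (auto simp: n_def)
    have "n * (3 + 4 * weight_log + 2 * r) = 3 * n + 4 * (n * weight_log) + 2 * (n * r)" by (simp add: algebra_simps)
    also have "n * r \<le> n * 2 ^ r" using p nL0 by (intro mult_left_mono) auto
    also have "n * 2 ^ r \<le> 2 * (n * weight_log) * 2 ^ r" using nL by (intro mult_right_mono) auto
    finally have "n * (3 + 4 * weight_log + 2 * r) \<le> 10 * (n * weight_log) + 4 * (n * weight_log * 2 ^ r)"
      using nL by (simp add: algebra_simps)
    moreover have "n * weight_log \<le> n * weight_log * 2 ^ r" using mult_left_mono[OF p(1) nL0(2)] by simp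
    ultimately have "n * (3 + 4 * weight_log + 2 * r) \<le> 14 * (n * weight_log * 2 ^ r)" by linarith
    moreover have "K \<le> 2 ^ r * K" using p K by simp
    moreover have "2 ^ r * (14 * (K + n * weight_log)) = 14 * (2 ^ r * K) + 14 * (n * weight_log * 2 ^ r)"
      by (simp add: algebra_simps)
    ultimately show ?thesis using K by linarith
  qed
  finally show ?thesis by (simp add: V_def s_def n_def)
qed

end

section \<open>Recorded times and hitting times\<close>

lemma bin_missing_iff:
  "j \<notin> fst ` found k \<omega> z V \<longleftrightarrow> (\<forall>c\<in>visit z V. misses k \<omega> c (reach j z V))"
  by (auto simp: found_def cell_hits_def hits_def misses_def reach_def dart_def image_iff)

text \<open>Links the stopping test of the program to hitting times; their finiteness then yields
  termination almost surely.\<close>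

lemma bin_missing_hit_time:
  assumes "unit_valued \<omega>"
  shows "j \<notin> fst ` found k \<omega> (scaled K x) V \<longleftrightarrow> ereal V \<le> hit_time k K j \<omega> x"
proof -
  have sub: "reach j (scaled K x) V \<subseteq> below (scaled K x) V" by (auto simp: reach_def below_def)
  show ?thesis
    unfolding bin_missing_iff hit_time_ge
    using misses_outside_visit[OF assms sub] visit_subset by blast
qed

text \<open>A dart of the bin below the graph either lies in a visited cell and was recorded, or its
  time is at least V and thus later than the recorded one. So the minimum over the visited cells is
  the infimum over all cells.\<close>

lemma minhash_recorded:
  assumes U: "unit_valued \<omega>" and rec: "recorded (found k \<omega> (scaled K x) V) t"
    and j: "j \<in> fst ` found k \<omega> (scaled K x) V"
  shows "rmem t ''out'' j = minhash k K j \<omega> x"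
proof -
  let ?F = "found k \<omega> (scaled K x) V"
  define \<tau> where "\<tau> = rmem t ''out'' j"
  have \<tau>: "(j, \<tau>) \<in> ?F" "\<And>t. (j, t) \<in> ?F \<Longrightarrow> \<tau> \<le> t"
    using rec j by (auto simp: recorded_def \<tau>_def)
  from \<tau>(1) obtain c n where c: "c \<in> all_cells" "n < num_darts \<omega> c" "dart_bin k \<omega> c n = j" "dart_weight \<omega> c n < K * x (fst c)"
      "dart_time \<omega> c n = \<tau>" "\<tau> < V"
    by (auto simp: found_def cell_hits_def hits_def dest: visit_subset[THEN subsetD])
  have "hit_time k K j \<omega> x = ereal \<tau>"
  proof (rule antisym)
    show "hit_time k K j \<omega> x \<le> ereal \<tau>"
      unfolding hit_time_def by (rule INF_lower2[of "(c, n)"]) (use c in auto)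
    show "ereal \<tau> \<le> hit_time k K j \<omega> x"
      unfolding hit_time_def
    proof (rule INF_greatest, clarify)
      fix i tp e q n' :: nat
      let ?c = "(i, tp, e, q)"
      assume c': "?c \<in> all_cells" "n' < num_darts \<omega> ?c" "dart_weight \<omega> ?c n' < K * x (fst ?c)" "j = dart_bin k \<omega> ?c n'"
      show "ereal \<tau> \<le> ereal (dart_time \<omega> ?c n')"
      proof (cases "dart_time \<omega> ?c n' < V")
        case True
        then have "?c \<in> visit (scaled K x) V"
          using c' low_le_dart[OF U, of ?c n'] by (auto simp: visit_def)
        then have "(j, dart_time \<omega> ?c n') \<in> ?F"
          unfolding found_def cell_hits_def hits_def using c' True by blast
        then show ?thesis using \<tau>(2) by simp
      next
        case False
        then show ?thesis using c(6) by simp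
      qed
    qed
  qed
  then show ?thesis by (simp add: minhash_def \<tau>_def)
qed

lemma run_time_le:
  assumes "wp \<omega> c Q s" "\<And>n t. Q n t \<Longrightarrow> n \<le> B"
  shows "run_time \<omega> c s \<le> of_nat B"
proof -
  obtain n t where n: "exec \<omega> c s n t" "n \<le> B" using assms by (auto simp: wp_def)
  have "run_time \<omega> c s \<le> of_nat n" unfolding run_time_def by (rule INF_lower) (use n in auto)
  also have "\<dots> \<le> of_nat B" using n by (simp add: of_nat_mono)
  finally show ?thesis .
qed

text \<open>For k \<ge> 2 the extra summand k is at most 2 k ln k. For k = 1, where k ln k vanishes,
  it is paid for by \<open>a\<close>.\<close>

lemma scaling_le:
  assumes "1 \<le> k" "1 / 2 \<le> a"
  shows "scaling k + a \<le> 4 * (real k * ln (real k) + a)"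
proof -
  have "real k \<le> 2 * (real k * ln (real k)) + 2 * a"
  proof (cases "k = 1")
    case False
    then have "ln 2 \<le> ln (real k)" using assms by (intro ln_mono) auto
    then have "1 / 2 \<le> ln (real k)" using ln2_ge_two_thirds by linarith
    then have "real k * (1 / 2) \<le> real k * ln (real k)" by (intro mult_left_mono) auto
    then show ?thesis using assms(2) by linarith
  qed (use assms in simp)
  moreover have "0 \<le> real k * ln (real k)" using assms by simp
  ultimately show ?thesis using assms by (simp add: scaling_def distrib_left)
qed

section \<open>The expected cost of the rounds\<close>

context
  fixes k d :: nat and x :: "nat \<Rightarrow> real"
  assumes k: "1 \<le> k" and x: "x \<in> weighted_sets d"
begin

abbreviation (input) "scaled_x \<equiv> scaled (scaling k) x"
abbreviation (input) "horizon r \<equiv> 2 ^ r / norm1 d x"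
abbreviation (input) "round_cost r \<omega> \<equiv> ennreal (visit_cost \<omega> scaled_x (horizon r))"
abbreviation (input) "bins r \<omega> \<equiv> fst ` found k \<omega> scaled_x (horizon r)"

text \<open>
  The void event is stated for the cells of the next round, so that \<open>misses_cost\<close> applies to them.
\<close>

definition late :: "nat \<Rightarrow> nat \<Rightarrow> hashfun set" where
  "late r j = {\<omega>. \<forall>c\<in>visit scaled_x (horizon (Suc r)). misses k \<omega> c (reach j scaled_x (horizon r))}"

lemma horizon_pos: "0 < horizon r"
  using norm1_pos[OF x] by simp

lemma horizon_mono: "r \<le> r' \<Longrightarrow> horizon r \<le> horizon r'"
  using norm1_pos[OF x] by (intro divide_right_mono power_increasing) auto

lemma xs_nonneg: "0 \<le> scaled_x i"
  using x scaling_pos[OF k] by (auto simp: weighted_sets_def)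

lemma xs_zero: "d \<le> i \<Longrightarrow> scaled_x i \<le> 0"
  using x by (auto simp: weighted_sets_def)

lemma finite_visit_xs: "finite (visit scaled_x V)"
  by (rule finite_visit) (rule xs_zero)

lemma late_sets: "late r j \<in> sets hash_space"
  unfolding late_def by (intro misses_all_meas reach_sets countable_finite finite_visit_xs)

lemma emeasure_late:
  assumes "j < k"
  shows "emeasure hash_space (late r j) = ennreal (exp (- ((ln k + 1) * 2 ^ r)))"
proof -
  have "emeasure hash_space (late r j) = ennreal (exp (- (\<Sum>c\<in>visit scaled_x (horizon (Suc r)). hit_prob k c (reach j scaled_x (horizon r)))))"
    unfolding late_def by (rule emeasure_misses[OF finite_visit_xs reach_sets])
  also have "(\<Sum>c\<in>visit scaled_x (horizon (Suc r)). hit_prob k c (reach j scaled_x (horizon r))) = (\<Sum>i<d. scaled_x i) * horizon r / k"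
  proof (rule sum_hit_prob_reach[OF assms xs_zero])
    show "horizon r \<le> horizon (Suc r)" by (rule horizon_mono) simp
  qed (use xs_nonneg horizon_pos[of r] in auto)
  also have "(\<Sum>i<d. scaled_x i) = scaling k * norm1 d x"
    by (simp add: norm1_def sum_distrib_left)
  also have "scaling k * norm1 d x * horizon r / k = (ln k + 1) * 2 ^ r"
    using norm1_pos[OF x] k by (simp add: scaling_def)
  finally show ?thesis .
qed

text \<open>The union bound over the bins: ln k in the exponent is multiplied by 2^r \<ge> 1 and
  cancels the factor k.\<close>

lemma late_tail: "real k * exp (- ((ln (real k) + 1) * 2 ^ r)) \<le> exp (- (2 ^ r))"
proof -
  have "real k * exp (- ((ln (real k) + 1) * 2 ^ r)) = exp (ln (real k) + - ((ln (real k) + 1) * 2 ^ r))"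
    by (subst exp_add) (use k in simp)
  also have "\<dots> \<le> exp (- (2 ^ r))"
  proof -
    have "ln (real k) * 1 \<le> ln (real k) * 2 ^ r" using k by (intro mult_left_mono) auto
    then show ?thesis by (simp add: distrib_right)
  qed
  finally show ?thesis .
qed

lemma measurable_visit_cost [measurable]: "(\<lambda>\<omega>. ennreal (visit_cost \<omega> z V)) \<in> borel_measurable hash_space"
proof -
  have "(\<lambda>\<omega>. cell_cost \<omega> c) \<in> measurable hash_space (count_space UNIV)" for c
    unfolding cell_cost_def by measurable
  then have "(\<lambda>\<omega>. real (cell_cost \<omega> c)) \<in> borel_measurable hash_space" for c
    by measurable
  then show ?thesis unfolding visit_cost_def of_nat_sum by measurable
qed

lemma visit_cost_misses:
  assumes A: "A \<in> sets dart_space"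
  shows "(\<integral>\<^sup>+\<omega>. ennreal (visit_cost \<omega> scaled_x V) * indicator {\<omega>. \<forall>c\<in>visit scaled_x V. misses k \<omega> c A} \<omega> \<partial>hash_space)
     \<le> ennreal (2 * card (visit scaled_x V)) * emeasure hash_space {\<omega>. \<forall>c\<in>visit scaled_x V. misses k \<omega> c A}"
proof -
  let ?E = "{\<omega>. \<forall>c\<in>visit scaled_x V. misses k \<omega> c A}"
  have E: "?E \<in> sets hash_space" by (intro misses_all_meas A countable_finite finite_visit_xs)
  have "(\<integral>\<^sup>+\<omega>. ennreal (visit_cost \<omega> scaled_x V) * indicator ?E \<omega> \<partial>hash_space)
    = (\<integral>\<^sup>+\<omega>. (\<Sum>c\<in>visit scaled_x V. ennreal (1 + real (num_darts \<omega> c)) * indicator ?E \<omega>) \<partial>hash_space)"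
  proof (intro nn_integral_cong)
    fix \<omega>
    have "ennreal (visit_cost \<omega> scaled_x V) = ennreal (\<Sum>c\<in>visit scaled_x V. 1 + real (num_darts \<omega> c))"
      by (simp add: visit_cost_def cell_cost_def)
    also have "\<dots> = (\<Sum>c\<in>visit scaled_x V. ennreal (1 + real (num_darts \<omega> c)))"
      by (rule sum_ennreal[symmetric]) simp
    finally show "ennreal (visit_cost \<omega> scaled_x V) * indicator ?E \<omega> = (\<Sum>c\<in>visit scaled_x V. ennreal (1 + real (num_darts \<omega> c)) * indicator ?E \<omega>)"
      by (simp only: sum_distrib_right)
  qed
  also have "\<dots> = (\<Sum>c\<in>visit scaled_x V. \<integral>\<^sup>+\<omega>. ennreal (1 + real (num_darts \<omega> c)) * indicator ?E \<omega> \<partial>hash_space)"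
  proof (rule nn_integral_sum)
    fix c
    have "(\<lambda>\<omega>. ennreal (1 + real (num_darts \<omega> c))) \<in> borel_measurable hash_space" by measurable
    then show "(\<lambda>\<omega>. ennreal (1 + real (num_darts \<omega> c)) * indicator ?E \<omega>) \<in> borel_measurable hash_space"
      by (intro borel_measurable_times_ennreal borel_measurable_indicator E)
  qed
  also have "\<dots> \<le> (\<Sum>c\<in>visit scaled_x V. 2 * emeasure hash_space ?E)"
    by (intro sum_mono misses_cost finite_visit_xs A)
  also have "\<dots> = ennreal (2 * card (visit scaled_x V)) * emeasure hash_space ?E"
    by (simp add: ennreal_of_nat_eq_real_of_nat ennreal_mult mult_ac)
  finally show ?thesis .
qed

text \<open>Replaces the random number of rounds by a sum over all rounds: round r + 1 is charged
  once for every bin that is empty at horizon r, and it is run only if there is such a bin. Each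
  summand is a cost on a void event. 65 is 61 plus the constant 4 per round.\<close>

definition time_bound :: "hashfun \<Rightarrow> ennreal" where
  "time_bound \<omega> = ennreal (4 + 3 * norm0 d x) + 65 * (round_cost 0 \<omega> +
     (\<Sum>r. \<Sum>j<k. round_cost (Suc r) \<omega> * indicator (late r j) \<omega>))"

lemma integral_time_bound:
  "(\<integral>\<^sup>+\<omega>. time_bound \<omega> \<partial>hash_space) \<le> ennreal (70000 * (real k * ln (real k) + norm0 d x * weight_log d x))"
proof -
  let ?f = "\<lambda>r \<omega>. \<Sum>j<k. round_cost (Suc r) \<omega> * indicator (late r j) \<omega>"
  let ?p = "\<lambda>r. real k * exp (- ((ln (real k) + 1) * 2 ^ r))"
  let ?C = "\<lambda>r. visit scaled_x (horizon r)"
  define B where "B = 14 * (scaling k + norm0 d x * weight_log d x)"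
  have half: "1 / 2 \<le> norm0 d x * weight_log d x"
    using mult_mono[of 1 "real (norm0 d x)" "1 / 2" "weight_log d x"] norm0_ge_1[OF x] weight_log_bounds(1)[OF x] by simp
  have B0: "0 < B" unfolding B_def using half scaling_pos[OF k] by simp
  have card: "real (card (visit scaled_x (horizon r))) \<le> 2 ^ r * B" for r
    unfolding B_def by (rule card_visit[OF x scaling_pos[OF k]])
  have first: "(\<integral>\<^sup>+\<omega>. round_cost 0 \<omega> \<partial>hash_space) \<le> ennreal (2 * B)"
  proof -
    \<comment> \<open>The empty region is missed surely, so its conditional bound is the
      unconditional one for the first round.\<close>
    have all: "{\<omega>. \<forall>c\<in>visit scaled_x (horizon 0). misses k \<omega> c {}} = space hash_space" by (simp add: misses_def)
    have "(\<integral>\<^sup>+\<omega>. round_cost 0 \<omega> \<partial>hash_space) \<le> ennreal (2 * card (?C 0))"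
      using visit_cost_misses[of "{}" "horizon 0"] unfolding all hash_prob.emeasure_space_1 by (simp add: misses_def)
    also have "\<dots> \<le> ennreal (2 * B)" using card[of 0] by (intro ennreal_leI) simp
    finally show ?thesis .
  qed
  have round: "(\<integral>\<^sup>+\<omega>. ?f r \<omega> \<partial>hash_space) \<le> ennreal (8 * B * (1 / 2) ^ r)" for r
  proof -
    have "(\<integral>\<^sup>+\<omega>. ?f r \<omega> \<partial>hash_space)
      = (\<Sum>j<k. \<integral>\<^sup>+\<omega>. round_cost (Suc r) \<omega> * indicator (late r j) \<omega> \<partial>hash_space)"
      by (intro nn_integral_sum borel_measurable_times_ennreal measurable_visit_cost borel_measurable_indicator late_sets)
    also have "\<dots> \<le> (\<Sum>j<k. ennreal (2 * card (?C (Suc r))) * ennreal (exp (- ((ln k + 1) * 2 ^ r))))"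
    proof (rule sum_mono)
      fix j assume j: "j \<in> {..<k}"
      show "(\<integral>\<^sup>+\<omega>. round_cost (Suc r) \<omega> * indicator (late r j) \<omega> \<partial>hash_space)
        \<le> ennreal (2 * card (?C (Suc r))) * ennreal (exp (- ((ln k + 1) * 2 ^ r)))"
        using visit_cost_misses[OF reach_sets, of "horizon (Suc r)" j scaled_x "horizon r"] emeasure_late[of j r] j
        by (simp add: late_def)
    qed
    also have "\<dots> = ennreal (2 * card (?C (Suc r)) * (?p r))"
      by (simp add: ennreal_of_nat_eq_real_of_nat ennreal_mult[symmetric] mult_ac)
    also have "\<dots> \<le> ennreal (8 * B * (1 / 2) ^ r)"
    proof (rule ennreal_leI)
      define y :: real where "y = 2 ^ r"
      have y: "0 < y" by (simp add: y_def)
      \<comment> \<open>Round r + 1 has O(2^r) B cells, so a failure probability of order 4^-r is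
        enough to leave the geometric series with ratio 1 / 2.\<close>
      have "exp (- y) \<le> 2 / y\<^sup>2"
      proof -
        have "y\<^sup>2 / 2 \<le> exp y" using exp_lower_Taylor_quadratic[of y] y by simp
        then show ?thesis using y by (simp add: exp_minus field_simps)
      qed
      then have e: "?p r \<le> 2 / y\<^sup>2"
        using late_tail[of r] by (simp add: y_def)
      have c: "real (card (?C (Suc r))) \<le> 2 * y * B"
        using card[of "Suc r"] unfolding y_def power_Suc .
      have "(2 * real (card (?C (Suc r)))) * (?p r) \<le> (2 * (2 * y * B)) * (2 / y\<^sup>2)"
      proof (rule mult_mono[OF _ e])
        show "2 * real (card (?C (Suc r))) \<le> 2 * (2 * y * B)"
          using c by (rule mult_left_mono) simp
        show "0 \<le> 2 * (2 * y * B)" using y B0 by (intro mult_nonneg_nonneg) linarith+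
        show "0 \<le> ?p r" by (intro mult_nonneg_nonneg) auto
      qed
      also have "\<dots> = 8 * B * (1 / y)" using y by (simp add: power2_eq_square)
      also have "1 / y = (1 / 2) ^ r" by (simp add: y_def power_one_over)
      finally show "2 * card (?C (Suc r)) * (?p r) \<le> 8 * B * (1 / 2) ^ r"
        by (simp only: of_nat_mult of_nat_numeral)
    qed
    finally show ?thesis .
  qed
  have m: "(\<lambda>\<omega>. ?f r \<omega>) \<in> borel_measurable hash_space" for r
    by (intro borel_measurable_sum borel_measurable_times_ennreal measurable_visit_cost borel_measurable_indicator late_sets)
  let ?c = "\<lambda>\<omega>. round_cost 0 \<omega>"
  have ms: "(\<lambda>\<omega>. \<Sum>r. ?f r \<omega>) \<in> borel_measurable hash_space"
    using m[measurable] by measurable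
  have mc: "(\<lambda>\<omega>. ?c \<omega> + (\<Sum>r. ?f r \<omega>)) \<in> borel_measurable hash_space"
    by (rule borel_measurable_add[OF measurable_visit_cost ms])
  have "(\<integral>\<^sup>+\<omega>. time_bound \<omega> \<partial>hash_space) =
     (\<integral>\<^sup>+\<omega>. ennreal (4 + 3 * norm0 d x) \<partial>hash_space) + (\<integral>\<^sup>+\<omega>. 65 * (?c \<omega> + (\<Sum>r. ?f r \<omega>)) \<partial>hash_space)"
    unfolding time_bound_def by (rule nn_integral_add) (use mc in measurable)
  also have "(\<integral>\<^sup>+\<omega>. ennreal (4 + 3 * norm0 d x) \<partial>hash_space) = ennreal (4 + 3 * norm0 d x)"
    by (simp only: nn_integral_const hash_prob.emeasure_space_1 mult_1_right)
  also have "(\<integral>\<^sup>+\<omega>. 65 * (?c \<omega> + (\<Sum>r. ?f r \<omega>)) \<partial>hash_space) = 65 * (\<integral>\<^sup>+\<omega>. ?c \<omega> + (\<Sum>r. ?f r \<omega>) \<partial>hash_space)"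
    by (rule nn_integral_cmult[OF mc])
  also have "(\<integral>\<^sup>+\<omega>. ?c \<omega> + (\<Sum>r. ?f r \<omega>) \<partial>hash_space) = (\<integral>\<^sup>+\<omega>. ?c \<omega> \<partial>hash_space) + (\<integral>\<^sup>+\<omega>. (\<Sum>r. ?f r \<omega>) \<partial>hash_space)"
    by (rule nn_integral_add[OF measurable_visit_cost ms])
  also have "(\<integral>\<^sup>+\<omega>. (\<Sum>r. ?f r \<omega>) \<partial>hash_space) = (\<Sum>r. \<integral>\<^sup>+\<omega>. ?f r \<omega> \<partial>hash_space)"
    by (rule nn_integral_suminf) (rule m)
  finally have "(\<integral>\<^sup>+\<omega>. time_bound \<omega> \<partial>hash_space) =
     ennreal (4 + 3 * norm0 d x) + 65 * ((\<integral>\<^sup>+\<omega>. ?c \<omega> \<partial>hash_space) + (\<Sum>r. \<integral>\<^sup>+\<omega>. ?f r \<omega> \<partial>hash_space))" .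
  also have "\<dots> \<le> ennreal (4 + 3 * norm0 d x) + 65 * (ennreal (2 * B) + (\<Sum>r. ennreal (8 * B * (1 / 2) ^ r)))"
  proof -
    have "(\<Sum>r. \<integral>\<^sup>+\<omega>. ?f r \<omega> \<partial>hash_space) \<le> (\<Sum>r. ennreal (8 * B * (1 / 2) ^ r))"
      by (rule suminf_le[OF round summableI summableI])
    then show ?thesis
      by (rule add_left_mono[OF mult_left_mono[OF add_mono[OF first]]]) (rule zero_le)
  qed
  also have "(\<Sum>r. ennreal (8 * B * (1 / 2) ^ r)) = ennreal (16 * B)"
  proof (rule suminf_ennreal_eq)
    show "0 \<le> 8 * B * (1 / 2) ^ r" for r using B0 by simp
    show "(\<lambda>r. 8 * B * (1 / 2) ^ r) sums (16 * B)"
      using sums_mult[OF geometric_sums[of "1 / 2 :: real"], of "8 * B"] by simp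
  qed
  also have "ennreal (4 + 3 * norm0 d x) + 65 * (ennreal (2 * B) + ennreal (16 * B)) = ennreal (4 + 3 * norm0 d x + 65 * (18 * B))"
  proof -
    have "ennreal (2 * B) + ennreal (16 * B) = ennreal (2 * B + 16 * B)"
      by (rule ennreal_plus[symmetric]) (use B0 in auto)
    also have "2 * B + 16 * B = 18 * B" by simp
    finally have "65 * (ennreal (2 * B) + ennreal (16 * B)) = ennreal 65 * ennreal (18 * B)"
      by (simp only: ennreal_numeral)
    also have "\<dots> = ennreal (65 * (18 * B))"
      by (rule ennreal_mult[symmetric]) (use B0 in auto)
    finally have "65 * (ennreal (2 * B) + ennreal (16 * B)) = ennreal (65 * (18 * B))" .
    moreover have "ennreal (4 + 3 * norm0 d x) + ennreal (65 * (18 * B)) = ennreal (4 + 3 * norm0 d x + 65 * (18 * B))"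
      by (rule ennreal_plus[symmetric]) (use B0 in auto)
    ultimately show ?thesis by (simp only:)
  qed
  \<comment> \<open>Let T be the claimed bound without its constant; T is at least 1 / 2. Then B
    \<le> 14 * 4 T = 56 T, the rounds cost 65 * 18 * 56 T = 65520 T, and 4 + 3
    \<open>norm0 d x\<close> is at most 8 T + 6 T.\<close>
  also have "\<dots> \<le> ennreal (70000 * (real k * ln (real k) + norm0 d x * weight_log d x))"
  proof (rule ennreal_leI)
    have "real (norm0 d x) \<le> 2 * (norm0 d x * weight_log d x)"
      using mult_left_mono[OF weight_log_bounds(1)[OF x], of "norm0 d x"] by simp
    moreover have "B \<le> 56 * (real k * ln (real k) + norm0 d x * weight_log d x)"
      unfolding B_def using scaling_le[OF k half] by simp
    moreover have "0 \<le> real k * ln (real k)" using k by simp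
    ultimately show "4 + 3 * norm0 d x + 65 * (18 * B) \<le> 70000 * (real k * ln (real k) + norm0 d x * weight_log d x)"
      using half by simp
  qed
  finally show ?thesis .
qed

lemma AE_filled: "AE \<omega> in hash_space. \<exists>r. bins r \<omega> = {..<k}"
proof -
  have "AE \<omega> in hash_space. \<forall>j\<in>{..<k}. hit_time k (scaling k) j \<omega> x < \<infinity>"
  proof (rule AE_finite_allI)
    fix j assume "j \<in> {..<k}"
    then show "AE \<omega> in hash_space. hit_time k (scaling k) j \<omega> x < \<infinity>"
      by (intro AE_hit_time_finite[OF _ scaling_pos[OF k] x]) simp
  qed simp
  then show ?thesis
    using AE_hash_range
  proof eventually_elim
    case (elim \<omega>)
    have "\<exists>r. j \<in> bins r \<omega>" if "j < k" for j
    proof -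
      have "hit_time k (scaling k) j \<omega> x < \<infinity>" using elim(1) that by blast
      then have "hit_time k (scaling k) j \<omega> x \<noteq> \<infinity>" by simp
      then obtain y where y: "hit_time k (scaling k) j \<omega> x < ereal y"
        unfolding less_PInf_Ex_of_nat by blast
      obtain r where "y * norm1 d x < 2 ^ r" using real_arch_pow[of 2 "y * norm1 d x"] by auto
      then have "y < horizon r" using norm1_pos[OF x] by (simp add: pos_less_divide_eq)
      then have "\<not> ereal (horizon r) \<le> hit_time k (scaling k) j \<omega> x"
        using less_trans[OF y, of "ereal (horizon r)"] by (simp add: not_le)
      then show ?thesis unfolding bin_missing_hit_time[OF elim(2), symmetric] by blast
    qed
    then obtain r where r: "\<And>j. j < k \<Longrightarrow> j \<in> bins (r j) \<omega>" by metis
    \<comment> \<open>The sum is a convenient upper bound for the rounds in which the single bins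
      are first known to be filled.\<close>
    define R where "R = (\<Sum>j<k. r j)"
    have "j \<in> bins R \<omega>" if "j < k" for j
    proof -
      have "r j \<le> R" unfolding R_def using that by (intro member_le_sum) auto
      then have "found k \<omega> scaled_x (horizon (r j)) \<subseteq> found k \<omega> scaled_x (horizon R)"
        by (intro found_mono horizon_mono)
      then show ?thesis using r[OF that] by blast
    qed
    then have "{..<k} \<subseteq> bins R \<omega>" by blast
    with found_bins[OF elim(2) k] show ?case by (intro exI[of _ R] equalityI)
  qed
qed

lemma minhash_prog_correct:
  assumes U: "unit_valued \<omega>" and filled: "\<exists>r. bins r \<omega> = {..<k}"
    and en: "enumerates is (supp d x)"
  shows "outputs \<omega> minhash_prog (input k is x) k (\<lambda>j. minhash k (scaling k) j \<omega> x)"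
    and "run_time \<omega> minhash_prog (input k is x) \<le> time_bound \<omega>"
proof -
  define R where "R = (LEAST r. bins r \<omega> = {..<k})"
  have R: "bins R \<omega> = {..<k}"
    unfolding R_def by (rule LeastI_ex) (rule filled)
  have sub: "bins r \<omega> \<subset> {..<k}" if "r < R" for r
    using found_bins[OF U k, of scaled_x "horizon r"] not_less_Least[OF that[unfolded R_def]] by blast
  have len: "length is = norm0 d x"
    using en distinct_card[of "is"] by (auto simp: enumerates_def norm0_def)
  have wp: "wp \<omega> minhash_prog (\<lambda>m t. m \<le> 4 + 3 * length is + (\<Sum>r\<le>R. 4 + 61 * visit_cost \<omega> scaled_x (horizon r)) \<and>
      recorded (found k \<omega> scaled_x (horizon R)) t) (input k is x)"
  proof (rule wp_minhash_prog[OF k x en U])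
    show "card (bins r \<omega>) < k" if "r < R" for r
      using psubset_card_mono[OF _ sub[OF that]] by simp
    show "card (bins R \<omega>) = k" using R by simp
  qed
  show "outputs \<omega> minhash_prog (input k is x) k (\<lambda>j. minhash k (scaling k) j \<omega> x)"
  proof -
    obtain n t where t: "exec \<omega> minhash_prog (input k is x) n t" "recorded (found k \<omega> scaled_x (horizon R)) t"
      using wp by (auto simp: wp_def)
    have "rmem t ''out'' j = minhash k (scaling k) j \<omega> x" if "j < k" for j
      by (rule minhash_recorded[OF U t(2)]) (use R that in blast)
    with t(1) show ?thesis unfolding outputs_def by (intro exI conjI allI impI)
  qed
  have cost1: "1 \<le> visit_cost \<omega> scaled_x (horizon r)" for r
  proof -
    have "supp d x \<noteq> {}" using norm0_ge_1[OF x] by (auto simp: norm0_def)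
    then obtain i where "i \<in> supp d x" by auto
    then have "0 < x i" using x by (auto simp: supp_def weighted_sets_def less_le)
    then have "0 < scaled_x i" using scaling_pos[OF k] by simp
    then have "(i, 2, 0, 0) \<in> visit scaled_x (horizon r)"
      using visit_coordinate[where z = scaled_x and i = i, OF _ horizon_pos[of r]] by blast
    then have "cell_cost \<omega> (i, 2, 0, 0) \<le> visit_cost \<omega> scaled_x (horizon r)"
      unfolding visit_cost_def using finite_visit_xs by (intro member_le_sum) auto
    then show ?thesis by (simp add: cell_cost_def)
  qed
  have "run_time \<omega> minhash_prog (input k is x) \<le> of_nat (4 + 3 * length is + (\<Sum>r\<le>R. 4 + 61 * visit_cost \<omega> scaled_x (horizon r)))"
    by (rule run_time_le[OF wp]) simp
  also have "\<dots> \<le> of_nat (4 + 3 * norm0 d x + 65 * (\<Sum>r\<le>R. visit_cost \<omega> scaled_x (horizon r)))"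
    unfolding len sum_distrib_left 
  proof (intro of_nat_mono add_left_mono sum_mono)
    fix r show "4 + 61 * visit_cost \<omega> scaled_x (horizon r) \<le> 65 * visit_cost \<omega> scaled_x (horizon r)"
      using cost1[of r] by linarith
  qed
  also have "\<dots> = ennreal (4 + 3 * norm0 d x) + 65 * (\<Sum>r\<le>R. round_cost r \<omega>)"
  proof -
    define S where "S = (\<Sum>r\<le>R. real (visit_cost \<omega> scaled_x (horizon r)))"
    have S: "0 \<le> S" unfolding S_def by (rule sum_nonneg) simp
    have "(\<Sum>r\<le>R. round_cost r \<omega>) = ennreal S"
      unfolding S_def by (rule sum_ennreal) simp
    moreover have "of_nat (4 + 3 * norm0 d x + 65 * (\<Sum>r\<le>R. visit_cost \<omega> scaled_x (horizon r))) = ennreal (real (4 + 3 * norm0 d x) + 65 * S)"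
      unfolding ennreal_of_nat_eq_real_of_nat S_def by simp
    moreover have "ennreal (real (4 + 3 * norm0 d x) + 65 * S) = ennreal (real (4 + 3 * norm0 d x)) + ennreal (65 * S)"
      by (rule ennreal_plus) (use S in auto)
    moreover have "ennreal (65 * S) = ennreal 65 * ennreal S"
      by (rule ennreal_mult) (use S in auto)
    ultimately show ?thesis by (simp only: ennreal_numeral)
  qed
  also have "\<dots> \<le> time_bound \<omega>"
    unfolding time_bound_def
  proof (intro add_left_mono mult_left_mono)
    let ?f = "\<lambda>r. \<Sum>j<k. round_cost (Suc r) \<omega> * indicator (late r j) \<omega>"
    have "(\<Sum>r\<le>R. round_cost r \<omega>) = round_cost 0 \<omega> + (\<Sum>r<R. round_cost (Suc r) \<omega>)"
      by (rule sum.atMost_shift)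
    also have "(\<Sum>r<R. round_cost (Suc r) \<omega>) \<le> (\<Sum>r<R. ?f r)"
    proof (rule sum_mono)
      fix r assume "r \<in> {..<R}"
      \<comment> \<open>A bin that is empty at horizon r is missed by the cells of that round. The
        additional cells of round r + 1 lie outside the region at horizon r and miss it anyway, so
        the event \<open>late r j\<close> occurs.\<close>
      then obtain j where j: "j < k" "j \<notin> bins r \<omega>" using sub[of r] by auto
      have "reach j scaled_x (horizon r) \<subseteq> below scaled_x (horizon r)" by (auto simp: reach_def below_def)
      then have "\<omega> \<in> late r j"
        using j(2) misses_outside_visit[OF U, of "reach j scaled_x (horizon r)" scaled_x "horizon r"] visit_subset
        unfolding late_def bin_missing_iff by blast
      then have "round_cost (Suc r) \<omega> = round_cost (Suc r) \<omega> * indicator (late r j) \<omega>" by simp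
      also have "\<dots> \<le> ?f r" using j by (intro member_le_sum) auto
      finally show "round_cost (Suc r) \<omega> \<le> ?f r" .
    qed
    also have "(\<Sum>r<R. ?f r) \<le> (\<Sum>r. ?f r)" by (intro sum_le_suminf) auto
    finally show "(\<Sum>r\<le>R. round_cost r \<omega>) \<le> round_cost 0 \<omega> + (\<Sum>r. ?f r)"
      by (simp add: add_left_mono)
  qed auto
  finally show "run_time \<omega> minhash_prog (input k is x) \<le> time_bound \<omega>" .
qed

end

theorem theorem1:
  "\<exists>(P :: com) (C :: real). \<forall>k\<ge>1. \<forall>d.
     \<exists>h :: nat \<Rightarrow> hashfun \<Rightarrow> (nat \<Rightarrow> real) \<Rightarrow> real.
       indep_weighted_minhashes d k hash_space h \<and>
       (\<forall>x\<in>weighted_sets d. \<forall>is. enumerates is (supp d x) \<longrightarrow>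
          (AE \<omega> in hash_space. outputs \<omega> P (input k is x) k (\<lambda>j. h j \<omega> x)) \<and>
          expected_time P (input k is x)
            \<le> ennreal (C * (real k * ln (real k) +
                real (norm0 d x) * ln (norm1 d x + 1 / norm1 d x))))"
proof (intro exI[of _ minhash_prog] exI[of _ 70000] allI impI)
  fix k d :: nat assume k: "1 \<le> k"
  have "(AE \<omega> in hash_space. outputs \<omega> minhash_prog (input k is x) k (\<lambda>j. minhash k (scaling k) j \<omega> x)) \<and>
      expected_time minhash_prog (input k is x)
        \<le> ennreal (70000 * (real k * ln (real k) + real (norm0 d x) * ln (norm1 d x + 1 / norm1 d x)))"
    if x: "x \<in> weighted_sets d" and en: "enumerates is (supp d x)" for x "is"
  proof
    show "AE \<omega> in hash_space. outputs \<omega> minhash_prog (input k is x) k (\<lambda>j. minhash k (scaling k) j \<omega> x)"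
      using AE_hash_range AE_filled[OF k x]
      by eventually_elim (rule minhash_prog_correct(1)[OF k x _ _ en])
    have "AE \<omega> in hash_space. run_time \<omega> minhash_prog (input k is x) \<le> time_bound k d x \<omega>"
      using AE_hash_range AE_filled[OF k x]
      by eventually_elim (rule minhash_prog_correct(2)[OF k x _ _ en])
    then show "expected_time minhash_prog (input k is x)
        \<le> ennreal (70000 * (real k * ln (real k) + real (norm0 d x) * ln (norm1 d x + 1 / norm1 d x)))"
      unfolding expected_time_def by (rule order_trans[OF nn_integral_mono_AE integral_time_bound[OF k x]])
  qed
  with indep_weighted_minhashes_minhash[OF scaling_pos[OF k]]
  show "\<exists>h. indep_weighted_minhashes d k hash_space h \<and>
       (\<forall>x\<in>weighted_sets d. \<forall>is. enumerates is (supp d x) \<longrightarrow>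
          (AE \<omega> in hash_space. outputs \<omega> minhash_prog (input k is x) k (\<lambda>j. h j \<omega> x)) \<and>
          expected_time minhash_prog (input k is x)
            \<le> ennreal (70000 * (real k * ln (real k) +
                real (norm0 d x) * ln (norm1 d x + 1 / norm1 d x))))"
    by blast
qed

end
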